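(* A torsionless connection $\tilde\nabla$ on an $n$-dimensional manifold $M$ is projectively equivalent to a Levi-Civita connection $\hat\nabla$ of a metric $\hat g_{ab}$ if and only if its projective class $[\tilde\nabla]$ contains a special projective subclass $[\nabla]$ whose connections $\nabla$ satisfy the following: for every $\nabla\in[\nabla]$ there exists a nondegenerate symmetric tensor $g^{ab}$ and a vector field $\mu^a$ on $M$ such that $$\nabla_c g^{ab}=\mu^a\delta^b_{~c}+\mu^b\delta^a_{~c},$$ or, what is the same, $$\mathrm{D}g^{ab}=\mu^a\theta^b+\mu^b\theta^a.$$
   Context: Metrics may be Riemannian or pseudo-Riemannian. Two torsionless connections $\hat\nabla,\nabla$ on $M$ are projectively equivalent iff there is a 1-form $A$ on $M$ with $\hat\nabla_XY=\nabla_XY+A(X)Y+A(Y)X$ for all vector fields $X,Y$; the equivalence class of a connection is its projective class. Let $(X_a)$ be a frame on $M$ with dual coframe $(\theta^a)$, and write $\nabla_a:=\nabla_{X_a}$. For a torsionless connection $\nabla$ the connection 1-forms are $\Gamma^a_{~b}=\Gamma^a_{~bc}\theta^c$, where $\nabla_aX_b=\Gamma^c_{~ba}X_c$. The covariant exterior differential $\mathrm{D}$ acts on $g^{ab}$ by $\mathrm{D}g^{ab}=dg^{ab}+\Gamma^a_{~c}g^{cb}+\Gamma^b_{~c}g^{ac}=\theta^c\nabla_cg^{ab}$. Put $\Omega^a_{~b}=d\Gamma^a_{~b}+\Gamma^a_{~c}\wedge\Gamma^c_{~b}=\frac12R^a_{~bcd}\theta^c\wedge\theta^d$ and $R_{ab}=R^c_{~acb}$;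 the projective Schouten tensor of $\nabla$ is $\mathsf P_{ab}=\frac1{n-1}R_{(ab)}-\frac1{n+1}R_{[ab]}$ (round and square brackets denote symmetrization and antisymmetrization with factor $\frac12$). A special projective subclass of a projective class is the subclass of those projectively equivalent connections in it for which $\mathsf P_{ab}$ is symmetric; locally every projective class contains such a subclass, and it is given modulo projective changes with $A=d\phi$ a gradient. Connections in a special projective subclass are called special.
   Formalization: The equivalence on all of M is stated for M on which closed 1-forms are gradients (it fails e.g. for a flat torus, where the special connection with A = c dx admits no solution); for arbitrary M both sides are taken locally, near every point. *)

theory Defs
  imports "HOL-Analysis.Analysis"
begin

section \<open>Smooth manifolds\<close>

definition partial_deriv :: "'n::finite \<Rightarrow> (real^'n \<Rightarrow> real) \<Rightarrow> real^'n \<Rightarrow> real" where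
  "partial_deriv i f = (\<lambda>x. frechet_derivative f (at x) (axis i 1))"

text \<open>\<open>C_diff k S f\<close>: \<open>f\<close> is of class \<open>C\<^sup>k\<close> on the open set \<open>S\<close>.\<close>

fun C_diff :: "nat \<Rightarrow> (real^'n::finite) set \<Rightarrow> (real^'n \<Rightarrow> real) \<Rightarrow> bool" where
  "C_diff 0 S f \<longleftrightarrow> continuous_on S f"
| "C_diff (Suc k) S f \<longleftrightarrow>
     (\<forall>x\<in>S. f differentiable (at x)) \<and> (\<forall>i. C_diff k S (partial_deriv i f))"

definition smooth_on :: "(real^'n::finite) set \<Rightarrow> (real^'n \<Rightarrow> real) \<Rightarrow> bool" where
  "smooth_on S f \<longleftrightarrow> (\<forall>k. C_diff k S f)"

text \<open>
  The points of the manifold are the elements of a Hausdorff, second countable type \<open>'m\<close>; the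
  dimension is \<open>CARD('n)\<close>. A chart is a pair of its domain and its coordinate map, and the
  smooth structure is given by an atlas, written \<open>M\<close> throughout. All notions
  are relative to an open set \<open>U\<close>; the whole manifold is \<open>UNIV\<close>.
\<close>

type_synonym ('m, 'n) atlas = "('m set \<times> ('m \<Rightarrow> real^'n)) set"

definition chart :: "'m::topological_space set \<Rightarrow> ('m \<Rightarrow> real^'n::finite) \<Rightarrow> bool" where
  "chart V x \<longleftrightarrow> open V \<and> open (x ` V) \<and> homeomorphism V (x ` V) x (inv_into V x)"

definition smooth_manifold ::
    "('m::{t2_space, second_countable_topology}, 'n::finite) atlas \<Rightarrow> bool" where
  "smooth_manifold M \<longleftrightarrow>
     (\<forall>(V, x)\<in>M. chart V x) \<and>
     (\<Union>(V, x)\<in>M. V) = UNIV \<and>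
     (\<forall>(V, x)\<in>M. \<forall>(W, y)\<in>M. \<forall>i. smooth_on (x ` (V \<inter> W)) (\<lambda>z. y (inv_into V x z) $ i))"

definition smooth_fun ::
    "('m::topological_space, 'n::finite) atlas \<Rightarrow> 'm set \<Rightarrow> ('m \<Rightarrow> real) \<Rightarrow> bool" where
  "smooth_fun M U f \<longleftrightarrow> (\<forall>(V, x)\<in>M. smooth_on (x ` (U \<inter> V)) (\<lambda>z. f (inv_into V x z)))"

definition smooth_near ::
    "('m::topological_space, 'n::finite) atlas \<Rightarrow> 'm \<Rightarrow> ('m \<Rightarrow> real) \<Rightarrow> bool" where
  "smooth_near M p f \<longleftrightarrow> (\<exists>U. open U \<and> p \<in> U \<and> smooth_fun M U f)"


section \<open>Vector fields and tensor fields\<close>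

text \<open>
  Tangent vectors at \<open>p\<close> are the derivations of the functions smooth near \<open>p\<close>. Functions that are not
  smooth near \<open>p\<close> are sent to \<open>0\<close>, so that equality of tangent vectors is equality of functions.
  Likewise covectors vanish by convention outside the tangent space.
\<close>

type_synonym 'm tvec = "('m \<Rightarrow> real) \<Rightarrow> real"
type_synonym 'm vfield = "'m \<Rightarrow> 'm tvec"
type_synonym 'm covec = "'m tvec \<Rightarrow> real"
type_synonym 'm form = "'m \<Rightarrow> 'm covec"

definition tangent_space ::
    "('m::topological_space, 'n::finite) atlas \<Rightarrow> 'm \<Rightarrow> 'm tvec set" where
  "tangent_space M p = {v.
     (\<forall>f. \<not> smooth_near M p f \<longrightarrow> v f = 0) \<and>
     (\<forall>f g. smooth_near M p f \<longrightarrow> smooth_near M p g \<longrightarrow>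
        v (\<lambda>q. f q + g q) = v f + v g \<and>
        v (\<lambda>q. f q * g q) = f p * v g + g p * v f) \<and>
     (\<forall>c f. smooth_near M p f \<longrightarrow> v (\<lambda>q. c * f q) = c * v f)}"

definition cotangent_space ::
    "('m::topological_space, 'n::finite) atlas \<Rightarrow> 'm \<Rightarrow> 'm covec set" where
  "cotangent_space M p = {\<alpha>.
     (\<forall>v. v \<notin> tangent_space M p \<longrightarrow> \<alpha> v = 0) \<and>
     (\<forall>v\<in>tangent_space M p. \<forall>w\<in>tangent_space M p. \<forall>a b.
        \<alpha> (\<lambda>f. a * v f + b * w f) = a * \<alpha> v + b * \<alpha> w)}"

definition vector_field ::
    "('m::topological_space, 'n::finite) atlas \<Rightarrow> 'm set \<Rightarrow> 'm vfield \<Rightarrow> bool" where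
  "vector_field M U X \<longleftrightarrow>
     (\<forall>p\<in>U. X p \<in> tangent_space M p) \<and>
     (\<forall>W f. open W \<longrightarrow> W \<subseteq> U \<longrightarrow> smooth_fun M W f \<longrightarrow> smooth_fun M W (\<lambda>p. X p f))"

definition lie_bracket ::
    "('m::topological_space, 'n::finite) atlas \<Rightarrow> 'm vfield \<Rightarrow> 'm vfield \<Rightarrow> 'm vfield" where
  "lie_bracket M X Y = (\<lambda>p f.
     if smooth_near M p f then X p (\<lambda>q. Y q f) - Y p (\<lambda>q. X q f) else 0)"

definition one_form ::
    "('m::topological_space, 'n::finite) atlas \<Rightarrow> 'm set \<Rightarrow> 'm form \<Rightarrow> bool" where
  "one_form M U A \<longleftrightarrow>
     (\<forall>p\<in>U. A p \<in> cotangent_space M p) \<and>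
     (\<forall>W X. open W \<longrightarrow> W \<subseteq> U \<longrightarrow> vector_field M W X \<longrightarrow> smooth_fun M W (\<lambda>p. A p (X p)))"

definition differential ::
    "('m::topological_space, 'n::finite) atlas \<Rightarrow> ('m \<Rightarrow> real) \<Rightarrow> 'm form" where
  "differential M \<phi> = (\<lambda>p v. if v \<in> tangent_space M p then v \<phi> else 0)"

definition ext_deriv ::
    "('m::topological_space, 'n::finite) atlas \<Rightarrow> 'm form \<Rightarrow> 'm vfield \<Rightarrow> 'm vfield \<Rightarrow> 'm \<Rightarrow> real" where
  "ext_deriv M A X Y p =
     X p (\<lambda>q. A q (Y q)) - Y p (\<lambda>q. A q (X q)) - A p (lie_bracket M X Y p)"

definition wedge :: "'m form \<Rightarrow> 'm form \<Rightarrow> 'm vfield \<Rightarrow> 'm vfield \<Rightarrow> 'm \<Rightarrow> real" where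
  "wedge A B X Y p = A p (X p) * B p (Y p) - A p (Y p) * B p (X p)"

definition closed_form ::
    "('m::topological_space, 'n::finite) atlas \<Rightarrow> 'm set \<Rightarrow> 'm form \<Rightarrow> bool" where
  "closed_form M U A \<longleftrightarrow> one_form M U A \<and>
     (\<forall>W X Y. open W \<longrightarrow> W \<subseteq> U \<longrightarrow> vector_field M W X \<longrightarrow> vector_field M W Y \<longrightarrow>
        (\<forall>p\<in>W. ext_deriv M A X Y p = 0))"

text \<open>
  \<open>H\<^sup>1(U) = 0\<close> in de Rham cohomology, as e.g. on coordinate balls. Two projectively
  equivalent connections with symmetric Schouten tensor differ by a closed one-form; this condition
  makes a special projective subclass on \<open>U\<close> one that is given modulo projective changes with
  \<open>A = d\<phi>\<close>.
\<close>

definition closed_forms_are_gradients ::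
    "('m::topological_space, 'n::finite) atlas \<Rightarrow> 'm set \<Rightarrow> bool" where
  "closed_forms_are_gradients M U \<longleftrightarrow>
     (\<forall>A. closed_form M U A \<longrightarrow> (\<exists>\<phi>. smooth_fun M U \<phi> \<and> (\<forall>p\<in>U. A p = differential M \<phi> p)))"

text \<open>
  Nondegenerate symmetric tensor fields of type \<open>g\<^sub>a\<^sub>b\<close> and \<open>g\<^sup>a\<^sup>b\<close>. There is no
  condition on the signature, so that metrics may be Riemannian or pseudo-Riemannian.
\<close>

definition metric ::
    "('m::topological_space, 'n::finite) atlas \<Rightarrow> 'm set \<Rightarrow> ('m \<Rightarrow> 'm tvec \<Rightarrow> 'm tvec \<Rightarrow> real) \<Rightarrow> bool" where
  "metric M U g \<longleftrightarrow>
     (\<forall>p\<in>U.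
        (\<forall>u\<in>tangent_space M p. \<forall>v\<in>tangent_space M p. g p u v = g p v u) \<and>
        (\<forall>u\<in>tangent_space M p. \<forall>v\<in>tangent_space M p. \<forall>w\<in>tangent_space M p. \<forall>a b.
           g p (\<lambda>f. a * u f + b * v f) w = a * g p u w + b * g p v w) \<and>
        (\<forall>u\<in>tangent_space M p.
           (\<forall>v\<in>tangent_space M p. g p u v = 0) \<longrightarrow> u = (\<lambda>f. 0))) \<and>
     (\<forall>W X Y. open W \<longrightarrow> W \<subseteq> U \<longrightarrow> vector_field M W X \<longrightarrow> vector_field M W Y \<longrightarrow>
        smooth_fun M W (\<lambda>p. g p (X p) (Y p)))"

definition sym_tensor ::
    "('m::topological_space, 'n::finite) atlas \<Rightarrow> 'm set \<Rightarrow> ('m \<Rightarrow> 'm covec \<Rightarrow> 'm covec \<Rightarrow> real) \<Rightarrow> bool" where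
  "sym_tensor M U g \<longleftrightarrow>
     (\<forall>p\<in>U.
        (\<forall>\<alpha>\<in>cotangent_space M p. \<forall>\<beta>\<in>cotangent_space M p. g p \<alpha> \<beta> = g p \<beta> \<alpha>) \<and>
        (\<forall>\<alpha>\<in>cotangent_space M p. \<forall>\<beta>\<in>cotangent_space M p. \<forall>\<gamma>\<in>cotangent_space M p. \<forall>a b.
           g p (\<lambda>v. a * \<alpha> v + b * \<beta> v) \<gamma> = a * g p \<alpha> \<gamma> + b * g p \<beta> \<gamma>)) \<and>
     (\<forall>W \<alpha> \<beta>. open W \<longrightarrow> W \<subseteq> U \<longrightarrow> one_form M W \<alpha> \<longrightarrow> one_form M W \<beta> \<longrightarrow>
        smooth_fun M W (\<lambda>p. g p (\<alpha> p) (\<beta> p)))"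

definition nondegenerate_tensor ::
    "('m::topological_space, 'n::finite) atlas \<Rightarrow> 'm set \<Rightarrow> ('m \<Rightarrow> 'm covec \<Rightarrow> 'm covec \<Rightarrow> real) \<Rightarrow> bool" where
  "nondegenerate_tensor M U g \<longleftrightarrow>
     (\<forall>p\<in>U. \<forall>\<alpha>\<in>cotangent_space M p.
        (\<forall>\<beta>\<in>cotangent_space M p. g p \<alpha> \<beta> = 0) \<longrightarrow> \<alpha> = (\<lambda>v. 0))"


section \<open>Connections\<close>

text \<open>
  A connection is given by its action on the smooth vector fields on all open subsets, compatibly
  with restriction (the last clause); its values on anything else are irrelevant, and
  connections are therefore only ever compared on smooth vector fields.
\<close>

type_synonym 'm conn = "'m vfield \<Rightarrow> 'm vfield \<Rightarrow> 'm vfield"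

definition connection ::
    "('m::topological_space, 'n::finite) atlas \<Rightarrow> 'm set \<Rightarrow> 'm conn \<Rightarrow> bool" where
  "connection M U D \<longleftrightarrow>
     (\<forall>W X Y. open W \<longrightarrow> W \<subseteq> U \<longrightarrow> vector_field M W X \<longrightarrow> vector_field M W Y \<longrightarrow>
        vector_field M W (D X Y) \<and>
        (\<forall>X'. vector_field M W X' \<longrightarrow>
           (\<forall>p\<in>W. D (\<lambda>q f. X q f + X' q f) Y p = (\<lambda>f. D X Y p f + D X' Y p f))) \<and>
        (\<forall>Y'. vector_field M W Y' \<longrightarrow>
           (\<forall>p\<in>W. D X (\<lambda>q f. Y q f + Y' q f) p = (\<lambda>f. D X Y p f + D X Y' p f))) \<and>
        (\<forall>h. smooth_fun M W h \<longrightarrow>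
           (\<forall>p\<in>W. D (\<lambda>q f. h q * X q f) Y p = (\<lambda>f. h p * D X Y p f) \<and>
                  D X (\<lambda>q f. h q * Y q f) p = (\<lambda>f. h p * D X Y p f + X p h * Y p f))) \<and>
        (\<forall>X' Y'. (\<forall>p\<in>W. X' p = X p \<and> Y' p = Y p) \<longrightarrow> (\<forall>p\<in>W. D X' Y' p = D X Y p)))"

definition torsionless_connection ::
    "('m::topological_space, 'n::finite) atlas \<Rightarrow> 'm set \<Rightarrow> 'm conn \<Rightarrow> bool" where
  "torsionless_connection M U D \<longleftrightarrow> connection M U D \<and>
     (\<forall>W X Y. open W \<longrightarrow> W \<subseteq> U \<longrightarrow> vector_field M W X \<longrightarrow> vector_field M W Y \<longrightarrow>
        (\<forall>p\<in>W. (\<lambda>f. D X Y p f - D Y X p f) = lie_bracket M X Y p))"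

definition levi_civita ::
    "('m::topological_space, 'n::finite) atlas \<Rightarrow> 'm set \<Rightarrow>
     ('m \<Rightarrow> 'm tvec \<Rightarrow> 'm tvec \<Rightarrow> real) \<Rightarrow> 'm conn \<Rightarrow> bool" where
  "levi_civita M U g D \<longleftrightarrow> torsionless_connection M U D \<and>
     (\<forall>W X Y Z. open W \<longrightarrow> W \<subseteq> U \<longrightarrow>
        vector_field M W X \<longrightarrow> vector_field M W Y \<longrightarrow> vector_field M W Z \<longrightarrow>
        (\<forall>p\<in>W. Z p (\<lambda>q. g q (X q) (Y q)) = g p (D Z X p) (Y p) + g p (X p) (D Z Y p)))"

definition projectively_equivalent ::
    "('m::topological_space, 'n::finite) atlas \<Rightarrow> 'm set \<Rightarrow> 'm conn \<Rightarrow> 'm conn \<Rightarrow> bool" where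
  "projectively_equivalent M U D' D \<longleftrightarrow>
     (\<exists>A. one_form M U A \<and>
        (\<forall>W X Y. open W \<longrightarrow> W \<subseteq> U \<longrightarrow> vector_field M W X \<longrightarrow> vector_field M W Y \<longrightarrow>
           (\<forall>p\<in>W. D' X Y p = (\<lambda>f. D X Y p f + A p (X p) * Y p f + A p (Y p) * X p f))))"

definition projective_class ::
    "('m::topological_space, 'n::finite) atlas \<Rightarrow> 'm set \<Rightarrow> 'm conn \<Rightarrow> 'm conn set" where
  "projective_class M U D = {D'. torsionless_connection M U D' \<and> projectively_equivalent M U D' D}"


section \<open>Frames, connection forms and curvature\<close>

definition frame ::
    "('m::topological_space, 'n::finite) atlas \<Rightarrow> 'm set \<Rightarrow> ('n \<Rightarrow> 'm vfield) \<Rightarrow> bool" where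
  "frame M W E \<longleftrightarrow>
     (\<forall>a. vector_field M W (E a)) \<and>
     (\<forall>p\<in>W. \<forall>v\<in>tangent_space M p. \<exists>!\<xi>::real^'n. v = (\<lambda>f. \<Sum>a\<in>UNIV. \<xi> $ a * E a p f))"

definition coframe ::
    "('m::topological_space, 'n::finite) atlas \<Rightarrow> ('n \<Rightarrow> 'm vfield) \<Rightarrow> 'n \<Rightarrow> 'm form" where
  "coframe M E a = (\<lambda>p v.
     if v \<in> tangent_space M p
     then (THE \<xi>::real^'n. v = (\<lambda>f. \<Sum>b\<in>UNIV. \<xi> $ b * E b p f)) $ a else 0)"

text \<open>\<open>\<Gamma>\<^sup>a\<^sub>b\<^sub>c\<close>, where the last index is the direction of differentiation:
  \<open>\<nabla>\<^sub>a X\<^sub>b = \<Gamma>\<^sup>c\<^sub>b\<^sub>a X\<^sub>c\<close>.\<close>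

definition conn_coeff ::
    "('m::topological_space, 'n::finite) atlas \<Rightarrow> 'm conn \<Rightarrow> ('n \<Rightarrow> 'm vfield) \<Rightarrow>
     'n \<Rightarrow> 'n \<Rightarrow> 'n \<Rightarrow> 'm \<Rightarrow> real" where
  "conn_coeff M D E a b c p = coframe M E a p (D (E c) (E b) p)"

definition conn_form ::
    "('m::topological_space, 'n::finite) atlas \<Rightarrow> 'm conn \<Rightarrow> ('n \<Rightarrow> 'm vfield) \<Rightarrow>
     'n \<Rightarrow> 'n \<Rightarrow> 'm form" where
  "conn_form M D E a b = (\<lambda>p v. \<Sum>c\<in>UNIV. conn_coeff M D E a b c p * coframe M E c p v)"

definition curv_form ::
    "('m::topological_space, 'n::finite) atlas \<Rightarrow> 'm conn \<Rightarrow> ('n \<Rightarrow> 'm vfield) \<Rightarrow>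
     'n \<Rightarrow> 'n \<Rightarrow> 'm vfield \<Rightarrow> 'm vfield \<Rightarrow> 'm \<Rightarrow> real" where
  "curv_form M D E a b X Y p =
     ext_deriv M (conn_form M D E a b) X Y p
     + (\<Sum>c\<in>UNIV. wedge (conn_form M D E a c) (conn_form M D E c b) X Y p)"

text \<open>\<open>\<Omega>\<^sup>a\<^sub>b = (1/2) R\<^sup>a\<^sub>b\<^sub>c\<^sub>d \<theta>\<^sup>c \<and> \<theta>\<^sup>d\<close> means
  \<open>\<Omega>\<^sup>a\<^sub>b(X\<^sub>c, X\<^sub>d) = R\<^sup>a\<^sub>b\<^sub>c\<^sub>d\<close>.\<close>

definition curvature ::
    "('m::topological_space, 'n::finite) atlas \<Rightarrow> 'm conn \<Rightarrow> ('n \<Rightarrow> 'm vfield) \<Rightarrow>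
     'n \<Rightarrow> 'n \<Rightarrow> 'n \<Rightarrow> 'n \<Rightarrow> 'm \<Rightarrow> real" where
  "curvature M D E a b c d p = curv_form M D E a b (E c) (E d) p"

definition ricci ::
    "('m::topological_space, 'n::finite) atlas \<Rightarrow> 'm conn \<Rightarrow> ('n \<Rightarrow> 'm vfield) \<Rightarrow>
     'n \<Rightarrow> 'n \<Rightarrow> 'm \<Rightarrow> real" where
  "ricci M D E a b p = (\<Sum>c\<in>UNIV. curvature M D E c a c b p)"

definition schouten ::
    "('m::topological_space, 'n::finite) atlas \<Rightarrow> 'm conn \<Rightarrow> ('n \<Rightarrow> 'm vfield) \<Rightarrow>
     'n \<Rightarrow> 'n \<Rightarrow> 'm \<Rightarrow> real" where
  "schouten M D E a b p =
     1 / (real CARD('n) - 1) * ((ricci M D E a b p + ricci M D E b a p) / 2)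
     - 1 / (real CARD('n) + 1) * ((ricci M D E a b p - ricci M D E b a p) / 2)"

definition symmetric_schouten ::
    "('m::topological_space, 'n::finite) atlas \<Rightarrow> 'm set \<Rightarrow> 'm conn \<Rightarrow> bool" where
  "symmetric_schouten M U D \<longleftrightarrow>
     (\<forall>W E. open W \<longrightarrow> W \<subseteq> U \<longrightarrow> frame M W E \<longrightarrow>
        (\<forall>p\<in>W. \<forall>a b. schouten M D E a b p = schouten M D E b a p))"

text \<open>The special projective subclass may be empty, in which case the projective class
  contains none.\<close>

definition special_subclass ::
    "('m::topological_space, 'n::finite) atlas \<Rightarrow> 'm set \<Rightarrow> 'm conn set \<Rightarrow> 'm conn set \<Rightarrow> bool" where
  "special_subclass M U C S \<longleftrightarrow> S = {D\<in>C. symmetric_schouten M U D} \<and> S \<noteq> {}"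


section \<open>The metrisability equation\<close>

text \<open>
  \<open>(\<nabla>\<^sub>Z \<alpha>)(Y) = Z(\<alpha>(Y)) - \<alpha>(\<nabla>\<^sub>Z Y)\<close>, evaluated on a tangent vector \<open>v\<close> by extending
  it to a vector field \<open>Y\<close> near \<open>p\<close>; the result does not depend on the extension.
\<close>

definition cov_deriv_form ::
    "('m::topological_space, 'n::finite) atlas \<Rightarrow> 'm conn \<Rightarrow> 'm vfield \<Rightarrow> 'm form \<Rightarrow> 'm form" where
  "cov_deriv_form M D Z \<alpha> = (\<lambda>p v.
     if v \<in> tangent_space M p
     then (let Y = (SOME Y. (\<exists>W. open W \<and> p \<in> W \<and> vector_field M W Y) \<and> Y p = v)
           in Z p (\<lambda>q. \<alpha> q (Y q)) - \<alpha> p (D Z Y p))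
     else 0)"

text \<open>\<open>(\<nabla>\<^sub>Z g)(\<alpha>, \<beta>)\<close> for \<open>g = g\<^sup>a\<^sup>b\<close>.\<close>

definition cov_deriv_tensor ::
    "('m::topological_space, 'n::finite) atlas \<Rightarrow> 'm conn \<Rightarrow> ('m \<Rightarrow> 'm covec \<Rightarrow> 'm covec \<Rightarrow> real) \<Rightarrow>
     'm vfield \<Rightarrow> 'm form \<Rightarrow> 'm form \<Rightarrow> 'm \<Rightarrow> real" where
  "cov_deriv_tensor M D g Z \<alpha> \<beta> p =
     Z p (\<lambda>q. g q (\<alpha> q) (\<beta> q))
     - g p (cov_deriv_form M D Z \<alpha> p) (\<beta> p) - g p (\<alpha> p) (cov_deriv_form M D Z \<beta> p)"

text \<open>\<open>\<nabla>\<^sub>c g\<^sup>a\<^sup>b = \<mu>\<^sup>a \<delta>\<^sup>b\<^sub>c + \<mu>\<^sup>b \<delta>\<^sup>a\<^sub>c\<close> in every local frame.\<close>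

definition metrisability_eq ::
    "('m::topological_space, 'n::finite) atlas \<Rightarrow> 'm set \<Rightarrow> 'm conn \<Rightarrow>
     ('m \<Rightarrow> 'm covec \<Rightarrow> 'm covec \<Rightarrow> real) \<Rightarrow> 'm vfield \<Rightarrow> bool" where
  "metrisability_eq M U D g \<mu> \<longleftrightarrow>
     (\<forall>W E. open W \<longrightarrow> W \<subseteq> U \<longrightarrow> frame M W E \<longrightarrow> (\<forall>p\<in>W. \<forall>a b c.
        cov_deriv_tensor M D g (E c) (coframe M E a) (coframe M E b) p =
          coframe M E a p (\<mu> p) * of_bool (b = c) + coframe M E b p (\<mu> p) * of_bool (a = c)))"

text \<open>\<open>D g\<^sup>a\<^sup>b = d g\<^sup>a\<^sup>b + \<Gamma>\<^sup>a\<^sub>c g\<^sup>c\<^sup>b + \<Gamma>\<^sup>b\<^sub>c g\<^sup>a\<^sup>c\<close>, where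
  \<open>g\<^sup>a\<^sup>b = g(\<theta>\<^sup>a, \<theta>\<^sup>b)\<close>.\<close>

definition ext_cov_deriv ::
    "('m::topological_space, 'n::finite) atlas \<Rightarrow> 'm conn \<Rightarrow> ('m \<Rightarrow> 'm covec \<Rightarrow> 'm covec \<Rightarrow> real) \<Rightarrow>
     ('n \<Rightarrow> 'm vfield) \<Rightarrow> 'n \<Rightarrow> 'n \<Rightarrow> 'm form" where
  "ext_cov_deriv M D g E a b = (\<lambda>p v.
     differential M (\<lambda>q. g q (coframe M E a q) (coframe M E b q)) p v
     + (\<Sum>c\<in>UNIV. conn_form M D E a c p v * g p (coframe M E c p) (coframe M E b p))
     + (\<Sum>c\<in>UNIV. conn_form M D E b c p v * g p (coframe M E a p) (coframe M E c p)))"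

text \<open>\<open>D g\<^sup>a\<^sup>b = \<mu>\<^sup>a \<theta>\<^sup>b + \<mu>\<^sup>b \<theta>\<^sup>a\<close> in every local frame.\<close>

definition metrisability_eq_ext ::
    "('m::topological_space, 'n::finite) atlas \<Rightarrow> 'm set \<Rightarrow> 'm conn \<Rightarrow>
     ('m \<Rightarrow> 'm covec \<Rightarrow> 'm covec \<Rightarrow> real) \<Rightarrow> 'm vfield \<Rightarrow> bool" where
  "metrisability_eq_ext M U D g \<mu> \<longleftrightarrow>
     (\<forall>W E. open W \<longrightarrow> W \<subseteq> U \<longrightarrow> frame M W E \<longrightarrow> (\<forall>p\<in>W. \<forall>a b.
        ext_cov_deriv M D g E a b p =
          (\<lambda>v. coframe M E a p (\<mu> p) * coframe M E b p v
               + coframe M E b p (\<mu> p) * coframe M E a p v)))"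

definition projectively_metric ::
    "('m::topological_space, 'n::finite) atlas \<Rightarrow> 'm set \<Rightarrow> 'm conn \<Rightarrow> bool" where
  "projectively_metric M U D \<longleftrightarrow>
     (\<exists>g D'. metric M U g \<and> levi_civita M U g D' \<and> projectively_equivalent M U D D')"

end

theory Submission
  imports Defs
begin

text \<open>
  Write \<open>\<tau>(X) = \<theta>\<^sup>a(\<nabla>\<^sub>X E\<^sub>a)\<close> for the trace of the connection form in a frame. By the first Bianchi
  identity \<open>d\<tau>\<close> is the antisymmetric part of the Ricci tensor, so the Schouten tensor is symmetric iff
  \<open>d\<tau> = 0\<close>; and \<open>\<tau>\<close> changes by \<open>(n + 1) A\<close> under a projective change \<open>A\<close>, so special connections differ
  by closed forms. Contracting the metrisability equation with the inverse of \<open>g\<^sup>a\<^sup>b\<close> gives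
  \<open>2 \<tau> + tr (G\<^sup>-\<^sup>1 dG) = 2 g\<^sub>a\<^sub>b \<mu>\<^sup>b\<close>, where \<open>tr (G\<^sup>-\<^sup>1 dG)\<close> is closed; with \<open>\<mu> = 0\<close> this shows that Levi-Civita
  connections are special, and for a special connection it shows that \<open>g\<^sub>a\<^sub>b \<mu>\<^sup>b\<close> is closed.
  If \<open>A = d\<phi>\<close> and \<open>h\<^sup>a\<^sup>b\<close> is parallel for the connection changed by \<open>A\<close>, then \<open>g\<^sup>a\<^sup>b = e\<^sup>2\<^sup>\<phi> h\<^sup>a\<^sup>b\<close> solves the
  metrisability equation for the original one with \<open>\<mu>\<^sup>a = - g\<^sup>a\<^sup>b A\<^sub>b\<close>, and conversely.
\<close>


section \<open>Calculus on Euclidean space\<close>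

text \<open>The existence of an antiderivative decides the form of the result. A projective change
  by \<open>A\<close> adds a term \<open>2 A\<^sub>c g\<^sup>a\<^sup>b\<close> to the covariant
  derivative of the tensor, and the rescaling by \<open>exp (2 * \<phi> p)\<close> absorbs it when
  \<open>A\<close> is the differential of \<open>\<phi>\<close>. The calculation only shows that the
  form in question is closed, so a potential is at hand where closed forms are gradients. Hence
  there is a global equivalence under this condition and a local one, reached by shrinking to balls
  in charts, where the Poincare lemma supplies \<open>\<phi>\<close>. The Levi-Civita connection
  that is sought is written down as a projective change, so no existence theorem for such
  connections enters. Closedness of \<open>tr (G\<^sup>-\<^sup>1 dG)\<close> is obtained from the
  symmetry of the trace of a product of two matrices, which avoids differentiating a determinant.
  Tangent vectors are abstract derivations: Hadamard's lemma is needed before the coordinate vectors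
  are known to span them, and Cramer's rule before the components in an arbitrary frame are known to
  be smooth.\<close>

lemma frechet_derivative_partials:
  fixes f :: "real^'n \<Rightarrow> real"
  assumes "f differentiable (at x)"
  shows "frechet_derivative f (at x) v = (\<Sum>i\<in>UNIV. v $ i * partial_deriv i f x)"
proof -
  have l: "linear (frechet_derivative f (at x))"
    using assms by (rule linear_frechet_derivative)
  have "frechet_derivative f (at x) v = frechet_derivative f (at x) (\<Sum>i\<in>UNIV. (v $ i) *\<^sub>R axis i 1)"
    using basis_expansion[of v] by (simp add: scalar_mult_eq_scaleR)
  also have "\<dots> = (\<Sum>i\<in>UNIV. v $ i * partial_deriv i f x)"
    by (simp add: linear_sum[OF l] linear_scale[OF l] partial_deriv_def)
  finally show ?thesis .
qed

lemma has_derivative_partials: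
  fixes f :: "real^'n \<Rightarrow> real"
  assumes "f differentiable (at x)"
  shows "(f has_derivative (\<lambda>v. \<Sum>i\<in>UNIV. v $ i * partial_deriv i f x)) (at x)"
proof -
  have "(f has_derivative frechet_derivative f (at x)) (at x)"
    using assms frechet_derivative_works by blast
  moreover have "frechet_derivative f (at x) = (\<lambda>v. \<Sum>i\<in>UNIV. v $ i * partial_deriv i f x)"
    using frechet_derivative_partials[OF assms] by auto
  ultimately show ?thesis by simp
qed

lemma sum_axis: "(\<Sum>k\<in>UNIV. axis (i::'n::finite) (1::real) $ k * h k) = h i"
proof -
  have "(\<Sum>k\<in>UNIV. axis i (1::real) $ k * h k) = (\<Sum>k\<in>UNIV. if k = i then h k else 0)"
    by (intro sum.cong) (auto simp: axis_def)
  then show ?thesis by simp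
qed

lemma partial_deriv_eqI:
  assumes "(f has_derivative f') (at x)"
  shows "partial_deriv i f x = f' (axis i 1)"
  using frechet_derivative_at[OF assms] by (simp add: partial_deriv_def)

text \<open>\<open>frechet_derivative\<close> is a choice over \<open>has_derivative\<close>, and
  functions that agree near \<open>x\<close> have the same derivatives there. So the choice agrees
  even where neither function is differentiable.\<close>

lemma partial_deriv_cong:
  assumes "open S" "x \<in> S" "\<And>y. y \<in> S \<Longrightarrow> f y = g y"
  shows "partial_deriv i f x = partial_deriv i g x"
proof -
  have "(f has_derivative f') (at x) \<longleftrightarrow> (g has_derivative f') (at x)" for f'
    using has_derivative_transform_within_open[of f f' x UNIV S g]
      has_derivative_transform_within_open[of g f' x UNIV S f] assms by fastforce
  then show ?thesis by (simp add: partial_deriv_def frechet_derivative_def)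
qed

lemma differentiable_cong_open:
  assumes "open S" "x \<in> S" "\<And>y. y \<in> S \<Longrightarrow> f y = g y" "f differentiable (at x)"
  shows "g differentiable (at x)"
  using assms has_derivative_transform_within_open[of f _ x UNIV S g]
  unfolding differentiable_def by blast

text \<open>The sum, product and chain rules identify \<open>partial_deriv\<close> only at points of
  differentiability. The closure proofs below therefore compute the derivative on \<open>S\<close>
  and change the representative with this lemma; \<open>S\<close> is open because a derivative looks
  at a whole neighbourhood.\<close>

lemma C_diff_cong:
  assumes "open S" "\<And>y. y \<in> S \<Longrightarrow> f y = g y" "C_diff k S f"
  shows "C_diff k S g"
  using assms(2,3)
proof (induction k arbitrary: f g)
  case 0
  then show ?case using continuous_on_cong[of S S f g] by simp
next
  case (Suc k)
  have "\<And>y. y \<in> S \<Longrightarrow> partial_deriv i f y = partial_deriv i g y" for i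
    using partial_deriv_cong[OF assms(1)] Suc.prems(1) by blast
  then have "C_diff k S (partial_deriv i g)" for i
    using Suc.IH[of "partial_deriv i f" "partial_deriv i g"] Suc.prems(2) by simp
  moreover have "g differentiable (at x)" if "x \<in> S" for x
    using differentiable_cong_open[OF assms(1) that Suc.prems(1)] Suc.prems(2) that by simp
  ultimately show ?case by simp
qed

lemma C_diff_subset: "C_diff k S f \<Longrightarrow> T \<subseteq> S \<Longrightarrow> C_diff k T f"
  by (induction k arbitrary: f) (auto intro: continuous_on_subset)

text \<open>\<open>partial_deriv\<close> does not refer to the set, so a test on small
  neighbourhoods passes through all orders of differentiation.\<close>

lemma C_diff_local:
  assumes "\<And>x. x \<in> S \<Longrightarrow> \<exists>T. open T \<and> x \<in> T \<and> C_diff k T f"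
  shows "C_diff k S f"
  using assms
proof (induction k arbitrary: f)
  case 0
  show ?case
    unfolding C_diff.simps
  proof (rule continuous_at_imp_continuous_on, rule ballI)
    fix x assume "x \<in> S"
    then obtain T where "open T" "x \<in> T" "C_diff 0 T f" using 0 by blast
    then show "isCont f x" by (simp add: continuous_on_eq_continuous_at)
  qed
next
  case (Suc k)
  show ?case
    unfolding C_diff.simps
  proof safe
    fix x assume "x \<in> S" then show "f differentiable at x" using Suc.prems by force
  next
    fix i show "C_diff k S (partial_deriv i f)"
      using Suc.prems by (intro Suc.IH) force
  qed
qed

lemma differentiable_imp_C_diff_0:
  "(\<And>x. x \<in> S \<Longrightarrow> f differentiable (at x)) \<Longrightarrow> C_diff 0 S f"
  by (auto intro!: continuous_at_imp_continuous_on differentiable_imp_continuous_within)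

lemma C_diff_SucD: "C_diff (Suc k) S f \<Longrightarrow> C_diff k S f"
proof (induction k arbitrary: f)
  case 0
  then show ?case using differentiable_imp_C_diff_0[of S f] by simp
qed auto

lemma C_diff_const: "C_diff k S (\<lambda>x. c)"
proof (induction k arbitrary: c)
  case (Suc k)
  have "partial_deriv i (\<lambda>x::real^'a. c) = (\<lambda>x. 0)" for i
    by (rule ext) (rule partial_deriv_eqI, rule has_derivative_const)
  with Suc show ?case by simp
qed auto

lemma partial_deriv_component: "partial_deriv i (\<lambda>x::real^'n. x $ j) = (\<lambda>x. of_bool (i = j))"
proof (rule ext)
  fix x :: "real^'n"
  have "((\<lambda>x::real^'n. x $ j) has_derivative (\<lambda>x. x $ j)) (at x)"
    by (rule bounded_linear_imp_has_derivative) (rule bounded_linear_vec_nth)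
  from partial_deriv_eqI[OF this] show "partial_deriv i (\<lambda>x. x $ j) x = of_bool (i = j)"
    by (simp add: axis_def)
qed

lemma C_diff_component: "C_diff k S (\<lambda>x::real^'n. x $ j)"
proof (cases k)
  case (Suc k)
  have "(\<lambda>x::real^'n. x $ j) differentiable (at x)" for x
    by (rule bounded_linear_imp_differentiable) (rule bounded_linear_vec_nth)
  with Suc show ?thesis by (simp add: partial_deriv_component C_diff_const)
qed (simp add: continuous_on_component)

lemma partial_deriv_add:
  assumes "f differentiable (at x)" "g differentiable (at x)"
  shows "partial_deriv i (\<lambda>x. f x + g x) x = partial_deriv i f x + partial_deriv i g x"
  using partial_deriv_eqI[OF has_derivative_add[OF has_derivative_partials[OF assms(1)]
      has_derivative_partials[OF assms(2)]]]
  by (simp add: sum_axis)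

lemma partial_deriv_mult:
  assumes "f differentiable (at x)" "g differentiable (at x)"
  shows "partial_deriv i (\<lambda>x. f x * g x) x = f x * partial_deriv i g x + partial_deriv i f x * g x"
  using partial_deriv_eqI[OF has_derivative_mult[OF has_derivative_partials[OF assms(1)]
      has_derivative_partials[OF assms(2)]]]
  by (simp add: sum_axis)

lemma C_diff_add:
  assumes "open S" "C_diff k S f" "C_diff k S g"
  shows "C_diff k S (\<lambda>x. f x + g x)"
  using assms(2,3)
proof (induction k arbitrary: f g)
  case (Suc k)
  have "C_diff k S (partial_deriv i (\<lambda>x. f x + g x))" for i
    by (rule C_diff_cong[OF assms(1) _ Suc.IH[of "partial_deriv i f" "partial_deriv i g"]])
      (use Suc.prems in \<open>auto simp: partial_deriv_add\<close>)
  moreover have "(\<lambda>x. f x + g x) differentiable (at x)" if "x \<in> S" for x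
    using Suc.prems that by (simp add: differentiable_add)
  ultimately show ?case by simp
qed (simp add: continuous_on_add)

lemma C_diff_mult:
  assumes "open S" "C_diff k S f" "C_diff k S g"
  shows "C_diff k S (\<lambda>x. f x * g x)"
  using assms(2,3)
proof (induction k arbitrary: f g)
  case (Suc k)
  have fg: "C_diff k S f" "C_diff k S g" using Suc.prems C_diff_SucD by blast+
  have c: "C_diff k S (\<lambda>x. f x * partial_deriv i g x + partial_deriv i f x * g x)" for i
    by (intro C_diff_add assms Suc.IH fg) (use Suc.prems in auto)
  have "C_diff k S (partial_deriv i (\<lambda>x. f x * g x))" for i
    by (rule C_diff_cong[OF assms(1) _ c[of i]])
      (use Suc.prems in \<open>auto simp: partial_deriv_mult\<close>)
  moreover have "(\<lambda>x. f x * g x) differentiable (at x)" if "x \<in> S" for x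
    using Suc.prems that by (simp add: differentiable_mult)
  ultimately show ?case by simp
qed (simp add: continuous_on_mult)

lemma C_diff_sum:
  assumes "open S" "\<And>i. i \<in> I \<Longrightarrow> C_diff k S (f i)"
  shows "C_diff k S (\<lambda>x. \<Sum>i\<in>I. f i x)"
proof (cases "finite I")
  case True
  then show ?thesis using assms(2)
    by (induction I) (auto simp: C_diff_const intro!: C_diff_add assms(1))
qed (simp add: C_diff_const)

lemma partial_deriv_compose_real:
  assumes "f differentiable (at x)" "(h has_field_derivative h') (at (f x))"
  shows "partial_deriv i (\<lambda>x. h (f x)) x = h' * partial_deriv i f x"
    and "(\<lambda>x. h (f x)) differentiable (at x)"
proof -
  have "(h has_derivative (*) h') (at (f x))"
    using assms(2) by (simp add: has_field_derivative_def)
  from has_derivative_compose[OF has_derivative_partials[OF assms(1)] this]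
  have *: "((\<lambda>x. h (f x)) has_derivative (\<lambda>v. h' * (\<Sum>i\<in>UNIV. v $ i * partial_deriv i f x))) (at x)" .
  show "partial_deriv i (\<lambda>x. h (f x)) x = h' * partial_deriv i f x"
    using partial_deriv_eqI[OF *]
    by (simp add: sum_axis)
  show "(\<lambda>x. h (f x)) differentiable (at x)" using * by (auto simp: differentiable_def)
qed

lemma C_diff_exp:
  assumes "open S" "C_diff k S f"
  shows "C_diff k S (\<lambda>x. exp (f x))"
  using assms(2)
proof (induction k)
  case (Suc k)
  have c: "C_diff k S (\<lambda>x. exp (f x) * partial_deriv i f x)" for i
    by (intro C_diff_mult assms Suc.IH C_diff_SucD[OF Suc.prems]) (use Suc.prems in auto)
  have "C_diff k S (partial_deriv i (\<lambda>x. exp (f x)))" for i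
    by (rule C_diff_cong[OF assms(1) _ c[of i]])
      (use Suc.prems in \<open>auto simp: partial_deriv_compose_real(1)[where h = exp and f = f, OF _ DERIV_exp]\<close>)
  moreover have "(\<lambda>x. exp (f x)) differentiable (at x)" if "x \<in> S" for x
    by (rule partial_deriv_compose_real(2)[where h = exp and f = f, OF _ DERIV_exp]) (use Suc.prems that in auto)
  ultimately show ?case by simp
qed (simp add: continuous_on_exp)

text \<open>The derivative of \<open>inverse\<close> is written as a product of values of
  \<open>inverse\<close>, so that the induction hypothesis applies to each factor.\<close>

lemma C_diff_inverse:
  assumes "open S" "C_diff k S f" "\<And>x. x \<in> S \<Longrightarrow> f x \<noteq> 0"
  shows "C_diff k S (\<lambda>x. inverse (f x))"
  using assms(2)
proof (induction k)
  case (Suc k)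
  have D: "(inverse has_field_derivative (- 1 * (inverse (f x) * inverse (f x)))) (at (f x))" if "x \<in> S" for x
    using DERIV_inverse[of "f x" UNIV] assms(3)[OF that] by (simp add: power2_eq_square numeral_2_eq_2)
  have c: "C_diff k S (\<lambda>x. (- 1 * (inverse (f x) * inverse (f x))) * partial_deriv i f x)" for i
    by (intro C_diff_mult assms(1) Suc.IH C_diff_const C_diff_SucD[OF Suc.prems]) (use Suc.prems in auto)
  have "C_diff k S (partial_deriv i (\<lambda>x. inverse (f x)))" for i
    by (rule C_diff_cong[OF assms(1) _ c[of i]])
      (use Suc.prems in \<open>auto simp: partial_deriv_compose_real(1)[where h = inverse and f = f, OF _ D]\<close>)
  moreover have "(\<lambda>x. inverse (f x)) differentiable (at x)" if "x \<in> S" for x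
    by (rule partial_deriv_compose_real(2)[where h = inverse and f = f, OF _ D[OF that]]) (use Suc.prems that in auto)
  ultimately show ?case by simp
qed (use assms(3) in \<open>simp add: continuous_on_inverse\<close>)

lemma partial_deriv_compose:
  fixes g :: "real^'n \<Rightarrow> real" and u :: "real^'m \<Rightarrow> real^'n"
  assumes "g differentiable (at (u x))" "\<And>j. (\<lambda>x. u x $ j) differentiable (at x)"
  shows "partial_deriv i (\<lambda>x. g (u x)) x
           = (\<Sum>j\<in>UNIV. partial_deriv j g (u x) * partial_deriv i (\<lambda>x. u x $ j) x)"
    and "(\<lambda>x. g (u x)) differentiable (at x)"
proof -
  have "((\<lambda>x. \<chi> j. u x $ j) has_derivative
      (\<lambda>v. \<chi> j. \<Sum>i\<in>UNIV. v $ i * partial_deriv i (\<lambda>x. u x $ j) x)) (at x)"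
    using has_derivative_partials[OF assms(2)]
    by (subst has_derivative_componentwise_within)
      (auto simp: Basis_vec_def inner_axis)
  then have "(u has_derivative
      (\<lambda>v. \<chi> j. \<Sum>i\<in>UNIV. v $ i * partial_deriv i (\<lambda>x. u x $ j) x)) (at x)" by simp
  from has_derivative_compose[OF this has_derivative_partials[OF assms(1)]]
  have *: "((\<lambda>x. g (u x)) has_derivative
      (\<lambda>v. \<Sum>k\<in>UNIV. (\<Sum>i\<in>UNIV. v $ i * partial_deriv i (\<lambda>x. u x $ k) x) * partial_deriv k g (u x))) (at x)"
    by simp
  show "partial_deriv i (\<lambda>x. g (u x)) x
      = (\<Sum>j\<in>UNIV. partial_deriv j g (u x) * partial_deriv i (\<lambda>x. u x $ j) x)"
    using partial_deriv_eqI[OF *]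
    by (simp add: sum_axis) (simp add: mult.commute)
  show "(\<lambda>x. g (u x)) differentiable (at x)" using * by (auto simp: differentiable_def)
qed

text \<open>The chain rule composes the partial derivatives of \<open>g\<close> with the same map
  \<open>u\<close>; hence the induction lets \<open>g\<close> vary.\<close>

lemma C_diff_compose:
  fixes g :: "real^'n \<Rightarrow> real" and u :: "real^'m \<Rightarrow> real^'n"
  assumes "open S" "C_diff k T g" "\<And>j. C_diff k S (\<lambda>x. u x $ j)" "\<And>x. x \<in> S \<Longrightarrow> u x \<in> T"
  shows "C_diff k S (\<lambda>x. g (u x))"
  using assms(2,3)
proof (induction k arbitrary: g)
  case 0
  have "continuous_on S (\<lambda>x. u x $ j)" for j using 0(2)[of j] by simp
  from continuous_on_vec_lambda[of S "\<lambda>j x. u x $ j", OF this] have "continuous_on S u" by simp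
  moreover have "continuous_on T g" using 0(1) by simp
  moreover have "u ` S \<subseteq> T" using assms(4) by blast
  ultimately show ?case
    using continuous_on_compose2[of T g S u] by simp
next
  case (Suc k)
  have pg: "C_diff k T (partial_deriv j g)" for j using Suc.prems(1) by simp
  have pu: "C_diff k S (partial_deriv i (\<lambda>x. u x $ j))" for i j using Suc.prems(2)[of j] by simp
  have dg: "g differentiable (at (u x))" if "x \<in> S" for x
    using Suc.prems(1) assms(4)[OF that] by simp
  have du: "(\<lambda>x. u x $ j) differentiable (at x)" if "x \<in> S" for x j
    using Suc.prems(2)[of j] that by simp
  have cg: "C_diff k S (\<lambda>x. partial_deriv j g (u x))" for j
    using Suc.IH[of "partial_deriv j g", OF pg C_diff_SucD[OF Suc.prems(2)]] .
  have c: "C_diff k S (\<lambda>x. \<Sum>j\<in>UNIV. partial_deriv j g (u x) * partial_deriv i (\<lambda>x. u x $ j) x)" for i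
    by (rule C_diff_sum[OF assms(1)]) (rule C_diff_mult[OF assms(1) cg pu])
  have "C_diff k S (partial_deriv i (\<lambda>x. g (u x)))" for i
  proof (rule C_diff_cong[OF assms(1) _ c[of i]])
    fix x assume "x \<in> S"
    from partial_deriv_compose(1)[of g u x i, OF dg[OF this] du[OF this]]
    show "(\<Sum>j\<in>UNIV. partial_deriv j g (u x) * partial_deriv i (\<lambda>x. u x $ j) x)
      = partial_deriv i (\<lambda>x. g (u x)) x" by simp
  qed
  moreover have "(\<lambda>x. g (u x)) differentiable (at x)" if "x \<in> S" for x
    using partial_deriv_compose(2)[of g u x, OF dg[OF that] du[OF that]] .
  ultimately show ?case by simp
qed

lemma smooth_on_SucD: "smooth_on S f \<Longrightarrow> C_diff (Suc k) S f"
  unfolding smooth_on_def by (rule spec)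

lemma smooth_on_differentiable: "smooth_on S f \<Longrightarrow> x \<in> S \<Longrightarrow> f differentiable (at x)"
  using smooth_on_SucD[of S f 0] by simp

lemma smooth_on_partial_deriv: "smooth_on S f \<Longrightarrow> smooth_on S (partial_deriv i f)"
  by (subst smooth_on_def) (use smooth_on_SucD[of S f] in simp)

lemma smooth_on_continuous: "smooth_on S f \<Longrightarrow> continuous_on S f"
  unfolding smooth_on_def by (drule spec[of _ 0]) simp

lemma smooth_on_local:
  assumes "\<And>x. x \<in> S \<Longrightarrow> \<exists>T. open T \<and> x \<in> T \<and> smooth_on T f"
  shows "smooth_on S f"
  unfolding smooth_on_def
proof (intro allI C_diff_local)
  fix k x assume "x \<in> S"
  with assms obtain T where "open T" "x \<in> T" "smooth_on T f" by blast
  then show "\<exists>T. open T \<and> x \<in> T \<and> C_diff k T f"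
    by (intro exI[of _ T]) (simp add: smooth_on_def)
qed

text \<open>Differentiation in \<open>x\<close> under the integral sign produces one more factor
  \<open>t\<close>; the weight \<open>t ^ k\<close> makes the family stable under it. With
  \<open>k = 0\<close> these are the coefficient functions in Hadamard's lemma and in the primitive
  of a closed form.\<close>

definition ray_mean :: "real^'n \<Rightarrow> nat \<Rightarrow> (real^'n \<Rightarrow> real) \<Rightarrow> real^'n \<Rightarrow> real" where
  "ray_mean a k f x = integral {0..1} (\<lambda>t. t ^ k * f (a + t *\<^sub>R (x - a)))"

lemma ray_in_ball:
  assumes "x \<in> ball a r" "t \<in> {0..1::real}"
  shows "a + t *\<^sub>R (x - a) \<in> ball (a::real^'n) r"
proof -
  have "t * norm (x - a) \<le> norm (x - a)" using assms(2) by (simp add: mult_left_le_one_le)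
  with assms show ?thesis by (simp add: dist_norm norm_minus_commute)
qed

lemma continuous_on_ray_integrand:
  fixes a :: "real^'n"
  assumes "continuous_on (ball a r) f"
  shows "continuous_on (ball a r \<times> {0..1}) (\<lambda>(x, t). t ^ k * f (a + t *\<^sub>R (x - a)))"
  unfolding case_prod_beta
  by (intro continuous_on_mult continuous_on_compose2[OF assms] continuous_intros)
    (auto simp del: mem_ball intro!: ray_in_ball continuous_intros)

lemma continuous_on_ray_mean:
  assumes "continuous_on (ball a r) f"
  shows "continuous_on (ball a r) (ray_mean a k f)"
  using integral_continuous_on_param[of "ball a r" 0 1 "\<lambda>x t. t ^ k * f (a + t *\<^sub>R (x - a))"]
    continuous_on_ray_integrand[OF assms]
  by (simp add: ray_mean_def[abs_def])

lemma ray_integrable: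
  fixes a :: "real^'n"
  assumes "continuous_on (ball a r) f" "x \<in> ball a r"
  shows "(\<lambda>t. t ^ k * f (a + t *\<^sub>R (x - a))) integrable_on {0..1}"
  by (intro integrable_continuous_interval continuous_on_mult continuous_on_compose2[OF assms(1)]
      continuous_intros) (auto simp del: mem_ball intro!: ray_in_ball[OF assms(2)] continuous_intros)

lemma has_derivative_ray_mean:
  fixes f :: "real^'n \<Rightarrow> real"
  assumes f: "C_diff (Suc 0) (ball a r) f" and x: "x \<in> ball a r"
  shows "(ray_mean a k f has_derivative
      (\<lambda>v. \<Sum>i\<in>UNIV. v $ i * ray_mean a (Suc k) (partial_deriv i f) x)) (at x)"
proof -
  \<comment> \<open>The Leibniz rule for parameter integrals takes the derivative as a bounded
    linear map. \<open>P i\<close> are the coordinate functionals, and \<open>F x t\<close> is the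
    derivative of the integrand expanded in them.\<close>
  define P :: "'n \<Rightarrow> (real^'n) \<Rightarrow>\<^sub>L real" where "P i = Blinfun (\<lambda>v. v $ i)" for i
  have P: "blinfun_apply (P i) v = v $ i" for i v
    unfolding P_def by (subst bounded_linear_Blinfun_apply) (auto intro: bounded_linear_vec_nth)
  define c where "c i x t = t ^ Suc k * partial_deriv i f (a + t *\<^sub>R (x - a))" for i x t
  define F where "F x t = (\<Sum>i\<in>UNIV. c i x t *\<^sub>R P i)" for x t
  have contp: "continuous_on (ball a r) (partial_deriv i f)" for i using f by simp
  have contf: "continuous_on (ball a r) f" using C_diff_SucD[OF f] by simp
  have cc: "continuous_on (ball a r \<times> {0..1}) (\<lambda>(x, t). c i x t)" for i
    unfolding c_def by (rule continuous_on_ray_integrand[OF contp])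
  have "((\<lambda>x. integral (cbox 0 1) (\<lambda>t. t ^ k * f (a + t *\<^sub>R (x - a)))) has_derivative
      blinfun_apply (integral (cbox 0 1) (F x))) (at x within ball a r)"
  proof (rule leibniz_rule)
    fix x and t :: real assume x: "x \<in> ball a r" and t: "t \<in> cbox 0 1"
    then have "f differentiable (at (a + t *\<^sub>R (x - a)))"
      using f ray_in_ball[of x a r t] by simp
    then have "(f has_derivative (\<lambda>v. \<Sum>i\<in>UNIV. v $ i * partial_deriv i f (a + t *\<^sub>R (x - a)))) (at (a + t *\<^sub>R (x - a)))"
      by (rule has_derivative_partials)
    moreover have "((\<lambda>x. a + t *\<^sub>R (x - a)) has_derivative (\<lambda>v. t *\<^sub>R v)) (at x)"
      by (auto intro!: derivative_eq_intros)
    ultimately have "((\<lambda>x. f (a + t *\<^sub>R (x - a))) has_derivative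
       (\<lambda>v. \<Sum>i\<in>UNIV. (t *\<^sub>R v) $ i * partial_deriv i f (a + t *\<^sub>R (x - a)))) (at x)"
      using has_derivative_compose by fastforce
    from has_derivative_mult_right[OF this, of "t ^ k"]
    have "((\<lambda>x. t ^ k * f (a + t *\<^sub>R (x - a))) has_derivative
       (\<lambda>v. t ^ k * (\<Sum>i\<in>UNIV. (t *\<^sub>R v) $ i * partial_deriv i f (a + t *\<^sub>R (x - a))))) (at x)" .
    moreover have "(\<lambda>v. t ^ k * (\<Sum>i\<in>UNIV. (t *\<^sub>R v) $ i * partial_deriv i f (a + t *\<^sub>R (x - a)))) = blinfun_apply (F x t)"
      by (auto simp: F_def blinfun.sum_left blinfun.scaleR_left P c_def sum_distrib_left mult_ac)
    ultimately show "((\<lambda>x. t ^ k * f (a + t *\<^sub>R (x - a))) has_derivative blinfun_apply (F x t)) (at x within ball a r)"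
      by (auto intro: has_derivative_at_withinI)
  next
    fix x assume "x \<in> ball a r"
    then show "(\<lambda>t. t ^ k * f (a + t *\<^sub>R (x - a))) integrable_on cbox 0 1"
      using ray_integrable[OF contf] by simp
  next
    show "continuous_on (ball a r \<times> cbox 0 1) (\<lambda>(x, t). F x t)"
      using cc unfolding F_def case_prod_beta by (auto intro!: continuous_intros)
  qed (use x in auto)
  then have "((\<lambda>x. integral {0..1} (\<lambda>t. t ^ k * f (a + t *\<^sub>R (x - a)))) has_derivative
      blinfun_apply (integral {0..1} (F x))) (at x)"
    using x at_within_open[of x "ball a r"] by simp
  moreover have "blinfun_apply (integral {0..1} (F x)) v = (\<Sum>i\<in>UNIV. v $ i * ray_mean a (Suc k) (partial_deriv i f) x)" for v
  proof -
    have I: "(\<lambda>t. c i x t) integrable_on {0..1}" for i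
      unfolding c_def by (rule ray_integrable[OF contp x])
    have I2: "((\<lambda>t. c i x t *\<^sub>R P i) has_integral (ray_mean a (Suc k) (partial_deriv i f) x *\<^sub>R P i)) {0..1}" for i
    proof -
      have "((\<lambda>t. c i x t) has_integral (ray_mean a (Suc k) (partial_deriv i f) x)) {0..1}"
        using I[of i] unfolding ray_mean_def c_def by (simp add: has_integral_integral)
      from has_integral_linear[OF this bounded_linear_scaleR_left[of "P i"]]
      show ?thesis by (simp add: o_def)
    qed
    have "(F x has_integral (\<Sum>i\<in>UNIV. ray_mean a (Suc k) (partial_deriv i f) x *\<^sub>R P i)) {0..1}"
      unfolding F_def by (rule has_integral_sum) (auto intro: I2)
    then have "integral {0..1} (F x) = (\<Sum>i\<in>UNIV. ray_mean a (Suc k) (partial_deriv i f) x *\<^sub>R P i)"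
      by (rule integral_unique)
    then show ?thesis by (simp add: blinfun.sum_left blinfun.scaleR_left P mult.commute)
  qed
  ultimately show ?thesis
    unfolding ray_mean_def[abs_def] by (metis (no_types, lifting) ext)
qed

lemma partial_deriv_ray_mean:
  assumes "C_diff (Suc 0) (ball a r) f" "x \<in> ball a r"
  shows "partial_deriv i (ray_mean a k f) x = ray_mean a (Suc k) (partial_deriv i f) x"
  using partial_deriv_eqI[OF has_derivative_ray_mean[OF assms]]
  by (simp add: sum_axis)

lemma C_diff_Suc0: "C_diff (Suc k) S f \<Longrightarrow> C_diff (Suc 0) S f"
  by (induction k) (blast dest: C_diff_SucD)+

text \<open>Each partial derivative is again a ray mean, of a partial derivative of \<open>f\<close>
  and with the weight raised by one; so both \<open>k\<close> and \<open>f\<close> vary in the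
  induction.\<close>

lemma C_diff_ray_mean:
  "C_diff m (ball a r) f \<Longrightarrow> C_diff m (ball a r) (ray_mean a k f)"
proof (induction m arbitrary: k f)
  case 0
  then show ?case by (simp add: continuous_on_ray_mean)
next
  case (Suc m)
  have 1: "C_diff (Suc 0) (ball a r) f" using Suc.prems by (rule C_diff_Suc0)
  have "C_diff m (ball a r) (partial_deriv i (ray_mean a k f))" for i
    by (rule C_diff_cong[OF open_ball _ Suc.IH[of "partial_deriv i f" "Suc k"]])
      (use Suc.prems partial_deriv_ray_mean[OF 1] in auto)
  moreover have "ray_mean a k f differentiable (at x)" if "x \<in> ball a r" for x
    using has_derivative_ray_mean[OF 1 that] by (auto simp: differentiable_def)
  ultimately show ?case by simp
qed

lemma smooth_on_ray_mean: "smooth_on (ball a r) f \<Longrightarrow> smooth_on (ball a r) (ray_mean a k f)"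
  unfolding smooth_on_def by (auto intro: C_diff_ray_mean)

lemma ray_mean_center: "ray_mean a 0 f a = f a"
  by (simp add: ray_mean_def)

lemma has_integral_ray_sum:
  assumes "\<And>i. continuous_on (ball a r) (g i)" "x \<in> ball a r"
  shows "((\<lambda>t. \<Sum>i\<in>UNIV. (c i :: real) * (t ^ k * g i (a + t *\<^sub>R (x - a)))) has_integral
    (\<Sum>i\<in>UNIV. c i * ray_mean a k (g (i::'i::finite)) x)) {0..1}"
  unfolding ray_mean_def
  by (intro has_integral_sum has_integral_mult_right) (auto simp: ray_integrable[OF assms] intro!: integrable_integral)

text \<open>Integrate the derivative of \<open>f\<close> along the segment from \<open>a\<close> to
  \<open>x\<close>. The factorisation into coordinate differences and smooth functions is what an
  abstract derivation can be applied to.\<close>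

lemma hadamard:
  fixes f :: "real^'n \<Rightarrow> real"
  assumes f: "smooth_on (ball a r) f" and x: "x \<in> ball a r"
  shows "f x = f a + (\<Sum>i\<in>UNIV. (x - a) $ i * ray_mean a 0 (partial_deriv i f) x)"
proof -
  have "((\<lambda>t. \<Sum>i\<in>UNIV. (x - a) $ i * (t ^ 0 * partial_deriv i f (a + t *\<^sub>R (x - a)))) has_integral
      (f (a + 1 *\<^sub>R (x - a)) - f (a + 0 *\<^sub>R (x - a)))) {0..1}"
  proof (rule fundamental_theorem_of_calculus)
    fix t :: real assume t: "t \<in> {0..1}"
    have d: "f differentiable (at (a + t *\<^sub>R (x - a)))"
      using smooth_on_differentiable[OF f] ray_in_ball[OF x t] by blast
    have "((\<lambda>t. a + t *\<^sub>R (x - a)) has_derivative (\<lambda>s. s *\<^sub>R (x - a))) (at t)"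
      by (auto intro!: derivative_eq_intros)
    from has_derivative_compose[OF this has_derivative_partials[OF d]]
    have "((\<lambda>t. f (a + t *\<^sub>R (x - a))) has_vector_derivative
      (\<Sum>i\<in>UNIV. (x - a) $ i * (t ^ 0 * partial_deriv i f (a + t *\<^sub>R (x - a))))) (at t)"
      by (simp add: has_vector_derivative_def sum_distrib_left mult_ac)
    then show "((\<lambda>t. f (a + t *\<^sub>R (x - a))) has_vector_derivative
      (\<Sum>i\<in>UNIV. (x - a) $ i * (t ^ 0 * partial_deriv i f (a + t *\<^sub>R (x - a))))) (at t within {0..1})"
      by (rule has_vector_derivative_at_within)
  qed simp
  moreover have "((\<lambda>t. \<Sum>i\<in>UNIV. (x - a) $ i * (t ^ 0 * partial_deriv i f (a + t *\<^sub>R (x - a)))) has_integral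
      (\<Sum>i\<in>UNIV. (x - a) $ i * ray_mean a 0 (partial_deriv i f) x)) {0..1}"
    by (rule has_integral_ray_sum[OF _ x]) (intro smooth_on_continuous smooth_on_partial_deriv f)
  ultimately have "f (a + 1 *\<^sub>R (x - a)) - f (a + 0 *\<^sub>R (x - a))
    = (\<Sum>i\<in>UNIV. (x - a) $ i * ray_mean a 0 (partial_deriv i f) x)"
    by (rule has_integral_unique)
  then show ?thesis by simp
qed

text \<open>The primitive is the integral of the form along rays; its derivative is computed by
  recognising \<open>d/dt (t a\<^sub>j)\<close> under the integral sign.\<close>

lemma poincare_ball:
  fixes u :: "'n::finite \<Rightarrow> real^'n \<Rightarrow> real"
  assumes u: "\<And>i. smooth_on (ball a r) (u i)"
    and closed: "\<And>i j x. x \<in> ball a r \<Longrightarrow> partial_deriv i (u j) x = partial_deriv j (u i) x"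
  defines "\<phi> \<equiv> \<lambda>x. \<Sum>i\<in>UNIV. (x $ i + - a $ i) * ray_mean a 0 (u i) x"
  shows "smooth_on (ball a r) \<phi>" "\<And>x j. x \<in> ball a r \<Longrightarrow> partial_deriv j \<phi> x = u j x"
proof -
  show "smooth_on (ball a r) \<phi>"
    unfolding smooth_on_def \<phi>_def
    by (intro allI C_diff_sum C_diff_mult C_diff_add C_diff_component C_diff_const C_diff_ray_mean)
      (use u in \<open>auto simp: smooth_on_def\<close>)
  fix x j assume x: "x \<in> ball a r"
  have u1: "C_diff (Suc 0) (ball a r) (u i)" for i using u[of i] unfolding smooth_on_def by blast
  have "((\<lambda>x. x $ i + (- a $ i)) has_derivative (\<lambda>v. v $ i)) (at x)" for i
    by (auto intro!: derivative_eq_intros bounded_linear_imp_has_derivative bounded_linear_vec_nth)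
  from has_derivative_mult[OF this has_derivative_ray_mean[OF u1 x]]
  have "(\<phi> has_derivative (\<lambda>v. \<Sum>i\<in>UNIV. (x $ i + - a $ i) * (\<Sum>l\<in>UNIV. v $ l * ray_mean a (Suc 0) (partial_deriv l (u i)) x)
      + v $ i * ray_mean a 0 (u i) x)) (at x)"
    unfolding \<phi>_def by (intro has_derivative_sum) simp
  from partial_deriv_eqI[OF this]
  have "partial_deriv j \<phi> x = (\<Sum>i\<in>UNIV. (x $ i + - a $ i) * ray_mean a (Suc 0) (partial_deriv j (u i)) x) + ray_mean a 0 (u j) x"
    unfolding sum.distrib by (simp add: sum_axis)
  \<comment> \<open>Closedness enters here, under the integral sign: exchanging the indices turns
    the sum into the radial derivative of the single function \<open>u j\<close>.\<close>
  moreover have "ray_mean a (Suc 0) (partial_deriv j (u i)) x = ray_mean a (Suc 0) (partial_deriv i (u j)) x" for i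
    unfolding ray_mean_def
    by (intro integral_cong) (use closed ray_in_ball[OF x] in auto)
  ultimately have L: "partial_deriv j \<phi> x = (\<Sum>i\<in>UNIV. (x - a) $ i * ray_mean a (Suc 0) (partial_deriv i (u j)) x) + ray_mean a 0 (u j) x"
    by simp
  have "((\<lambda>t. (\<Sum>i\<in>UNIV. (x - a) $ i * (t ^ Suc 0 * partial_deriv i (u j) (a + t *\<^sub>R (x - a))))
        + t ^ 0 * u j (a + t *\<^sub>R (x - a))) has_integral
     ((\<Sum>i\<in>UNIV. (x - a) $ i * ray_mean a (Suc 0) (partial_deriv i (u j)) x) + ray_mean a 0 (u j) x)) {0..1}"
  proof (rule has_integral_add)
    show "((\<lambda>t. \<Sum>i\<in>UNIV. (x - a) $ i * (t ^ Suc 0 * partial_deriv i (u j) (a + t *\<^sub>R (x - a)))) has_integral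
      (\<Sum>i\<in>UNIV. (x - a) $ i * ray_mean a (Suc 0) (partial_deriv i (u j)) x)) {0..1}"
      by (rule has_integral_ray_sum[OF _ x]) (rule smooth_on_continuous[OF smooth_on_partial_deriv[OF u]])
    show "((\<lambda>t. t ^ 0 * u j (a + t *\<^sub>R (x - a))) has_integral ray_mean a 0 (u j) x) {0..1}"
      unfolding ray_mean_def
      by (rule integrable_integral[OF ray_integrable[OF smooth_on_continuous[OF u] x]])
  qed
  \<comment> \<open>The integrand is the \<open>t\<close>-derivative of
    \<open>t * u j (a + t *\<^sub>R (x - a))\<close>. The factor \<open>t\<close> removes the
    boundary value at the centre and leaves \<open>u j x\<close>.\<close>
  then have "(\<Sum>i\<in>UNIV. (x - a) $ i * ray_mean a (Suc 0) (partial_deriv i (u j)) x) + ray_mean a 0 (u j) x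
     = 1 * u j (a + 1 *\<^sub>R (x - a)) - 0 * u j (a + 0 *\<^sub>R (x - a))"
  proof (rule has_integral_unique)
    show "((\<lambda>t. (\<Sum>i\<in>UNIV. (x - a) $ i * (t ^ Suc 0 * partial_deriv i (u j) (a + t *\<^sub>R (x - a))))
        + t ^ 0 * u j (a + t *\<^sub>R (x - a))) has_integral
      (1 * u j (a + 1 *\<^sub>R (x - a)) - 0 * u j (a + 0 *\<^sub>R (x - a)))) {0..1}"
    proof (rule fundamental_theorem_of_calculus)
      fix t :: real assume t: "t \<in> {0..1}"
      have d: "u j differentiable (at (a + t *\<^sub>R (x - a)))"
        using smooth_on_differentiable[OF u] ray_in_ball[OF x t] by blast
      have "((\<lambda>t. a + t *\<^sub>R (x - a)) has_derivative (\<lambda>s. s *\<^sub>R (x - a))) (at t)"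
        by (auto intro!: derivative_eq_intros)
      from has_derivative_mult[OF has_derivative_ident has_derivative_compose[OF this has_derivative_partials[OF d]]]
      have "((\<lambda>t. t * u j (a + t *\<^sub>R (x - a))) has_derivative (\<lambda>h. t * (\<Sum>i\<in>UNIV. (h *\<^sub>R (x - a)) $ i * partial_deriv i (u j) (a + t *\<^sub>R (x - a))) +
             h * u j (a + t *\<^sub>R (x - a)))) (at t)" .
      moreover have "(\<lambda>h. t * (\<Sum>i\<in>UNIV. (h *\<^sub>R (x - a)) $ i * partial_deriv i (u j) (a + t *\<^sub>R (x - a))) +
             h * u j (a + t *\<^sub>R (x - a))) = (\<lambda>h. h *\<^sub>R ((\<Sum>i\<in>UNIV. (x - a) $ i * (t ^ Suc 0 * partial_deriv i (u j) (a + t *\<^sub>R (x - a))))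
          + t ^ 0 * u j (a + t *\<^sub>R (x - a))))"
        by (simp add: sum_distrib_left algebra_simps)
      ultimately have "((\<lambda>t. t * u j (a + t *\<^sub>R (x - a))) has_vector_derivative
        ((\<Sum>i\<in>UNIV. (x - a) $ i * (t ^ Suc 0 * partial_deriv i (u j) (a + t *\<^sub>R (x - a))))
          + t ^ 0 * u j (a + t *\<^sub>R (x - a)))) (at t)"
        unfolding has_vector_derivative_def by simp
      then show "((\<lambda>t. t * u j (a + t *\<^sub>R (x - a))) has_vector_derivative
        ((\<Sum>i\<in>UNIV. (x - a) $ i * (t ^ Suc 0 * partial_deriv i (u j) (a + t *\<^sub>R (x - a))))
          + t ^ 0 * u j (a + t *\<^sub>R (x - a)))) (at t within {0..1})"
        by (rule has_vector_derivative_at_within)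
    qed simp
  qed
  with L show "partial_deriv j \<phi> x = u j x" by simp
qed


section \<open>Smooth functions and tangent vectors\<close>

lemma partial_deriv_const: "partial_deriv i (\<lambda>x. c) x = 0"
  using partial_deriv_eqI[OF has_derivative_const] .

lemma eventually_nhds_open: "open U \<Longrightarrow> p \<in> U \<Longrightarrow> (\<And>q. q \<in> U \<Longrightarrow> P q) \<Longrightarrow> eventually P (nhds p)"
  unfolding eventually_nhds by blast

section \<open>Smoothness near a point, read in one chart\<close>

locale manifold =
  fixes M :: "('m::{t2_space, second_countable_topology}, 'n::finite) atlas"
  assumes smooth_manifold: "smooth_manifold M"
begin

abbreviation sm :: "'m \<Rightarrow> ('m \<Rightarrow> real) \<Rightarrow> bool" where "sm \<equiv> smooth_near M"
abbreviation TT :: "'m \<Rightarrow> 'm tvec set" where "TT \<equiv> tangent_space M"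
abbreviation CT :: "'m \<Rightarrow> 'm covec set" where "CT \<equiv> cotangent_space M"

lemma ex_chart: obtains V x where "(V, x) \<in> M" "p \<in> V"
proof -
  have "p \<in> (\<Union>(V, x)\<in>M. V)" using smooth_manifold by (simp add: smooth_manifold_def)
  then show ?thesis using that by blast
qed

context
  fixes V and x :: "'m \<Rightarrow> real^'n"
  assumes Vx: "(V, x) \<in> M"
begin

lemma chart_homeo: "homeomorphism V (x ` V) x (inv_into V x)"
  and chart_open: "open V" and chart_open_range: "open (x ` V)"
  using smooth_manifold Vx by (auto simp: smooth_manifold_def chart_def)

lemma chart_inv: "q \<in> V \<Longrightarrow> inv_into V x (x q) = q"
  using chart_homeo by (rule homeomorphism_apply1)

lemma chart_open_image: "open U \<Longrightarrow> open (x ` (U \<inter> V))"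
proof -
  assume "open U"
  then have "openin (top_of_set V) (U \<inter> V)" by (metis inf_commute openin_open_Int)
  from homeomorphism_imp_open_map[OF chart_homeo this]
  show ?thesis using chart_open_range openin_open_trans by blast
qed

lemma chart_open_preimage: "open T \<Longrightarrow> open {q \<in> V. x q \<in> T}"
proof -
  assume "open T"
  moreover have "continuous_on V x" using chart_homeo by (simp add: homeomorphism_def)
  ultimately have "open (V \<inter> x -` T)" using chart_open continuous_open_preimage by blast
  moreover have "V \<inter> x -` T = {q \<in> V. x q \<in> T}" by auto
  ultimately show ?thesis by simp
qed

end

text \<open>The transition maps are smooth, so a coordinate expression that is smooth in one chart
  is smooth in all of them. Every closure property of \<open>sm\<close> is reduced in this way to
  \<open>C_diff\<close> in a single chart.\<close>

lemma smooth_near_chart: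
  assumes Vx: "(V, x) \<in> M" and "p \<in> V"
  shows "sm p f \<longleftrightarrow> (\<exists>T. open T \<and> x p \<in> T \<and> smooth_on T (\<lambda>z. f (inv_into V x z)))"
proof
  assume "sm p f"
  then obtain U where "open U" "p \<in> U" "smooth_fun M U f" unfolding smooth_near_def by blast
  then show "\<exists>T. open T \<and> x p \<in> T \<and> smooth_on T (\<lambda>z. f (inv_into V x z))"
    using assms chart_open_image[OF Vx, of U]
    by (intro exI[of _ "x ` (U \<inter> V)"]) (auto simp: smooth_fun_def)
next
  assume "\<exists>T. open T \<and> x p \<in> T \<and> smooth_on T (\<lambda>z. f (inv_into V x z))"
  then obtain T where T: "open T" "x p \<in> T" "smooth_on T (\<lambda>z. f (inv_into V x z))" by blast
  define U where "U = {q \<in> V. x q \<in> T}"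
  have "open U" unfolding U_def by (rule chart_open_preimage[OF Vx T(1)])
  have "smooth_on (y ` (U \<inter> W)) (\<lambda>z. f (inv_into W y z))" if Wy: "(W, y) \<in> M" for W y
    unfolding smooth_on_def
  proof
    fix k
    have inv: "inv_into W y (y q) = q" if "q \<in> W" for q using that by (rule chart_inv[OF Wy])
    have opn: "open (y ` (U \<inter> W))" using chart_open_image[OF Wy \<open>open U\<close>] .
    \<comment> \<open>The atlas provides the transition map from \<open>y\<close> to
      \<open>x\<close> on the overlap; the expression in \<open>y\<close> is the one in
      \<open>x\<close> composed with it.\<close>
    have tr: "C_diff k (y ` (U \<inter> W)) (\<lambda>z. x (inv_into W y z) $ i)" for i
    proof -
      have "smooth_on (y ` (W \<inter> V)) (\<lambda>z. x (inv_into W y z) $ i)"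
        using smooth_manifold Wy Vx unfolding smooth_manifold_def by fast
      then have "C_diff k (y ` (W \<inter> V)) (\<lambda>z. x (inv_into W y z) $ i)" unfolding smooth_on_def by blast
      then show ?thesis by (rule C_diff_subset) (auto simp: U_def)
    qed
    have "C_diff k (y ` (U \<inter> W)) (\<lambda>z. f (inv_into V x (x (inv_into W y z))))"
    proof (rule C_diff_compose[where u = "\<lambda>z. x (inv_into W y z)" and g = "\<lambda>z. f (inv_into V x z)" and T = T, OF opn _ tr])
      show "C_diff k T (\<lambda>z. f (inv_into V x z))" using T(3) unfolding smooth_on_def by blast
      fix z assume "z \<in> y ` (U \<inter> W)"
      then show "x (inv_into W y z) \<in> T" using inv by (auto simp: U_def)
    qed
    then show "C_diff k (y ` (U \<inter> W)) (\<lambda>z. f (inv_into W y z))"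
    proof (rule C_diff_cong[OF opn, rotated])
      fix z assume "z \<in> y ` (U \<inter> W)"
      then obtain q where q: "q \<in> U" "q \<in> W" "z = y q" by blast
      then have "q \<in> V" by (simp add: U_def)
      then show "f (inv_into V x (x (inv_into W y z))) = f (inv_into W y z)"
        using q inv chart_inv[OF Vx] by simp
    qed
  qed
  then have "smooth_fun M U f" unfolding smooth_fun_def by blast
  then show "sm p f" using \<open>open U\<close> T assms unfolding smooth_near_def U_def by blast
qed

lemma smooth_fun_subset: "smooth_fun M U f \<Longrightarrow> W \<subseteq> U \<Longrightarrow> smooth_fun M W f"
  unfolding smooth_fun_def smooth_on_def by (fast intro: C_diff_subset)

text \<open>On an open set smoothness is a property of germs. This allows the whole development to
  argue at one point and to return to open sets only at the interfaces.\<close>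

lemma smooth_fun_iff:
  assumes "open U"
  shows "smooth_fun M U f \<longleftrightarrow> (\<forall>p\<in>U. sm p f)"
proof
  assume "smooth_fun M U f" then show "\<forall>p\<in>U. sm p f" using assms unfolding smooth_near_def by blast
next
  assume *: "\<forall>p\<in>U. sm p f"
  have "smooth_on (x ` (U \<inter> V)) (\<lambda>z. f (inv_into V x z))" if Vx: "(V, x) \<in> M" for V x
  proof (rule smooth_on_local)
    fix z assume "z \<in> x ` (U \<inter> V)"
    then obtain p where p: "p \<in> U" "p \<in> V" "z = x p" by blast
    with * smooth_near_chart[OF Vx p(2)]
    show "\<exists>T. open T \<and> z \<in> T \<and> smooth_on T (\<lambda>z. f (inv_into V x z))" by blast
  qed
  then show "smooth_fun M U f" unfolding smooth_fun_def by blast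
qed

lemma sm_eventually: "sm p f \<Longrightarrow> \<forall>\<^sub>F q in nhds p. sm q f"
  unfolding eventually_nhds smooth_near_def by blast

lemma sm_cong:
  assumes "\<forall>\<^sub>F q in nhds p. f q = g q" "sm p f"
  shows "sm p g"
proof -
  obtain V x where Vx: "(V, x) \<in> M" "p \<in> V" by (rule ex_chart)
  obtain N where N: "open N" "p \<in> N" "\<And>q. q \<in> N \<Longrightarrow> f q = g q"
    using assms(1) unfolding eventually_nhds by blast
  obtain T where T: "open T" "x p \<in> T" "smooth_on T (\<lambda>z. f (inv_into V x z))"
    using assms(2) smooth_near_chart[OF Vx] by blast
  let ?S = "T \<inter> x ` (N \<inter> V)"
  have o: "open ?S" using T(1) chart_open_image[OF Vx(1) N(1)] by blast
  have "smooth_on ?S (\<lambda>z. g (inv_into V x z))"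
    unfolding smooth_on_def
  proof
    fix k
    have "C_diff k ?S (\<lambda>z. f (inv_into V x z))"
      using T(3) unfolding smooth_on_def by (blast intro: C_diff_subset)
    then show "C_diff k ?S (\<lambda>z. g (inv_into V x z))"
      by (rule C_diff_cong[OF o, rotated]) (use N(3) chart_inv[OF Vx(1)] in auto)
  qed
  then show ?thesis using o T(2) N(2) Vx smooth_near_chart[OF Vx] by blast
qed

text \<open>One transfer serves sums, products and, with an ignored second argument,
  \<open>exp\<close>: the two neighbourhoods are intersected in the range of a common chart.\<close>

lemma sm_binop:
  fixes h :: "real \<Rightarrow> real \<Rightarrow> real"
  assumes h: "\<And>k (S :: (real^'n) set) F G. open S \<Longrightarrow> C_diff k S F \<Longrightarrow> C_diff k S G \<Longrightarrow> C_diff k S (\<lambda>z. h (F z) (G z))"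
    and f: "sm p f" and g: "sm p g"
  shows "sm p (\<lambda>q. h (f q) (g q))"
proof -
  obtain V x where Vx: "(V, x) \<in> M" "p \<in> V" by (rule ex_chart)
  obtain T where T: "open T" "x p \<in> T" "smooth_on T (\<lambda>z. f (inv_into V x z))"
    using f smooth_near_chart[OF Vx] by blast
  obtain T' where T': "open T'" "x p \<in> T'" "smooth_on T' (\<lambda>z. g (inv_into V x z))"
    using g smooth_near_chart[OF Vx] by blast
  have o: "open (T \<inter> T')" using T T' by blast
  have "smooth_on (T \<inter> T') (\<lambda>z. h (f (inv_into V x z)) (g (inv_into V x z)))"
    unfolding smooth_on_def
  proof
    fix k
    have "C_diff k (T \<inter> T') (\<lambda>z. f (inv_into V x z))" "C_diff k (T \<inter> T') (\<lambda>z. g (inv_into V x z))"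
      using T(3) T'(3) unfolding smooth_on_def by (blast intro: C_diff_subset)+
    from h[OF o this] show "C_diff k (T \<inter> T') (\<lambda>z. h (f (inv_into V x z)) (g (inv_into V x z)))" .
  qed
  then show ?thesis using o T(2) T'(2) smooth_near_chart[OF Vx] by blast
qed

lemma sm_add: "sm p f \<Longrightarrow> sm p g \<Longrightarrow> sm p (\<lambda>q. f q + g q)"
  using sm_binop[of "(+)"] C_diff_add by blast

lemma sm_mult: "sm p f \<Longrightarrow> sm p g \<Longrightarrow> sm p (\<lambda>q. f q * g q)"
  using sm_binop[of "(*)"] C_diff_mult by blast

lemma sm_exp: "sm p f \<Longrightarrow> sm p (\<lambda>q. exp (f q))"
  using sm_binop[of "\<lambda>a b. exp a" p f f] C_diff_exp by blast

lemma sm_const: "sm p (\<lambda>q. c)"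
proof -
  obtain V x where Vx: "(V, x) \<in> M" "p \<in> V" by (rule ex_chart)
  have "smooth_on UNIV (\<lambda>z::real^'n. c)" by (simp add: smooth_on_def C_diff_const)
  then show ?thesis using smooth_near_chart[OF Vx] by blast
qed

lemma sm_cmult: "sm p f \<Longrightarrow> sm p (\<lambda>q. c * f q)"
  using sm_mult[OF sm_const] .

lemma sm_uminus: "sm p f \<Longrightarrow> sm p (\<lambda>q. - f q)"
  using sm_cmult[of p f "-1"] by simp

lemma sm_diff: "sm p f \<Longrightarrow> sm p g \<Longrightarrow> sm p (\<lambda>q. f q - g q)"
  using sm_add[OF _ sm_uminus, of p f g] by simp

lemma sm_sum: "(\<And>i. i \<in> I \<Longrightarrow> sm p (f i)) \<Longrightarrow> sm p (\<lambda>q. \<Sum>i\<in>I. f i q)"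
proof (induction I rule: infinite_finite_induct)
  case (insert i I)
  then have "sm p (\<lambda>q. f i q + (\<Sum>i\<in>I. f i q))" by (intro sm_add) auto
  with insert show ?case by simp
qed (simp_all add: sm_const)

lemma sm_prod: "(\<And>i. i \<in> I \<Longrightarrow> sm p (f i)) \<Longrightarrow> sm p (\<lambda>q. \<Prod>i\<in>I. f i q)"
proof (induction I rule: infinite_finite_induct)
  case (insert i I)
  then have "sm p (\<lambda>q. f i q * (\<Prod>i\<in>I. f i q))" by (intro sm_mult) auto
  with insert show ?case by simp
qed (simp_all add: sm_const)

lemma sm_inverse:
  assumes "sm p f" "f p \<noteq> 0"
  shows "sm p (\<lambda>q. inverse (f q))"
proof -
  obtain V x where Vx: "(V, x) \<in> M" "p \<in> V" by (rule ex_chart)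
  obtain T where T: "open T" "x p \<in> T" "smooth_on T (\<lambda>z. f (inv_into V x z))"
    using assms(1) smooth_near_chart[OF Vx] by blast
  \<comment> \<open>By continuity the points of \<open>T\<close> where the coordinate expression
    does not vanish form an open set, and \<open>x p\<close> is one of them.\<close>
  define S where "S = T \<inter> (\<lambda>z. f (inv_into V x z)) -` (- {0})"
  have o: "open S" unfolding S_def
    by (rule continuous_open_preimage[OF smooth_on_continuous[OF T(3)] T(1)]) auto
  have "smooth_on S (\<lambda>z. inverse (f (inv_into V x z)))"
    unfolding smooth_on_def
  proof
    fix k
    have "C_diff k S (\<lambda>z. f (inv_into V x z))"
      using T(3) unfolding smooth_on_def S_def by (blast intro: C_diff_subset)
    then show "C_diff k S (\<lambda>z. inverse (f (inv_into V x z)))"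
      by (rule C_diff_inverse[OF o]) (auto simp: S_def)
  qed
  moreover have "x p \<in> S" using T(2) assms(2) chart_inv[OF Vx(1,2)] by (simp add: S_def)
  ultimately show ?thesis using o smooth_near_chart[OF Vx] by blast
qed

lemma sm_divide: "sm p f \<Longrightarrow> sm p g \<Longrightarrow> g p \<noteq> 0 \<Longrightarrow> sm p (\<lambda>q. f q / g q)"
  using sm_mult[OF _ sm_inverse, of p f g] by (simp add: divide_inverse)

lemma sm_det:
  fixes m :: "'m \<Rightarrow> 'k::finite \<Rightarrow> 'k \<Rightarrow> real"
  assumes "\<And>i j. sm p (\<lambda>q. m q i j)"
  shows "sm p (\<lambda>q. det (\<chi> i j. m q i j))"
  unfolding det_def by (intro sm_sum sm_cmult sm_prod) (simp add: assms)

lemma sm_chart_pullback: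
  assumes Vx: "(V, x) \<in> M" "p \<in> V" and G: "open T" "x p \<in> T" "smooth_on T G"
  shows "sm p (\<lambda>q. G (x q))"
proof -
  let ?S = "T \<inter> x ` V"
  have o: "open ?S" using G(1) chart_open_range[OF Vx(1)] by blast
  have "smooth_on ?S (\<lambda>z. G (x (inv_into V x z)))"
    unfolding smooth_on_def
  proof
    fix k
    have "C_diff k ?S G" using G(3) unfolding smooth_on_def by (blast intro: C_diff_subset)
    then show "C_diff k ?S (\<lambda>z. G (x (inv_into V x z)))"
      by (rule C_diff_cong[OF o, rotated]) (use chart_inv[OF Vx(1)] in auto)
  qed
  then show ?thesis using o G(2) Vx smooth_near_chart[OF Vx] by blast
qed

lemma sm_coordinate: "(V, x) \<in> M \<Longrightarrow> p \<in> V \<Longrightarrow> sm p (\<lambda>q. x q $ i)"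
  by (rule sm_chart_pullback[where T = UNIV]) (auto simp: smooth_on_def C_diff_component)


section \<open>Derivations at a point\<close>

context
  fixes v p assumes v: "v \<in> TT p"
begin

lemma tv_nonsmooth: "\<not> sm p f \<Longrightarrow> v f = 0"
  and tv_add: "sm p f \<Longrightarrow> sm p g \<Longrightarrow> v (\<lambda>q. f q + g q) = v f + v g"
  and tv_mult: "sm p f \<Longrightarrow> sm p g \<Longrightarrow> v (\<lambda>q. f q * g q) = f p * v g + g p * v f"
  and tv_cmult: "sm p f \<Longrightarrow> v (\<lambda>q. c * f q) = c * v f"
  using v unfolding tangent_space_def by blast+

lemma tv_const: "v (\<lambda>q. c) = 0"
proof -
  have "v (\<lambda>q. 1 * 1) = 1 * v (\<lambda>q. 1) + 1 * v (\<lambda>q. 1)"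
    by (rule tv_mult) (rule sm_const)+
  then have "v (\<lambda>q. 1) = 0" by simp
  with tv_cmult[OF sm_const, of c 1] show ?thesis by simp
qed

lemma tv_uminus: "sm p f \<Longrightarrow> v (\<lambda>q. - f q) = - v f"
  using tv_cmult[of f "-1"] by simp

lemma tv_diff: "sm p f \<Longrightarrow> sm p g \<Longrightarrow> v (\<lambda>q. f q - g q) = v f - v g"
  using tv_add[OF _ sm_uminus, of f g] tv_uminus by simp

lemma tv_sum: "(\<And>i. i \<in> I \<Longrightarrow> sm p (f i)) \<Longrightarrow> v (\<lambda>q. \<Sum>i\<in>I. f i q) = (\<Sum>i\<in>I. v (f i))"
proof (induction I rule: infinite_finite_induct)
  case (insert i I)
  have "v (\<lambda>q. f i q + (\<Sum>i\<in>I. f i q)) = v (f i) + v (\<lambda>q. \<Sum>i\<in>I. f i q)"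
    using insert.prems by (intro tv_add sm_sum) auto
  with insert show ?case by simp
qed (simp_all add: tv_const)

text \<open>No smooth bump function is needed for locality: \<open>f = f \<cdot> \<xi>\<close> with the discontinuous
  \<open>\<xi>\<close> equal to \<open>0\<close> near the point.\<close>

lemma tv_cong:
  assumes fg: "\<forall>\<^sub>F q in nhds p. f q = g q"
  shows "v f = v g"
proof (cases "sm p f")
  case False
  moreover have "\<not> sm p g"
    using False sm_cong[of g f p] fg by (auto simp: eq_commute)
  ultimately show ?thesis using tv_nonsmooth by simp
next
  case True
  then have g: "sm p g" using sm_cong fg by blast
  obtain N where N: "open N" "p \<in> N" "\<And>q. q \<in> N \<Longrightarrow> f q = g q"
    using fg unfolding eventually_nhds by blast
  define \<xi> :: "'m \<Rightarrow> real" where "\<xi> q = (if q \<in> N then 0 else 1)" for q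
  have \<xi>: "sm p \<xi>"
    by (rule sm_cong[OF _ sm_const[of p 0]], rule eventually_nhds_open[OF N(1,2)]) (simp add: \<xi>_def)
  have "v (\<lambda>q. f q - g q) = v (\<lambda>q. (f q - g q) * \<xi> q)"
    using N(3) by (intro arg_cong[of _ _ v] ext) (simp add: \<xi>_def)
  also have "\<dots> = (f p - g p) * v \<xi> + \<xi> p * v (\<lambda>q. f q - g q)"
    using True g \<xi> by (intro tv_mult sm_diff)
  also have "\<dots> = 0" using N(2,3) by (simp add: \<xi>_def)
  finally show ?thesis using tv_diff[OF True g] by simp
qed

end

lemma TT_lincomb:
  assumes "v \<in> TT p" "w \<in> TT p"
  shows "(\<lambda>f. a * v f + b * w f) \<in> TT p"
  unfolding tangent_space_def
  using tv_nonsmooth[OF assms(1)] tv_nonsmooth[OF assms(2)] tv_add[OF assms(1)] tv_add[OF assms(2)]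
    tv_mult[OF assms(1)] tv_mult[OF assms(2)] tv_cmult[OF assms(1)] tv_cmult[OF assms(2)]
  by (simp add: algebra_simps)

lemma TT_zero: "(\<lambda>f. 0) \<in> TT p" by (simp add: tangent_space_def)

lemma TT_scale: "v \<in> TT p \<Longrightarrow> (\<lambda>f. a * v f) \<in> TT p"
  using TT_lincomb[of v p v a 0] by simp

lemma TT_add: "v \<in> TT p \<Longrightarrow> w \<in> TT p \<Longrightarrow> (\<lambda>f. v f + w f) \<in> TT p"
  using TT_lincomb[of v p w 1 1] by simp

lemma TT_sum: "(\<And>i. i \<in> I \<Longrightarrow> v i \<in> TT p) \<Longrightarrow> (\<lambda>f. \<Sum>i\<in>I. c i * v i f) \<in> TT p"
proof (induction I rule: infinite_finite_induct)
  case (insert i I)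
  have "(\<lambda>f. c i * v i f + 1 * (\<Sum>i\<in>I. c i * v i f)) \<in> TT p"
    using insert by (intro TT_lincomb) auto
  with insert show ?case by simp
qed (simp_all add: TT_zero)

text \<open>The value 0 on functions that are not smooth near \<open>p\<close> follows the
  convention of \<open>tangent_space\<close>; without it this would not be a tangent vector.\<close>

definition coord_vec :: "'m set \<Rightarrow> ('m \<Rightarrow> real^'n) \<Rightarrow> 'n \<Rightarrow> 'm vfield" where
  "coord_vec V x i p = (\<lambda>f. if sm p f then partial_deriv i (\<lambda>z. f (inv_into V x z)) (x p) else 0)"

context
  fixes V and x :: "'m \<Rightarrow> real^'n"
  assumes Vx: "(V, x) \<in> M"
begin

lemma chart_differentiable:
  assumes "p \<in> V" "sm p f"
  shows "(\<lambda>z. f (inv_into V x z)) differentiable (at (x p))"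
  using assms smooth_near_chart[OF Vx assms(1)] smooth_on_differentiable by blast

lemma coord_vec_TT:
  assumes p: "p \<in> V"
  shows "coord_vec V x i p \<in> TT p"
proof -
  have a: "coord_vec V x i p (\<lambda>q. f q + g q) = coord_vec V x i p f + coord_vec V x i p g"
    and m: "coord_vec V x i p (\<lambda>q. f q * g q) = f p * coord_vec V x i p g + g p * coord_vec V x i p f"
    if "sm p f" "sm p g" for f g
    using partial_deriv_add[OF chart_differentiable[OF p that(1)] chart_differentiable[OF p that(2)], of i]
      partial_deriv_mult[OF chart_differentiable[OF p that(1)] chart_differentiable[OF p that(2)], of i]
      sm_add[OF that] sm_mult[OF that] that chart_inv[OF Vx p]
    by (simp_all add: coord_vec_def mult.commute)
  have "coord_vec V x i p (\<lambda>q. c * f q) = c * coord_vec V x i p f" if "sm p f" for c f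
    using m[OF sm_const that, of c] by (simp add: coord_vec_def partial_deriv_const)
  then show ?thesis unfolding tangent_space_def using a m by (simp add: coord_vec_def)
qed

lemma coord_vec_smooth:
  assumes p: "p \<in> V" and f: "sm p f"
  shows "sm p (\<lambda>q. coord_vec V x i q f)"
proof -
  obtain U where U: "open U" "p \<in> U" "smooth_fun M U f" using f unfolding smooth_near_def by blast
  let ?T = "x ` (U \<inter> V)" and ?F = "\<lambda>z. f (inv_into V x z)"
  have o: "open ?T" using chart_open_image[OF Vx U(1)] .
  have F: "smooth_on ?T (partial_deriv i ?F)"
    using U(3) Vx by (intro smooth_on_partial_deriv) (auto simp: smooth_fun_def)
  have "smooth_on ?T (\<lambda>z. coord_vec V x i (inv_into V x z) f)"
    unfolding smooth_on_def
  proof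
    fix k
    have "C_diff k ?T (partial_deriv i ?F)" using F unfolding smooth_on_def by blast
    then show "C_diff k ?T (\<lambda>z. coord_vec V x i (inv_into V x z) f)"
    proof (rule C_diff_cong[OF o, rotated])
      fix z assume "z \<in> ?T"
      then obtain q where q: "q \<in> U" "q \<in> V" "z = x q" by blast
      moreover have "sm q f" using q U unfolding smooth_near_def by blast
      ultimately show "partial_deriv i ?F z = coord_vec V x i (inv_into V x z) f"
        using chart_inv[OF Vx] by (simp add: coord_vec_def)
    qed
  qed
  then show ?thesis using o U p smooth_near_chart[OF Vx p] by blast
qed

lemma coord_vec_coordinate:
  assumes p: "p \<in> V"
  shows "coord_vec V x i p (\<lambda>q. x q $ j) = of_bool (i = j)"
proof -
  have "partial_deriv i (\<lambda>z. x (inv_into V x z) $ j) (x p) = partial_deriv i (\<lambda>z. z $ j) (x p)"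
    by (rule partial_deriv_cong[OF chart_open_range[OF Vx]]) (use p chart_inv[OF Vx] in auto)
  then show ?thesis using sm_coordinate[OF Vx p] by (simp add: coord_vec_def partial_deriv_component)
qed

text \<open>By Hadamard's lemma \<open>f\<close> is, near \<open>p\<close>, a constant plus a sum of
  products of coordinate differences and smooth functions. The differences vanish at
  \<open>p\<close>, so the Leibniz rule leaves their derivatives times the values of the other
  factors, which are the partial derivatives of \<open>f\<close>. On functions that are not smooth
  near \<open>p\<close> both sides are 0 by convention, which makes this an equality of
  functionals.\<close>

lemma tangent_expand_coords:
  assumes p: "p \<in> V" and v: "v \<in> TT p"
  shows "v = (\<lambda>f. \<Sum>i\<in>UNIV. v (\<lambda>q. x q $ i) * coord_vec V x i p f)"
proof
  fix f
  show "v f = (\<Sum>i\<in>UNIV. v (\<lambda>q. x q $ i) * coord_vec V x i p f)"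
  proof (cases "sm p f")
    case False
    then show ?thesis using tv_nonsmooth[OF v] by (simp add: coord_vec_def)
  next
    case True
    let ?F = "\<lambda>z. f (inv_into V x z)" and ?a = "x p"
    obtain T where T: "open T" "?a \<in> T" "smooth_on T ?F"
      using True smooth_near_chart[OF Vx p] by blast
    then obtain r where r: "r > 0" "ball ?a r \<subseteq> T" using open_contains_ball by blast
    have F: "smooth_on (ball ?a r) ?F"
      using T(3) r(2) unfolding smooth_on_def by (blast intro: C_diff_subset)
    define g where "g i = ray_mean ?a 0 (partial_deriv i ?F)" for i
    have g: "sm p (\<lambda>q. g i (x q))" for i
      unfolding g_def
      by (rule sm_chart_pullback[OF Vx p open_ball _ smooth_on_ray_mean[OF smooth_on_partial_deriv[OF F]]])
        (use r(1) in simp)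
    have c: "sm p (\<lambda>q. x q $ i - ?a $ i)" for i
      by (intro sm_diff sm_const sm_coordinate[OF Vx p])
    have vc: "v (\<lambda>q. x q $ i - ?a $ i) = v (\<lambda>q. x q $ i)" for i
      using tv_diff[OF v sm_coordinate[OF Vx p] sm_const] tv_const[OF v] by simp
    have sms: "sm p (\<lambda>q. \<Sum>i\<in>UNIV. (x q $ i - ?a $ i) * g i (x q))"
      by (rule sm_sum) (rule sm_mult[OF c g])
    have vs: "v (\<lambda>q. \<Sum>i\<in>UNIV. (x q $ i - ?a $ i) * g i (x q)) = (\<Sum>i\<in>UNIV. v (\<lambda>q. (x q $ i - ?a $ i) * g i (x q)))"
      by (rule tv_sum[OF v]) (rule sm_mult[OF c g])
    have "v f = v (\<lambda>q. f p + (\<Sum>i\<in>UNIV. (x q $ i - ?a $ i) * g i (x q)))"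
    proof (rule tv_cong[OF v], rule eventually_nhds_open[OF chart_open_preimage[OF Vx open_ball]])
      show "p \<in> {q \<in> V. x q \<in> ball ?a r}" using p r by simp
      fix q assume "q \<in> {q \<in> V. x q \<in> ball ?a r}"
      then show "f q = f p + (\<Sum>i\<in>UNIV. (x q $ i - ?a $ i) * g i (x q))"
        using hadamard[OF F, of "x q"] chart_inv[OF Vx] p by (simp add: g_def)
    qed
    also have "\<dots> = (\<Sum>i\<in>UNIV. v (\<lambda>q. (x q $ i - ?a $ i) * g i (x q)))"
      using tv_add[OF v sm_const[of p "f p"] sms] vs tv_const[OF v] by simp
    also have "\<dots> = (\<Sum>i\<in>UNIV. v (\<lambda>q. x q $ i) * coord_vec V x i p f)"
      using tv_mult[OF v c g] vc True by (simp add: coord_vec_def g_def ray_mean_center mult.commute)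
    finally show ?thesis .
  qed
qed

lemma tangent_eqI_coords:
  assumes "p \<in> V" "v \<in> TT p" "w \<in> TT p" "\<And>i. v (\<lambda>q. x q $ i) = w (\<lambda>q. x q $ i)"
  shows "v = w"
proof
  fix f
  have "v f = (\<Sum>i\<in>UNIV. v (\<lambda>q. x q $ i) * coord_vec V x i p f)"
    by (rule fun_cong[OF tangent_expand_coords[OF assms(1,2)]])
  also have "\<dots> = (\<Sum>i\<in>UNIV. w (\<lambda>q. x q $ i) * coord_vec V x i p f)" using assms(4) by simp
  also have "\<dots> = w f" by (rule fun_cong[OF tangent_expand_coords[OF assms(1,3)], symmetric])
  finally show "v f = w f" .
qed

end

end


section \<open>Local fields and frames\<close>

context manifold
begin

text \<open>Germ versions of \<open>vector_field\<close>, \<open>one_form\<close> and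
  \<open>frame\<close>. Fields with different domains can be combined at a point without naming a
  common domain, since the neighbourhoods are merged by \<open>eventually\<close>.\<close>

definition vf_near :: "'m \<Rightarrow> 'm vfield \<Rightarrow> bool" where
  "vf_near p X \<longleftrightarrow> (\<exists>U. open U \<and> p \<in> U \<and> vector_field M U X)"

definition form_near :: "'m \<Rightarrow> 'm form \<Rightarrow> bool" where
  "form_near p A \<longleftrightarrow> (\<exists>U. open U \<and> p \<in> U \<and> one_form M U A)"

definition frame_near :: "'m \<Rightarrow> ('n \<Rightarrow> 'm vfield) \<Rightarrow> bool" where
  "frame_near p E \<longleftrightarrow> (\<exists>U. open U \<and> p \<in> U \<and> frame M U E)"

lemma vector_field_subset: "vector_field M U X \<Longrightarrow> W \<subseteq> U \<Longrightarrow> vector_field M W X"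
  unfolding vector_field_def by (auto dest: order_trans)

lemma one_form_subset: "one_form M U A \<Longrightarrow> W \<subseteq> U \<Longrightarrow> one_form M W A"
  unfolding one_form_def by (auto dest: order_trans)

lemma frame_subset: "frame M U E \<Longrightarrow> W \<subseteq> U \<Longrightarrow> frame M W E"
proof -
  assume "frame M U E" "W \<subseteq> U"
  then show "frame M W E"
    unfolding frame_def using vector_field_subset[OF _ \<open>W \<subseteq> U\<close>] by (simp add: subsetD)
qed

lemma vf_nearI: "vector_field M U X \<Longrightarrow> open U \<Longrightarrow> p \<in> U \<Longrightarrow> vf_near p X"
  and form_nearI: "one_form M U A \<Longrightarrow> open U \<Longrightarrow> p \<in> U \<Longrightarrow> form_near p A"
  and frame_nearI: "frame M U E \<Longrightarrow> open U \<Longrightarrow> p \<in> U \<Longrightarrow> frame_near p E"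
  unfolding vf_near_def form_near_def frame_near_def by blast+

lemma vf_near_eventually: "vf_near p X \<Longrightarrow> \<forall>\<^sub>F q in nhds p. vf_near q X"
  and form_near_eventually: "form_near p A \<Longrightarrow> \<forall>\<^sub>F q in nhds p. form_near q A"
  and frame_near_eventually: "frame_near p E \<Longrightarrow> \<forall>\<^sub>F q in nhds p. frame_near q E"
  unfolding eventually_nhds vf_near_def form_near_def frame_near_def by blast+

lemma vf_near_TT: "vf_near p X \<Longrightarrow> X p \<in> TT p"
  unfolding vf_near_def vector_field_def by blast

lemma vf_near_sm: "vf_near p X \<Longrightarrow> sm p f \<Longrightarrow> sm p (\<lambda>q. X q f)"
proof -
  assume "vf_near p X" "sm p f"
  then obtain U N where U: "open U" "p \<in> U" "vector_field M U X" and N: "open N" "p \<in> N" "smooth_fun M N f"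
    unfolding vf_near_def smooth_near_def by blast
  have "smooth_fun M (U \<inter> N) (\<lambda>q. X q f)"
    using U N smooth_fun_subset[OF N(3), of "U \<inter> N"] unfolding vector_field_def by (simp add: open_Int)
  then show ?thesis using U N unfolding smooth_near_def by blast
qed

lemma vector_fieldI:
  assumes "open U" "\<And>p. p \<in> U \<Longrightarrow> X p \<in> TT p" "\<And>p f. p \<in> U \<Longrightarrow> sm p f \<Longrightarrow> sm p (\<lambda>q. X q f)"
  shows "vector_field M U X"
  unfolding vector_field_def using assms by (auto simp: smooth_fun_iff)

lemma vector_field_iff:
  assumes "open U"
  shows "vector_field M U X \<longleftrightarrow> (\<forall>p\<in>U. vf_near p X)"
proof
  assume "vector_field M U X" then show "\<forall>p\<in>U. vf_near p X" using assms vf_nearI by blast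
next
  assume *: "\<forall>p\<in>U. vf_near p X"
  show "vector_field M U X"
  proof (rule vector_fieldI[OF assms])
    fix p assume "p \<in> U"
    with * have X: "vf_near p X" by blast
    then show "X p \<in> TT p" by (rule vf_near_TT)
    show "sm p (\<lambda>q. X q f)" if "sm p f" for f using X that by (rule vf_near_sm)
  qed
qed

lemma vf_near_cong:
  assumes "\<forall>\<^sub>F q in nhds p. X q = Y q" "vf_near p X"
  shows "vf_near p Y"
proof -
  obtain U N where U: "open U" "p \<in> U" "vector_field M U X" and N: "open N" "p \<in> N" "\<And>q. q \<in> N \<Longrightarrow> X q = Y q"
    using assms unfolding vf_near_def eventually_nhds by blast
  have "vector_field M (U \<inter> N) Y"
  proof (rule vector_fieldI)
    show "open (U \<inter> N)" using U N by blast
    fix q assume q: "q \<in> U \<inter> N"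
    then have X: "vf_near q X" using vf_nearI[OF U(3,1)] by blast
    then show "Y q \<in> TT q" using vf_near_TT N(3) q by fastforce
    fix f assume "sm q f"
    from vf_near_sm[OF X this] show "sm q (\<lambda>r. Y r f)"
      by (rule sm_cong[rotated]) (rule eventually_nhds_open[OF N(1)], use q N(3) in auto)
  qed
  then show ?thesis using U N by (intro vf_nearI[of "U \<inter> N"]) auto
qed

lemma vf_near_add: "vf_near p X \<Longrightarrow> vf_near p Y \<Longrightarrow> vf_near p (\<lambda>q f. X q f + Y q f)"
proof -
  assume "vf_near p X" "vf_near p Y"
  then have "\<forall>\<^sub>F q in nhds p. vf_near q X \<and> vf_near q Y"
    using vf_near_eventually eventually_conj by blast
  then obtain U where U: "open U" "p \<in> U" "\<And>q. q \<in> U \<Longrightarrow> vf_near q X \<and> vf_near q Y"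
    unfolding eventually_nhds by blast
  have "vector_field M U (\<lambda>q f. X q f + Y q f)"
  proof (rule vector_fieldI[OF U(1)])
    fix q assume "q \<in> U"
    then have X: "vf_near q X" and Y: "vf_near q Y" using U(3) by blast+
    show "(\<lambda>f. X q f + Y q f) \<in> TT q" by (rule TT_add[OF vf_near_TT[OF X] vf_near_TT[OF Y]])
    show "sm q (\<lambda>r. X r f + Y r f)" if "sm q f" for f
      by (rule sm_add[OF vf_near_sm[OF X that] vf_near_sm[OF Y that]])
  qed
  then show ?thesis using U by (intro vf_nearI)
qed

lemma vf_near_scale: "sm p h \<Longrightarrow> vf_near p X \<Longrightarrow> vf_near p (\<lambda>q f. h q * X q f)"
proof -
  assume "sm p h" "vf_near p X"
  then have "\<forall>\<^sub>F q in nhds p. sm q h \<and> vf_near q X"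
    using vf_near_eventually sm_eventually eventually_conj by blast
  then obtain U where U: "open U" "p \<in> U" "\<And>q. q \<in> U \<Longrightarrow> sm q h \<and> vf_near q X"
    unfolding eventually_nhds by blast
  have "vector_field M U (\<lambda>q f. h q * X q f)"
  proof (rule vector_fieldI[OF U(1)])
    fix q assume "q \<in> U"
    then have h: "sm q h" and X: "vf_near q X" using U(3) by blast+
    show "(\<lambda>f. h q * X q f) \<in> TT q" by (rule TT_scale[OF vf_near_TT[OF X]])
    show "sm q (\<lambda>r. h r * X r f)" if "sm q f" for f
      by (rule sm_mult[OF h vf_near_sm[OF X that]])
  qed
  then show ?thesis using U by (intro vf_nearI)
qed

lemma vf_near_zero: "vf_near p (\<lambda>q f. 0)"
proof (rule vf_nearI[OF _ open_UNIV UNIV_I])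
  show "vector_field M UNIV (\<lambda>q f. 0)"
    by (rule vector_fieldI[OF open_UNIV]) (rule TT_zero, rule sm_const)
qed

lemma vf_near_sum:
  "(\<And>i. i \<in> I \<Longrightarrow> sm p (h i)) \<Longrightarrow> (\<And>i. i \<in> I \<Longrightarrow> vf_near p (X i)) \<Longrightarrow>
    vf_near p (\<lambda>q f. \<Sum>i\<in>I. h i q * X i q f)"
proof (induction I rule: infinite_finite_induct)
  case (insert i I)
  have "vf_near p (\<lambda>q f. h i q * X i q f + (\<Sum>i\<in>I. h i q * X i q f))"
    by (rule vf_near_add[OF vf_near_scale]) (use insert in simp_all)
  with insert show ?case by simp
qed (simp_all add: vf_near_zero)

text \<open>In the Leibniz rule the products of first derivatives
  \<open>X f * Y g + Y f * X g\<close> are symmetric in \<open>X\<close> and \<open>Y\<close> and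
  cancel, so the commutator of two derivations is again a derivation.\<close>

lemma vf_near_lie_bracket:
  assumes "vf_near p X" "vf_near p Y"
  shows "vf_near p (lie_bracket M X Y)"
proof -
  have "\<forall>\<^sub>F q in nhds p. vf_near q X \<and> vf_near q Y"
    using vf_near_eventually assms eventually_conj by blast
  then obtain U where U: "open U" "p \<in> U" "\<And>q. q \<in> U \<Longrightarrow> vf_near q X \<and> vf_near q Y"
    unfolding eventually_nhds by blast
  have "vector_field M U (lie_bracket M X Y)"
  proof (rule vector_fieldI[OF U(1)])
    fix q assume "q \<in> U"
    then have X: "vf_near q X" and Y: "vf_near q Y" using U(3) by blast+
    note Xq = vf_near_TT[OF X] and Yq = vf_near_TT[OF Y]
    \<comment> \<open>The outer vector differentiates the result of the inner one, so the rules for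
      the inner one are needed at all points near \<open>q\<close>.\<close>
    have ev: "\<forall>\<^sub>F r in nhds q. X r \<in> TT r \<and> Y r \<in> TT r \<and> sm r f \<and> sm r g" if "sm q f" "sm q g" for f g
      using eventually_conj[OF vf_near_eventually[OF X] eventually_conj[OF vf_near_eventually[OF Y]
        eventually_conj[OF sm_eventually[OF that(1)] sm_eventually[OF that(2)]]]]
      by eventually_elim (simp add: vf_near_TT)
    have "lie_bracket M X Y q (\<lambda>q. f q + g q) = lie_bracket M X Y q f + lie_bracket M X Y q g"
      if f: "sm q f" and g: "sm q g" for f g
    proof -
      have "X q (\<lambda>r. Y r (\<lambda>q. f q + g q)) = X q (\<lambda>r. Y r f + Y r g)"
        by (rule tv_cong[OF Xq], rule eventually_mono[OF ev[OF f g]]) (auto intro: tv_add)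
      moreover have "Y q (\<lambda>r. X r (\<lambda>q. f q + g q)) = Y q (\<lambda>r. X r f + X r g)"
        by (rule tv_cong[OF Yq], rule eventually_mono[OF ev[OF f g]]) (auto intro: tv_add)
      ultimately show ?thesis
        using tv_add[OF Xq vf_near_sm[OF Y f] vf_near_sm[OF Y g]]
          tv_add[OF Yq vf_near_sm[OF X f] vf_near_sm[OF X g]] f g sm_add[OF f g]
        by (simp add: lie_bracket_def)
    qed
    moreover have mult: "lie_bracket M X Y q (\<lambda>q. f q * g q) = f q * lie_bracket M X Y q g + g q * lie_bracket M X Y q f"
      if f: "sm q f" and g: "sm q g" for f g
    proof -
      have "X q (\<lambda>r. Y r (\<lambda>q. f q * g q)) = X q (\<lambda>r. f r * Y r g + g r * Y r f)"
        by (rule tv_cong[OF Xq], rule eventually_mono[OF ev[OF f g]]) (auto intro: tv_mult)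
      moreover have "Y q (\<lambda>r. X r (\<lambda>q. f q * g q)) = Y q (\<lambda>r. f r * X r g + g r * X r f)"
        by (rule tv_cong[OF Yq], rule eventually_mono[OF ev[OF f g]]) (auto intro: tv_mult)
      ultimately show ?thesis
        using tv_add[OF Xq sm_mult[OF f vf_near_sm[OF Y g]] sm_mult[OF g vf_near_sm[OF Y f]]]
          tv_add[OF Yq sm_mult[OF f vf_near_sm[OF X g]] sm_mult[OF g vf_near_sm[OF X f]]]
          tv_mult[OF Xq f vf_near_sm[OF Y g]] tv_mult[OF Xq g vf_near_sm[OF Y f]]
          tv_mult[OF Yq f vf_near_sm[OF X g]] tv_mult[OF Yq g vf_near_sm[OF X f]]
          f g sm_mult[OF f g]
        by (simp add: lie_bracket_def algebra_simps)
    qed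
    moreover have "lie_bracket M X Y q (\<lambda>q. c * f q) = c * lie_bracket M X Y q f" if f: "sm q f" for c f
    proof -
      have "lie_bracket M X Y q (\<lambda>q. c) = X q (\<lambda>r. Y r (\<lambda>q. c)) - Y q (\<lambda>r. X r (\<lambda>q. c))"
        by (simp add: lie_bracket_def sm_const)
      also have "X q (\<lambda>r. Y r (\<lambda>q. c)) = X q (\<lambda>r. 0)"
        by (rule tv_cong[OF Xq], rule eventually_mono[OF ev[OF f f]]) (auto intro: tv_const)
      also have "Y q (\<lambda>r. X r (\<lambda>q. c)) = Y q (\<lambda>r. 0)"
        by (rule tv_cong[OF Yq], rule eventually_mono[OF ev[OF f f]]) (auto intro: tv_const)
      finally show ?thesis using mult[OF sm_const f, of c] tv_const[OF Xq] tv_const[OF Yq] by simp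
    qed
    ultimately show "lie_bracket M X Y q \<in> TT q"
      unfolding tangent_space_def by (simp add: lie_bracket_def)
    fix f assume f: "sm q f"
    have "sm q (\<lambda>r. X r (\<lambda>q. Y q f) - Y r (\<lambda>q. X q f))"
      by (intro sm_diff vf_near_sm[OF X] vf_near_sm[OF Y] f)
    then show "sm q (\<lambda>r. lie_bracket M X Y r f)"
      by (rule sm_cong[rotated], intro eventually_mono[OF ev[OF f f]]) (simp add: lie_bracket_def)
  qed
  then show ?thesis using U by (intro vf_nearI)
qed

section \<open>Frames, coframes and covectors\<close>

lemma frame_near_vf: "frame_near p E \<Longrightarrow> vf_near p (E a)"
  unfolding frame_near_def frame_def by (elim exE conjE) (rule vf_nearI, erule spec)

lemma frame_near_TT: "frame_near p E \<Longrightarrow> E a p \<in> TT p"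
  by (rule vf_near_TT[OF frame_near_vf])

lemma frame_near_basis:
  assumes "frame_near p E" "v \<in> TT p"
  shows "\<exists>!\<xi>::real^'n. v = (\<lambda>f. \<Sum>a\<in>UNIV. \<xi> $ a * E a p f)"
proof -
  obtain U where U: "p \<in> U" "frame M U E" using assms(1) unfolding frame_near_def by (elim exE conjE)
  have "\<forall>p\<in>U. \<forall>v\<in>TT p. \<exists>!\<xi>::real^'n. v = (\<lambda>f. \<Sum>a\<in>UNIV. \<xi> $ a * E a p f)"
    using U(2) unfolding frame_def by (rule conjunct2)
  from bspec[OF bspec[OF this U(1)] assms(2)] show ?thesis .
qed

lemma coframe_expand:
  assumes "frame_near p E" "v \<in> TT p"
  shows "v = (\<lambda>f. \<Sum>a\<in>UNIV. coframe M E a p v * E a p f)"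
proof -
  have c: "coframe M E a p v = (THE \<xi>::real^'n. v = (\<lambda>f. \<Sum>b\<in>UNIV. \<xi> $ b * E b p f)) $ a" for a
    using assms(2) by (simp add: coframe_def)
  show ?thesis
    unfolding c by (rule theI'[OF frame_near_basis[OF assms]])
qed

lemma coframe_lincomb:
  assumes "frame_near p E"
  shows "coframe M E a p (\<lambda>f. \<Sum>b\<in>UNIV. c b * E b p f) = c a"
proof -
  let ?v = "\<lambda>f. \<Sum>b\<in>UNIV. c b * E b p f"
  have v: "?v \<in> TT p" by (rule TT_sum) (rule frame_near_TT[OF assms])
  have "(THE \<xi>::real^'n. ?v = (\<lambda>f. \<Sum>b\<in>UNIV. \<xi> $ b * E b p f)) = (\<chi> b. c b)"
    by (rule the1_equality[OF frame_near_basis[OF assms v]]) simp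
  then show ?thesis using v by (simp add: coframe_def)
qed

lemma coframe_eqI:
  assumes "frame_near p E" "v = (\<lambda>f. \<Sum>b\<in>UNIV. c b * E b p f)"
  shows "coframe M E a p v = c a"
  unfolding assms(2) by (rule coframe_lincomb[OF assms(1)])

lemma coframe_frame:
  assumes "frame_near p E"
  shows "coframe M E a p (E b p) = of_bool (a = b)"
proof (rule coframe_eqI[OF assms, of "E b p" "\<lambda>a. of_bool (a = b)" a])
  have "(\<Sum>a\<in>UNIV. of_bool (a = b) * E a p f) = (\<Sum>a\<in>UNIV. if a = b then E a p f else 0)" for f
    by (intro sum.cong) auto
  then show "E b p = (\<lambda>f. \<Sum>a\<in>UNIV. of_bool (a = b) * E a p f)" by simp
qed

lemma CT_linear:
  assumes "\<alpha> \<in> CT p" "v \<in> TT p" "w \<in> TT p"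
  shows "\<alpha> (\<lambda>f. a * v f + b * w f) = a * \<alpha> v + b * \<alpha> w"
  using assms unfolding cotangent_space_def by blast

lemma CT_outside: "\<alpha> \<in> CT p \<Longrightarrow> v \<notin> TT p \<Longrightarrow> \<alpha> v = 0"
  unfolding cotangent_space_def by blast

lemma CT_zero_vec: "\<alpha> \<in> CT p \<Longrightarrow> \<alpha> (\<lambda>f. 0) = 0"
  using CT_linear[OF _ TT_zero TT_zero, of \<alpha> p 0 0] by simp

lemma CT_scale: "\<alpha> \<in> CT p \<Longrightarrow> v \<in> TT p \<Longrightarrow> \<alpha> (\<lambda>f. a * v f) = a * \<alpha> v"
  using CT_linear[of \<alpha> p v v a 0] by simp

lemma CT_add: "\<alpha> \<in> CT p \<Longrightarrow> v \<in> TT p \<Longrightarrow> w \<in> TT p \<Longrightarrow> \<alpha> (\<lambda>f. v f + w f) = \<alpha> v + \<alpha> w"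
  using CT_linear[of \<alpha> p v w 1 1] by simp

lemma CT_diff: "\<alpha> \<in> CT p \<Longrightarrow> v \<in> TT p \<Longrightarrow> w \<in> TT p \<Longrightarrow> \<alpha> (\<lambda>f. v f - w f) = \<alpha> v - \<alpha> w"
  using CT_linear[of \<alpha> p v w 1 "-1"] by simp

lemma CT_sum:
  assumes "\<alpha> \<in> CT p"
  shows "(\<And>i. i \<in> I \<Longrightarrow> v i \<in> TT p) \<Longrightarrow> \<alpha> (\<lambda>f. \<Sum>i\<in>I. c i * v i f) = (\<Sum>i\<in>I. c i * \<alpha> (v i))"
proof (induction I rule: infinite_finite_induct)
  case (insert i I)
  have "\<alpha> (\<lambda>f. c i * v i f + 1 * (\<Sum>i\<in>I. c i * v i f)) = c i * \<alpha> (v i) + 1 * \<alpha> (\<lambda>f. \<Sum>i\<in>I. c i * v i f)"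
    using insert by (intro CT_linear[OF assms] TT_sum) auto
  with insert show ?case by simp
qed (simp_all add: CT_zero_vec[OF assms])

lemma CT_I:
  assumes "\<And>v. v \<notin> TT p \<Longrightarrow> \<alpha> v = 0"
    "\<And>v w a b. v \<in> TT p \<Longrightarrow> w \<in> TT p \<Longrightarrow> \<alpha> (\<lambda>f. a * v f + b * w f) = a * \<alpha> v + b * \<alpha> w"
  shows "\<alpha> \<in> CT p"
  using assms unfolding cotangent_space_def by blast

lemma CT_lincomb:
  assumes "\<alpha> \<in> CT p" "\<beta> \<in> CT p"
  shows "(\<lambda>v. a * \<alpha> v + b * \<beta> v) \<in> CT p"
  by (rule CT_I) (simp_all add: CT_outside[OF assms(1)] CT_outside[OF assms(2)]
      CT_linear[OF assms(1)] CT_linear[OF assms(2)] algebra_simps)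

lemma CT_zero: "(\<lambda>v. 0) \<in> CT p" by (rule CT_I) simp_all

lemma CT_sum_mem: "(\<And>i. i \<in> I \<Longrightarrow> \<alpha> i \<in> CT p) \<Longrightarrow> (\<lambda>v. \<Sum>i\<in>I. c i * \<alpha> i v) \<in> CT p"
proof (induction I rule: infinite_finite_induct)
  case (insert i I)
  have "(\<lambda>v. c i * \<alpha> i v + 1 * (\<Sum>i\<in>I. c i * \<alpha> i v)) \<in> CT p"
    using insert by (intro CT_lincomb) auto
  with insert show ?case by simp
qed (simp_all add: CT_zero)

lemma coframe_CT:
  assumes E: "frame_near p E"
  shows "coframe M E a p \<in> CT p"
proof (rule CT_I)
  fix v w r s assume v: "v \<in> TT p" and w: "w \<in> TT p"
  have "(\<lambda>f. r * v f + s * w f) = (\<lambda>f. \<Sum>b\<in>UNIV. (r * coframe M E b p v + s * coframe M E b p w) * E b p f)"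
    by (subst coframe_expand[OF E v], subst coframe_expand[OF E w])
      (simp add: sum_distrib_left sum.distrib distrib_right mult.assoc)
  from coframe_eqI[OF E this]
  show "coframe M E a p (\<lambda>f. r * v f + s * w f) = r * coframe M E a p v + s * coframe M E a p w" .
qed (simp add: coframe_def)

lemma CT_expand:
  assumes E: "frame_near p E" and \<alpha>: "\<alpha> \<in> CT p"
  shows "\<alpha> = (\<lambda>v. \<Sum>a\<in>UNIV. \<alpha> (E a p) * coframe M E a p v)"
proof
  fix v
  show "\<alpha> v = (\<Sum>a\<in>UNIV. \<alpha> (E a p) * coframe M E a p v)"
  proof (cases "v \<in> TT p")
    case True
    have "\<alpha> v = \<alpha> (\<lambda>f. \<Sum>a\<in>UNIV. coframe M E a p v * E a p f)"
      using coframe_expand[OF E True] by (rule arg_cong)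
    also have "\<dots> = (\<Sum>a\<in>UNIV. coframe M E a p v * \<alpha> (E a p))"
      by (rule CT_sum[OF \<alpha>]) (rule frame_near_TT[OF E])
    finally show ?thesis by (simp add: mult.commute)
  next
    case False
    then show ?thesis using CT_outside[OF \<alpha>] by (simp add: coframe_def)
  qed
qed

lemma CT_eqI:
  assumes E: "frame_near p E" and "\<alpha> \<in> CT p" "\<beta> \<in> CT p" "\<And>a. \<alpha> (E a p) = \<beta> (E a p)"
  shows "\<alpha> = \<beta>"
  by (subst CT_expand[OF E assms(2)], subst CT_expand[OF E assms(3)]) (simp add: assms(4))

lemma TT_eqI:
  assumes E: "frame_near p E" and "v \<in> TT p" "w \<in> TT p" "\<And>a. coframe M E a p v = coframe M E a p w"
  shows "v = w"
  by (subst coframe_expand[OF E assms(2)], subst coframe_expand[OF E assms(3)]) (simp add: assms(4))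

text \<open>Existence of the coefficients is the coordinate expansion; applying a combination to the
  coordinate functions reads off its coefficients and makes them unique.\<close>

lemma frame_chart:
  assumes Vx: "(V, x) \<in> M"
  shows "frame M V (coord_vec V x)"
  unfolding frame_def
proof safe
  show "vector_field M V (coord_vec V x a)" for a
    by (rule vector_fieldI[OF chart_open[OF Vx] coord_vec_TT[OF Vx] coord_vec_smooth[OF Vx]])
next
  fix p v assume p: "p \<in> V" and v: "v \<in> TT p"
  show "\<exists>\<xi>::real^'n. v = (\<lambda>f. \<Sum>a\<in>UNIV. \<xi> $ a * coord_vec V x a p f)"
    using tangent_expand_coords[OF Vx p v] by (intro exI[of _ "\<chi> i. v (\<lambda>q. x q $ i)"]) simp
next
  fix p v and \<xi> \<eta> :: "real^'n"
  assume p: "p \<in> V" and v: "(\<lambda>f. \<Sum>a\<in>UNIV. \<xi> $ a * coord_vec V x a p f) \<in> TT p"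
    and eq: "(\<lambda>f. \<Sum>a\<in>UNIV. \<xi> $ a * coord_vec V x a p f) = (\<lambda>f. \<Sum>a\<in>UNIV. \<eta> $ a * coord_vec V x a p f)"
  have "\<xi> $ j = \<eta> $ j" for j
  proof -
    have "(\<Sum>a\<in>UNIV. \<zeta> $ a * coord_vec V x a p (\<lambda>q. x q $ j)) = \<zeta> $ j" for \<zeta> :: "real^'n"
    proof -
      have "(\<Sum>a\<in>UNIV. \<zeta> $ a * coord_vec V x a p (\<lambda>q. x q $ j)) = (\<Sum>a\<in>UNIV. if a = j then \<zeta> $ a else 0)"
        by (intro sum.cong) (auto simp: coord_vec_coordinate[OF Vx p])
      then show ?thesis by simp
    qed
    with fun_cong[OF eq, of "\<lambda>q. x q $ j"] show ?thesis by simp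
  qed
  then show "\<xi> = \<eta>" by (simp add: vec_eq_iff)
qed

lemma frame_near_chart: "(V, x) \<in> M \<Longrightarrow> p \<in> V \<Longrightarrow> frame_near p (coord_vec V x)"
  using frame_nearI[OF frame_chart] chart_open by blast

lemma ex_frame: obtains E where "frame_near p E"
  using ex_chart[of p] frame_near_chart by blast

text \<open>The components with respect to a frame solve a linear system with smooth coefficients;
  Cramer's rule makes them smooth.\<close>

lemma linear_system_sm:
  fixes N :: "'m \<Rightarrow> 'k::finite \<Rightarrow> 'k \<Rightarrow> real"
  assumes N: "\<And>i j. sm p (\<lambda>q. N q i j)" and b: "\<And>i. sm p (\<lambda>q. b q i)"
    and det: "\<And>q. det (\<chi> i j. N q i j) = 0 \<Longrightarrow> \<not> P q" and P: "\<forall>\<^sub>F q in nhds p. P q"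
    and eq: "\<And>q i. P q \<Longrightarrow> (\<Sum>j\<in>UNIV. N q i j * u q j) = b q i"
  shows "sm p (\<lambda>q. u q k)"
proof -
  define D where "D q = det (\<chi> i j. if j = k then b q i else N q i j)" for q
  have D: "sm p D" unfolding D_def
  proof (rule sm_det)
    fix i j show "sm p (\<lambda>q. if j = k then b q i else N q i j)"
      by (cases "j = k") (simp_all add: N b)
  qed
  have "P p" by (rule eventually_nhds_x_imp_x[OF P])
  then have "det (\<chi> i j. N p i j) \<noteq> 0" using det[of p] by argo
  then have "sm p (\<lambda>q. D q / det (\<chi> i j. N q i j))"
    by (rule sm_divide[OF D sm_det[OF N]])
  then show ?thesis
  proof (rule sm_cong[rotated], intro eventually_mono[OF P])
    fix q assume q: "P q"
    then have d: "det (\<chi> i j. N q i j) \<noteq> 0" using det[of q] by argo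
    have "(\<chi> i j. N q i j) *v (\<chi> j. u q j) = (\<chi> i. b q i)"
      using eq[OF q] by (simp add: matrix_vector_mult_def)
    from iffD1[OF cramer[OF d] this]
    have "(\<chi> j. u q j) = (\<chi> k. det (\<chi> i j. if j = k then (\<chi> i. b q i) $ i else (\<chi> i j. N q i j) $ i $ j) / det (\<chi> i j. N q i j))" .
    from arg_cong[OF this, of "\<lambda>w. w $ k"]
    have "u q k = det (\<chi> i j. if j = k then b q i else N q i j) / det (\<chi> i j. N q i j)"
      by (simp only: vec_lambda_beta)
    then show "D q / det (\<chi> i j. N q i j) = u q k" by (simp only: D_def)
  qed
qed

lemma det_nonzeroI:
  fixes N :: "'k::finite \<Rightarrow> 'k \<Rightarrow> real"
  assumes "\<And>c. (\<And>i. (\<Sum>j\<in>UNIV. N i j * c j) = 0) \<Longrightarrow> (\<And>j. c j = 0)"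
  shows "det (\<chi> i j. N i j) \<noteq> 0"
proof -
  have "\<forall>c. (\<chi> i j. N i j) *v c = 0 \<longrightarrow> c = 0"
  proof (intro allI impI)
    fix c :: "real^'k" assume "(\<chi> i j. N i j) *v c = 0"
    then have "(\<Sum>j\<in>UNIV. N i j * c $ j) = 0" for i
      by (simp add: matrix_vector_mult_def vec_eq_iff)
    then show "c = 0" using assms[of "\<lambda>j. c $ j"] by (simp add: vec_eq_iff)
  qed
  then have "invertible (\<chi> i j. N i j)"
    by (simp add: invertible_left_inverse matrix_left_invertible_ker)
  then show ?thesis by (simp add: invertible_det_nz)
qed

text \<open>Applying the expansion of \<open>X\<close> in the frame to the coordinate functions
  gives a linear system for the components, with the smooth matrix
  \<open>E j q (\<lambda>r. x r $ i)\<close>. A vector in its kernel is a combination of frame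
  vectors that annihilates all coordinates, hence the zero tangent vector, and its coefficients
  vanish.\<close>

lemma coframe_sm:
  assumes E: "frame_near p E" and X: "vf_near p X"
  shows "sm p (\<lambda>q. coframe M E a q (X q))"
proof -
  obtain V x where Vx: "(V, x) \<in> M" and p: "p \<in> V" by (rule ex_chart)
  define P where "P q \<longleftrightarrow> q \<in> V \<and> frame_near q E \<and> vf_near q X" for q
  have "\<forall>\<^sub>F q in nhds p. q \<in> V"
    by (rule eventually_nhds_open[OF chart_open[OF Vx] p])
  then have P: "\<forall>\<^sub>F q in nhds p. P q"
    unfolding P_def by (intro eventually_conj frame_near_eventually[OF E] vf_near_eventually[OF X])
  show ?thesis
  proof (rule linear_system_sm[of p "\<lambda>q i j. E j q (\<lambda>r. x r $ i)" "\<lambda>q i. X q (\<lambda>r. x r $ i)" P, OF _ _ _ P])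
    show "sm p (\<lambda>q. E j q (\<lambda>r. x r $ i))" for i j
      by (rule vf_near_sm[OF frame_near_vf[OF E] sm_coordinate[OF Vx p]])
    show "sm p (\<lambda>q. X q (\<lambda>r. x r $ i))" for i
      by (rule vf_near_sm[OF X sm_coordinate[OF Vx p]])
  next
    fix q assume d: "det (\<chi> i j. E j q (\<lambda>r. x r $ i)) = 0"
    show "\<not> P q"
    proof
      assume "P q"
      then have q: "q \<in> V" and Eq: "frame_near q E" by (auto simp: P_def)
      have "det (\<chi> i j. E j q (\<lambda>r. x r $ i)) \<noteq> 0"
      proof (rule det_nonzeroI[of "\<lambda>i j. E j q (\<lambda>r. x r $ i)"])
        fix c j assume c: "\<And>i. (\<Sum>j\<in>UNIV. E j q (\<lambda>r. x r $ i) * c j) = 0"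
        have "(\<lambda>f. \<Sum>j\<in>UNIV. c j * E j q f) = (\<lambda>f. 0)"
        proof (rule tangent_eqI_coords[OF Vx q _ TT_zero])
          show "(\<lambda>f. \<Sum>j\<in>UNIV. c j * E j q f) \<in> TT q" by (rule TT_sum) (rule frame_near_TT[OF Eq])
          show "(\<Sum>j\<in>UNIV. c j * E j q (\<lambda>r. x r $ i)) = 0" for i using c[of i] by (simp add: mult.commute)
        qed
        from coframe_eqI[OF Eq this[symmetric], of j] show "c j = 0"
          using CT_zero_vec[OF coframe_CT[OF Eq]] by simp
      qed
      with d show False by simp
    qed
  next
    fix q i assume "P q"
    then have "frame_near q E" "X q \<in> TT q" by (auto simp: P_def vf_near_TT)
    from fun_cong[OF coframe_expand[OF this], of "\<lambda>r. x r $ i"]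
    show "(\<Sum>j\<in>UNIV. E j q (\<lambda>r. x r $ i) * coframe M E j q (X q)) = X q (\<lambda>r. x r $ i)"
      by (simp add: mult.commute)
  qed
qed

section \<open>Fields and forms recognised by their components\<close>

lemma form_near_CT: "form_near p A \<Longrightarrow> A p \<in> CT p"
  unfolding form_near_def one_form_def by (elim exE conjE) (erule (1) bspec)

lemma form_near_sm: "form_near p A \<Longrightarrow> vf_near p X \<Longrightarrow> sm p (\<lambda>q. A q (X q))"
proof -
  assume "form_near p A" "vf_near p X"
  then obtain U N where U: "open U" "p \<in> U" "one_form M U A" and N: "open N" "p \<in> N" "vector_field M N X"
    unfolding vf_near_def form_near_def by blast
  have "smooth_fun M (U \<inter> N) (\<lambda>q. A q (X q))"
    using U N vector_field_subset[OF N(3), of "U \<inter> N"] unfolding one_form_def by (simp add: open_Int)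
  then show ?thesis using U N unfolding smooth_near_def by blast
qed

lemma one_formI:
  assumes "open U" "\<And>p. p \<in> U \<Longrightarrow> A p \<in> CT p"
    "\<And>p X. p \<in> U \<Longrightarrow> vf_near p X \<Longrightarrow> sm p (\<lambda>q. A q (X q))"
  shows "one_form M U A"
  unfolding one_form_def using assms by (auto simp: smooth_fun_iff vector_field_iff)

lemma one_form_iff:
  assumes "open U"
  shows "one_form M U A \<longleftrightarrow> (\<forall>p\<in>U. form_near p A)"
proof
  assume "one_form M U A" then show "\<forall>p\<in>U. form_near p A" using assms form_nearI by blast
next
  assume *: "\<forall>p\<in>U. form_near p A"
  show "one_form M U A"
  proof (rule one_formI[OF assms])
    fix p assume "p \<in> U"
    with * have A: "form_near p A" by blast
    then show "A p \<in> CT p" by (rule form_near_CT)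
    show "sm p (\<lambda>q. A q (X q))" if "vf_near p X" for X using A that by (rule form_near_sm)
  qed
qed

lemma form_sm_components:
  assumes E: "frame_near p E" and A: "\<forall>\<^sub>F q in nhds p. A q \<in> CT q" and AE: "\<And>a. sm p (\<lambda>q. A q (E a q))"
    and X: "vf_near p X"
  shows "sm p (\<lambda>q. A q (X q))"
proof -
  have "sm p (\<lambda>q. \<Sum>a\<in>UNIV. A q (E a q) * coframe M E a q (X q))"
    by (intro sm_sum sm_mult AE coframe_sm[OF E X])
  moreover have "\<forall>\<^sub>F q in nhds p. (\<Sum>a\<in>UNIV. A q (E a q) * coframe M E a q (X q)) = A q (X q)"
    using eventually_conj[OF A frame_near_eventually[OF E]]
  proof eventually_elim
    case (elim q)
    then have "frame_near q E" "A q \<in> CT q" by blast+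
    from fun_cong[OF CT_expand[OF this], of "X q"] show ?case by (rule sym)
  qed
  ultimately show ?thesis by (rule sm_cong[rotated])
qed

lemma form_nearI_components:
  assumes E: "frame_near p E" and A: "\<forall>\<^sub>F q in nhds p. A q \<in> CT q" and AE: "\<And>a. sm p (\<lambda>q. A q (E a q))"
  shows "form_near p A"
proof -
  have "\<forall>\<^sub>F q in nhds p. A q \<in> CT q \<and> frame_near q E \<and> (\<forall>a. sm q (\<lambda>q. A q (E a q)))"
    by (intro eventually_conj A frame_near_eventually[OF E] eventually_all_finite sm_eventually AE)
  then obtain U where U: "open U" "p \<in> U"
    "\<And>q. q \<in> U \<Longrightarrow> A q \<in> CT q \<and> frame_near q E \<and> (\<forall>a. sm q (\<lambda>q. A q (E a q)))"
    unfolding eventually_nhds by blast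
  have "one_form M U A"
  proof (rule one_formI[OF U(1)])
    show "A q \<in> CT q" if "q \<in> U" for q using U(3)[OF that] by blast
    fix q X assume q: "q \<in> U" and X: "vf_near q X"
    show "sm q (\<lambda>q. A q (X q))"
      by (rule form_sm_components[OF _ eventually_nhds_open[OF U(1) q] _ X]) (use U(3) q in blast)+
  qed
  then show ?thesis using U by (intro form_nearI)
qed

lemma form_near_coframe: "frame_near p E \<Longrightarrow> form_near p (coframe M E a)"
proof -
  assume E: "frame_near p E"
  show ?thesis
  proof (rule form_nearI_components[OF E])
    show "\<forall>\<^sub>F q in nhds p. coframe M E a q \<in> CT q"
      using frame_near_eventually[OF E] by eventually_elim (rule coframe_CT)
    show "sm p (\<lambda>q. coframe M E a q (E b q))" for b
      by (rule coframe_sm[OF E frame_near_vf[OF E]])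
  qed
qed

lemma vf_nearI_components:
  assumes E: "frame_near p E" and X: "\<forall>\<^sub>F q in nhds p. X q \<in> TT q"
    and XE: "\<And>a. sm p (\<lambda>q. coframe M E a q (X q))"
  shows "vf_near p X"
proof (rule vf_near_cong[rotated])
  show "vf_near p (\<lambda>q f. \<Sum>a\<in>UNIV. coframe M E a q (X q) * E a q f)"
    by (rule vf_near_sum) (rule XE, rule frame_near_vf[OF E])
  show "\<forall>\<^sub>F q in nhds p. (\<lambda>f. \<Sum>a\<in>UNIV. coframe M E a q (X q) * E a q f) = X q"
    using eventually_conj[OF X frame_near_eventually[OF E]]
  proof eventually_elim
    case (elim q)
    then have "frame_near q E" "X q \<in> TT q" by blast+
    from coframe_expand[OF this] show ?case by (rule sym)
  qed
qed

end


section \<open>Connections in a frame\<close>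

locale affine_connection = manifold M
  for M :: "('m::{t2_space, second_countable_topology}, 'n::finite) atlas" +
  fixes U :: "'m set" and D :: "'m conn"
  assumes open_U: "open U" and torsionless: "torsionless_connection M U D"
begin

lemma eventually_U: "p \<in> U \<Longrightarrow> \<forall>\<^sub>F q in nhds p. q \<in> U"
  by (rule eventually_nhds_open[OF open_U])

lemma ex_nbhd:
  assumes "p \<in> U" "\<forall>\<^sub>F q in nhds p. P q"
  obtains W where "open W" "p \<in> W" "W \<subseteq> U" "\<forall>q\<in>W. P q"
proof -
  obtain S where S: "open S" "p \<in> S" "\<forall>q\<in>S. P q" using assms(2) unfolding eventually_nhds by auto
  show ?thesis
    by (rule that[of "S \<inter> U"]) (use S assms(1) open_U in auto)
qed

lemma ex_nbhd_fields:
  assumes "p \<in> U" "vf_near p X" "vf_near p Y"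
  obtains W where "open W" "p \<in> W" "W \<subseteq> U" "vector_field M W X" "vector_field M W Y"
proof (rule ex_nbhd[OF assms(1) eventually_conj[OF vf_near_eventually[OF assms(2)] vf_near_eventually[OF assms(3)]]])
  fix W assume W: "open W" "p \<in> W" "W \<subseteq> U" "\<forall>q\<in>W. vf_near q X \<and> vf_near q Y"
  show ?thesis
    by (rule that[OF W(1-3)]) (simp_all add: vector_field_iff[OF W(1)] bspec[OF W(4)])
qed

lemma ex_nbhd_fields3:
  assumes "p \<in> U" "vf_near p X" "vf_near p Y" "vf_near p Z"
  obtains W where "open W" "p \<in> W" "W \<subseteq> U" "vector_field M W X" "vector_field M W Y" "vector_field M W Z"
proof (rule ex_nbhd[OF assms(1) eventually_conj[OF vf_near_eventually[OF assms(2)]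
      eventually_conj[OF vf_near_eventually[OF assms(3)] vf_near_eventually[OF assms(4)]]]])
  fix W assume W: "open W" "p \<in> W" "W \<subseteq> U" "\<forall>q\<in>W. vf_near q X \<and> vf_near q Y \<and> vf_near q Z"
  show ?thesis
    by (rule that[OF W(1-3)]) (simp_all add: vector_field_iff[OF W(1)] bspec[OF W(4)])
qed

section \<open>The connection axioms at a single point\<close>

lemmas connection = conjunct1[OF torsionless[unfolded torsionless_connection_def],
    unfolded connection_def, rule_format]
lemmas torsion = conjunct2[OF torsionless[unfolded torsionless_connection_def], rule_format]

lemma conn_vf:
  assumes "p \<in> U" "vf_near p X" "vf_near p Y"
  shows "vf_near p (D X Y)"
proof -
  obtain W where W: "open W" "p \<in> W" "W \<subseteq> U" "vector_field M W X" "vector_field M W Y"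
    by (rule ex_nbhd_fields[OF assms])
  from conjunct1[OF connection[OF W(1,3,4,5)]] show ?thesis by (rule vf_nearI[OF _ W(1,2)])
qed

lemma conn_add_left:
  assumes "p \<in> U" "vf_near p X" "vf_near p X'" "vf_near p Y"
  shows "D (\<lambda>q f. X q f + X' q f) Y p = (\<lambda>f. D X Y p f + D X' Y p f)"
proof -
  obtain W where W: "open W" "p \<in> W" "W \<subseteq> U" "vector_field M W X" "vector_field M W X'" "vector_field M W Y"
    by (rule ex_nbhd_fields3[OF assms])
  from conjunct1[OF conjunct2[OF connection[OF W(1,3,4,6)]], rule_format, OF W(5,2)]
  show ?thesis .
qed

lemma conn_add_right:
  assumes "p \<in> U" "vf_near p X" "vf_near p Y" "vf_near p Y'"
  shows "D X (\<lambda>q f. Y q f + Y' q f) p = (\<lambda>f. D X Y p f + D X Y' p f)"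
proof -
  obtain W where W: "open W" "p \<in> W" "W \<subseteq> U" "vector_field M W X" "vector_field M W Y" "vector_field M W Y'"
    by (rule ex_nbhd_fields3[OF assms])
  from conjunct1[OF conjunct2[OF conjunct2[OF connection[OF W(1,3,4,5)]]], rule_format, OF W(6,2)]
  show ?thesis .
qed

lemma conn_scale:
  assumes "p \<in> U" "vf_near p X" "vf_near p Y" "sm p h"
  shows "D (\<lambda>q f. h q * X q f) Y p = (\<lambda>f. h p * D X Y p f)"
    and "D X (\<lambda>q f. h q * Y q f) p = (\<lambda>f. h p * D X Y p f + X p h * Y p f)"
proof -
  obtain W where W: "open W" "p \<in> W" "W \<subseteq> U" "\<forall>q\<in>W. vf_near q X \<and> vf_near q Y \<and> sm q h"
    by (rule ex_nbhd[OF assms(1) eventually_conj[OF vf_near_eventually[OF assms(2)]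
      eventually_conj[OF vf_near_eventually[OF assms(3)] sm_eventually[OF assms(4)]]]])
  have XY: "vector_field M W X" "vector_field M W Y" and h: "smooth_fun M W h"
    by (simp_all add: vector_field_iff[OF W(1)] smooth_fun_iff[OF W(1)] bspec[OF W(4)])
  note * = conjunct1[OF conjunct2[OF conjunct2[OF conjunct2[OF connection[OF W(1,3) XY]]]], rule_format, OF h W(2)]
  from conjunct1[OF *] show "D (\<lambda>q f. h q * X q f) Y p = (\<lambda>f. h p * D X Y p f)" .
  from conjunct2[OF *] show "D X (\<lambda>q f. h q * Y q f) p = (\<lambda>f. h p * D X Y p f + X p h * Y p f)" .
qed

text \<open>The compatibility with restriction in \<open>connection\<close> compares on an open set
  for arbitrary \<open>X'\<close> and \<open>Y'\<close>. Shrinking that set to a neighbourhood of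
  agreement turns it into locality, which permits replacing fields by their frame
  expansions.\<close>

lemma conn_cong:
  assumes "p \<in> U" "vf_near p X" "vf_near p Y"
    "\<forall>\<^sub>F q in nhds p. X' q = X q" "\<forall>\<^sub>F q in nhds p. Y' q = Y q"
  shows "D X' Y' p = D X Y p"
proof -
  obtain W where W: "open W" "p \<in> W" "W \<subseteq> U"
    "\<forall>q\<in>W. (vf_near q X \<and> vf_near q Y) \<and> X' q = X q \<and> Y' q = Y q"
    by (rule ex_nbhd[OF assms(1) eventually_conj[OF eventually_conj[OF vf_near_eventually[OF assms(2)]
      vf_near_eventually[OF assms(3)]] eventually_conj[OF assms(4,5)]]])
  have XY: "vector_field M W X" "vector_field M W Y"
    by (simp_all add: vector_field_iff[OF W(1)] bspec[OF W(4)])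
  have eq: "\<forall>p\<in>W. X' p = X p \<and> Y' p = Y p" using W(4) by blast
  from conjunct2[OF conjunct2[OF conjunct2[OF conjunct2[OF connection[OF W(1,3) XY]]]]]
  have "\<forall>X' Y'. (\<forall>p\<in>W. X' p = X p \<and> Y' p = Y p) \<longrightarrow> (\<forall>p\<in>W. D X' Y' p = D X Y p)" .
  from bspec[OF mp[OF spec[OF spec[OF this, of X'], of Y'] eq] W(2)] show ?thesis .
qed

lemma conn_torsion:
  assumes "p \<in> U" "vf_near p X" "vf_near p Y"
  shows "D X Y p = (\<lambda>f. D Y X p f + lie_bracket M X Y p f)"
proof
  fix f
  obtain W where W: "open W" "p \<in> W" "W \<subseteq> U" "vector_field M W X" "vector_field M W Y"
    by (rule ex_nbhd_fields[OF assms])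
  from fun_cong[OF torsion[OF W(1,3,4,5,2)], of f]
  show "D X Y p f = D Y X p f + lie_bracket M X Y p f" by simp
qed

lemma conn_zero_left: "p \<in> U \<Longrightarrow> vf_near p Y \<Longrightarrow> D (\<lambda>q f. 0) Y p = (\<lambda>f. 0)"
  using conn_scale(1)[OF _ vf_near_zero _ sm_const, of p Y 0] by simp

lemma conn_zero_right: "p \<in> U \<Longrightarrow> vf_near p X \<Longrightarrow> D X (\<lambda>q f. 0) p = (\<lambda>f. 0)"
  using conn_scale(2)[OF _ _ vf_near_zero sm_const, of p X 0] by simp

lemma conn_sum_left:
  assumes p: "p \<in> U" and Y: "vf_near p Y"
  shows "(\<And>i. i \<in> I \<Longrightarrow> sm p (h i)) \<Longrightarrow> (\<And>i. i \<in> I \<Longrightarrow> vf_near p (X i)) \<Longrightarrow>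
    D (\<lambda>q f. \<Sum>i\<in>I. h i q * X i q f) Y p = (\<lambda>f. \<Sum>i\<in>I. h i p * D (X i) Y p f)"
proof (induction I rule: infinite_finite_induct)
  case (insert i I)
  have hi: "sm p (h i)" and Xi: "vf_near p (X i)" using insert.prems by simp_all
  have v: "vf_near p (\<lambda>q f. \<Sum>i\<in>I. h i q * X i q f)"
    by (rule vf_near_sum) (use insert.prems in simp_all)
  have "D (\<lambda>q f. h i q * X i q f + (\<Sum>i\<in>I. h i q * X i q f)) Y p
    = (\<lambda>f. h i p * D (X i) Y p f + (\<Sum>i\<in>I. h i p * D (X i) Y p f))"
    using conn_add_left[OF p vf_near_scale[OF hi Xi] v Y] conn_scale(1)[OF p Xi Y hi] insert by simp
  with insert.hyps show ?case by simp
qed (simp_all add: conn_zero_left[OF p Y])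

lemma conn_sum_right:
  assumes p: "p \<in> U" and X: "vf_near p X"
  shows "(\<And>i. i \<in> I \<Longrightarrow> sm p (h i)) \<Longrightarrow> (\<And>i. i \<in> I \<Longrightarrow> vf_near p (Y i)) \<Longrightarrow>
    D X (\<lambda>q f. \<Sum>i\<in>I. h i q * Y i q f) p = (\<lambda>f. \<Sum>i\<in>I. h i p * D X (Y i) p f + X p (h i) * Y i p f)"
proof (induction I rule: infinite_finite_induct)
  case (insert i I)
  have hi: "sm p (h i)" and Yi: "vf_near p (Y i)" using insert.prems by simp_all
  have v: "vf_near p (\<lambda>q f. \<Sum>i\<in>I. h i q * Y i q f)"
    by (rule vf_near_sum) (use insert.prems in simp_all)
  have "D X (\<lambda>q f. h i q * Y i q f + (\<Sum>i\<in>I. h i q * Y i q f)) p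
    = (\<lambda>f. h i p * D X (Y i) p f + X p (h i) * Y i p f + (\<Sum>i\<in>I. h i p * D X (Y i) p f + X p (h i) * Y i p f))"
    using conn_add_right[OF p X vf_near_scale[OF hi Yi] v] conn_scale(2)[OF p X Yi hi] insert by simp
  with insert.hyps show ?case by simp
qed (simp_all add: conn_zero_right[OF p X])

lemma eventually_expand:
  assumes E: "frame_near p E" and X: "vf_near p X"
  shows "\<forall>\<^sub>F q in nhds p. X q = (\<lambda>f. \<Sum>a\<in>UNIV. coframe M E a q (X q) * E a q f)"
  using eventually_conj[OF frame_near_eventually[OF E] vf_near_eventually[OF X]]
proof eventually_elim
  case (elim q)
  show ?case by (rule coframe_expand[OF conjunct1[OF elim] vf_near_TT[OF conjunct2[OF elim]]])
qed

lemma conn_expand_left: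
  assumes p: "p \<in> U" and E: "frame_near p E" and X: "vf_near p X" and Y: "vf_near p Y"
  shows "D X Y p = (\<lambda>f. \<Sum>a\<in>UNIV. coframe M E a p (X p) * D (E a) Y p f)"
proof -
  note h = coframe_sm[OF E X] and v = frame_near_vf[OF E]
  have "D X Y p = D (\<lambda>q f. \<Sum>a\<in>UNIV. coframe M E a q (X q) * E a q f) Y p"
    by (rule conn_cong[OF p _ Y eventually_expand[OF E X]]) (rule vf_near_sum[OF h v], simp)
  also have "\<dots> = (\<lambda>f. \<Sum>a\<in>UNIV. coframe M E a p (X p) * D (E a) Y p f)"
    by (rule conn_sum_left[OF p Y h v])
  finally show ?thesis .
qed

lemma conn_expand_right:
  assumes p: "p \<in> U" and E: "frame_near p E" and X: "vf_near p X" and Y: "vf_near p Y"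
  shows "D X Y p = (\<lambda>f. \<Sum>a\<in>UNIV. coframe M E a p (Y p) * D X (E a) p f
           + X p (\<lambda>q. coframe M E a q (Y q)) * E a p f)"
proof -
  note h = coframe_sm[OF E Y] and v = frame_near_vf[OF E]
  have "D X Y p = D X (\<lambda>q f. \<Sum>a\<in>UNIV. coframe M E a q (Y q) * E a q f) p"
    by (rule conn_cong[OF p X _ _ eventually_expand[OF E Y]]) (rule vf_near_sum[OF h v], simp)
  also have "\<dots> = (\<lambda>f. \<Sum>a\<in>UNIV. coframe M E a p (Y p) * D X (E a) p f
           + X p (\<lambda>q. coframe M E a q (Y q)) * E a p f)"
    by (rule conn_sum_right[OF p X h v])
  finally show ?thesis .
qed

lemma CT_conn:
  assumes p: "p \<in> U" and E: "frame_near p E" and X: "vf_near p X" and Y: "vf_near p Y" and \<alpha>: "\<alpha> \<in> CT p"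
  shows "\<alpha> (D X Y p) = (\<Sum>b\<in>UNIV. coframe M E b p (Y p) * \<alpha> (D X (E b) p))
     + (\<Sum>b\<in>UNIV. X p (\<lambda>q. coframe M E b q (Y q)) * \<alpha> (E b p))"
proof -
  have T: "D X (E b) p \<in> TT p" for b
    by (rule vf_near_TT[OF conn_vf[OF p X frame_near_vf[OF E]]])
  have "\<alpha> (D X Y p) = \<alpha> (\<lambda>f. (\<Sum>b\<in>UNIV. coframe M E b p (Y p) * D X (E b) p f)
      + (\<Sum>b\<in>UNIV. X p (\<lambda>q. coframe M E b q (Y q)) * E b p f))"
    unfolding conn_expand_right[OF p E X Y] sum.distrib ..
  also have "\<dots> = \<alpha> (\<lambda>f. \<Sum>b\<in>UNIV. coframe M E b p (Y p) * D X (E b) p f)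
      + \<alpha> (\<lambda>f. \<Sum>b\<in>UNIV. X p (\<lambda>q. coframe M E b q (Y q)) * E b p f)"
    by (rule CT_add[OF \<alpha> TT_sum TT_sum]) (rule T, rule frame_near_TT[OF E])
  also have "\<alpha> (\<lambda>f. \<Sum>b\<in>UNIV. coframe M E b p (Y p) * D X (E b) p f) = (\<Sum>b\<in>UNIV. coframe M E b p (Y p) * \<alpha> (D X (E b) p))"
    by (rule CT_sum[OF \<alpha>]) (rule T)
  also have "\<alpha> (\<lambda>f. \<Sum>b\<in>UNIV. X p (\<lambda>q. coframe M E b q (Y q)) * E b p f) = (\<Sum>b\<in>UNIV. X p (\<lambda>q. coframe M E b q (Y q)) * \<alpha> (E b p))"
    by (rule CT_sum[OF \<alpha>]) (rule frame_near_TT[OF E])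
  finally show ?thesis .
qed

lemma coframe_conn:
  assumes p: "p \<in> U" and E: "frame_near p E" and X: "vf_near p X" and Y: "vf_near p Y"
  shows "coframe M E a p (D X Y p) = X p (\<lambda>q. coframe M E a q (Y q))
    + (\<Sum>b\<in>UNIV. coframe M E b p (Y p) * coframe M E a p (D X (E b) p))"
  using CT_conn[OF assms coframe_CT[OF E, of a]] by (simp add: coframe_frame[OF E])

text \<open>A connection is linear over functions in the direction of differentiation. The form
  assembled from the coefficients \<open>conn_coeff\<close> therefore computes the derivative along
  any field, not just along frame fields.\<close>

lemma conn_form_eq:
  assumes p: "p \<in> U" and E: "frame_near p E" and X: "vf_near p X"
  shows "conn_form M D E a b p (X p) = coframe M E a p (D X (E b) p)"
proof -
  have T: "D (E c) (E b) p \<in> TT p" for c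
    by (rule vf_near_TT[OF conn_vf[OF p frame_near_vf[OF E] frame_near_vf[OF E]]])
  show ?thesis
    unfolding conn_form_def conn_coeff_def conn_expand_left[OF p E X frame_near_vf[OF E]]
    by (subst CT_sum[OF coframe_CT[OF E] T]) (simp add: mult.commute)
qed

lemma conn_form_CT: "frame_near p E \<Longrightarrow> conn_form M D E a b p \<in> CT p"
  unfolding conn_form_def by (rule CT_sum_mem) (rule coframe_CT)

lemma form_near_conn_form:
  assumes p: "p \<in> U" and E: "frame_near p E"
  shows "form_near p (conn_form M D E a b)"
proof (rule form_nearI_components[OF E])
  show "\<forall>\<^sub>F q in nhds p. conn_form M D E a b q \<in> CT q"
    using frame_near_eventually[OF E] by eventually_elim (rule conn_form_CT)
  fix c
  have "\<forall>\<^sub>F q in nhds p. coframe M E a q (D (E c) (E b) q) = conn_form M D E a b q (E c q)"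
    using eventually_conj[OF frame_near_eventually[OF E] eventually_U[OF p]]
  proof eventually_elim
    case (elim q)
    then show ?case using conn_form_eq[of q E "E c" a b] frame_near_vf[of q E c] by simp
  qed
  then show "sm p (\<lambda>q. conn_form M D E a b q (E c q))"
    by (rule sm_cong) (rule coframe_sm[OF E conn_vf[OF p frame_near_vf[OF E] frame_near_vf[OF E]]])
qed

text \<open>The derivatives of the components of \<open>Y\<close> occur in both terms and cancel, so
  only the value \<open>Y p\<close> matters. This makes the choice of extension in
  \<open>cov_deriv_form\<close> harmless and serves again below to show that exterior derivatives
  can be tested on a frame.\<close>

lemma nabla_form_tensorial:
  assumes p: "p \<in> U" and E: "frame_near p E" and Z: "vf_near p Z" and Y: "vf_near p Y" and \<alpha>: "form_near p \<alpha>"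
  shows "Z p (\<lambda>q. \<alpha> q (Y q)) - \<alpha> p (D Z Y p)
    = (\<Sum>b\<in>UNIV. coframe M E b p (Y p) * (Z p (\<lambda>q. \<alpha> q (E b q)) - \<alpha> p (D Z (E b) p)))"
proof -
  note Zp = vf_near_TT[OF Z] and \<theta> = coframe_sm[OF E Y] and \<alpha>E = form_near_sm[OF \<alpha> frame_near_vf[OF E]]
  have "Z p (\<lambda>q. \<alpha> q (Y q)) = Z p (\<lambda>q. \<Sum>b\<in>UNIV. \<alpha> q (E b q) * coframe M E b q (Y q))"
  proof (rule tv_cong[OF Zp])
    show "\<forall>\<^sub>F q in nhds p. \<alpha> q (Y q) = (\<Sum>b\<in>UNIV. \<alpha> q (E b q) * coframe M E b q (Y q))"
      using eventually_conj[OF frame_near_eventually[OF E] form_near_eventually[OF \<alpha>]]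
    proof eventually_elim
      case (elim q)
      show ?case by (rule fun_cong[OF CT_expand[OF conjunct1[OF elim] form_near_CT[OF conjunct2[OF elim]]]])
    qed
  qed
  also have "\<dots> = (\<Sum>b\<in>UNIV. Z p (\<lambda>q. \<alpha> q (E b q) * coframe M E b q (Y q)))"
    by (rule tv_sum[OF Zp]) (rule sm_mult[OF \<alpha>E \<theta>])
  also have "\<dots> = (\<Sum>b\<in>UNIV. \<alpha> p (E b p) * Z p (\<lambda>q. coframe M E b q (Y q)) + coframe M E b p (Y p) * Z p (\<lambda>q. \<alpha> q (E b q)))"
    by (intro sum.cong refl tv_mult[OF Zp \<alpha>E \<theta>])
  finally show ?thesis
    unfolding CT_conn[OF p E Z Y form_near_CT[OF \<alpha>]]
    by (simp add: sum.distrib sum_subtractf right_diff_distrib mult.commute)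
qed

lemma cov_deriv_form_eq:
  assumes p: "p \<in> U" and E: "frame_near p E" and Z: "vf_near p Z" and \<alpha>: "form_near p \<alpha>" and v: "v \<in> TT p"
  shows "cov_deriv_form M D Z \<alpha> p v
    = (\<Sum>b\<in>UNIV. coframe M E b p v * (Z p (\<lambda>q. \<alpha> q (E b q)) - \<alpha> p (D Z (E b) p)))"
proof -
  define P where "P Y \<longleftrightarrow> (\<exists>W. open W \<and> p \<in> W \<and> vector_field M W Y) \<and> Y p = v" for Y
  have P: "P Y \<longleftrightarrow> vf_near p Y \<and> Y p = v" for Y unfolding P_def vf_near_def ..
  \<comment> \<open>Witness for the choice in \<open>cov_deriv_form\<close>: the frame fields
    combined with the constant coefficients of \<open>v\<close>. The extension actually chosen may
    be another one, with the same result by tensoriality.\<close>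
  have "P (\<lambda>q f. \<Sum>b\<in>UNIV. coframe M E b p v * E b q f)"
    unfolding P
    by (intro conjI vf_near_sum sm_const frame_near_vf[OF E] coframe_expand[OF E v, symmetric])
  from someI[of P, OF this] have "P (SOME Y. P Y)" .
  then have Y: "vf_near p (SOME Y. P Y)" and Yp: "(SOME Y. P Y) p = v" unfolding P by simp_all
  have "cov_deriv_form M D Z \<alpha> p v = Z p (\<lambda>q. \<alpha> q ((SOME Y. P Y) q)) - \<alpha> p (D Z (SOME Y. P Y) p)"
    using v by (simp add: cov_deriv_form_def P_def Let_def)
  also have "\<dots> = (\<Sum>b\<in>UNIV. coframe M E b p v * (Z p (\<lambda>q. \<alpha> q (E b q)) - \<alpha> p (D Z (E b) p)))"
    using nabla_form_tensorial[OF p E Z Y \<alpha>] unfolding Yp .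
  finally show ?thesis .
qed

text \<open>The functions \<open>coframe M E a q (E b q)\<close> are constant near \<open>p\<close>,
  so their derivatives vanish and the connection coefficients remain, with the opposite
  sign.\<close>

lemma cov_deriv_coframe:
  assumes p: "p \<in> U" and E: "frame_near p E" and Z: "vf_near p Z"
  shows "cov_deriv_form M D Z (coframe M E a) p
    = (\<lambda>v. \<Sum>b\<in>UNIV. (- coframe M E a p (D Z (E b) p)) * coframe M E b p v)"
proof
  fix v
  show "cov_deriv_form M D Z (coframe M E a) p v
    = (\<Sum>b\<in>UNIV. (- coframe M E a p (D Z (E b) p)) * coframe M E b p v)"
  proof (cases "v \<in> TT p")
    case True
    have "Z p (\<lambda>q. coframe M E a q (E b q)) = 0" for b
    proof -
      have "Z p (\<lambda>q. coframe M E a q (E b q)) = Z p (\<lambda>q. of_bool (a = b))"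
      proof (rule tv_cong[OF vf_near_TT[OF Z]])
        show "\<forall>\<^sub>F q in nhds p. coframe M E a q (E b q) = of_bool (a = b)"
          using frame_near_eventually[OF E] by eventually_elim (rule coframe_frame)
      qed
      then show ?thesis using tv_const[OF vf_near_TT[OF Z]] by simp
    qed
    then show ?thesis
      using cov_deriv_form_eq[OF p E Z form_near_coframe[OF E] True, of a] by (simp add: mult.commute)
  next
    case False
    then show ?thesis by (simp add: cov_deriv_form_def coframe_def)
  qed
qed

end

section \<open>Symmetric tensors and their covariant derivatives\<close>

context manifold
begin

definition sym_bilinear_at :: "'m \<Rightarrow> ('m \<Rightarrow> 'm covec \<Rightarrow> 'm covec \<Rightarrow> real) \<Rightarrow> bool" where
  "sym_bilinear_at p g \<longleftrightarrow>
     (\<forall>\<alpha>\<in>CT p. \<forall>\<beta>\<in>CT p. g p \<alpha> \<beta> = g p \<beta> \<alpha>) \<and>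
     (\<forall>\<alpha>\<in>CT p. \<forall>\<beta>\<in>CT p. \<forall>\<gamma>\<in>CT p. \<forall>a b.
        g p (\<lambda>v. a * \<alpha> v + b * \<beta> v) \<gamma> = a * g p \<alpha> \<gamma> + b * g p \<beta> \<gamma>)"

lemma sym_tensor_at: "sym_tensor M U g \<Longrightarrow> p \<in> U \<Longrightarrow> sym_bilinear_at p g"
  unfolding sym_tensor_def sym_bilinear_at_def by (drule conjunct1) (erule (1) bspec)

context
  fixes p g assumes g: "sym_bilinear_at p g"
begin

lemma tensor_sym: "\<alpha> \<in> CT p \<Longrightarrow> \<beta> \<in> CT p \<Longrightarrow> g p \<alpha> \<beta> = g p \<beta> \<alpha>"
  using g by (simp add: sym_bilinear_at_def)

lemma tensor_linear: "\<alpha> \<in> CT p \<Longrightarrow> \<beta> \<in> CT p \<Longrightarrow> \<gamma> \<in> CT p \<Longrightarrow>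
    g p (\<lambda>v. a * \<alpha> v + b * \<beta> v) \<gamma> = a * g p \<alpha> \<gamma> + b * g p \<beta> \<gamma>"
  using g by (simp add: sym_bilinear_at_def)

lemma tensor_sum:
  assumes \<gamma>: "\<gamma> \<in> CT p"
  shows "(\<And>i. i \<in> I \<Longrightarrow> \<alpha> i \<in> CT p) \<Longrightarrow> g p (\<lambda>v. \<Sum>i\<in>I. c i * \<alpha> i v) \<gamma> = (\<Sum>i\<in>I. c i * g p (\<alpha> i) \<gamma>)"
proof (induction I rule: infinite_finite_induct)
  case (insert i I)
  have "g p (\<lambda>v. c i * \<alpha> i v + 1 * (\<Sum>i\<in>I. c i * \<alpha> i v)) \<gamma>
    = c i * g p (\<alpha> i) \<gamma> + 1 * g p (\<lambda>v. \<Sum>i\<in>I. c i * \<alpha> i v) \<gamma>"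
    by (rule tensor_linear[OF _ CT_sum_mem \<gamma>]) (use insert.prems in simp_all)
  with insert show ?case by simp
qed (use tensor_linear[OF CT_zero CT_zero \<gamma>, of 0 0] in simp_all)

lemma tensor_sum_right:
  assumes \<gamma>: "\<gamma> \<in> CT p" and \<alpha>: "\<And>i. i \<in> I \<Longrightarrow> \<alpha> i \<in> CT p"
  shows "g p \<gamma> (\<lambda>v. \<Sum>i\<in>I. c i * \<alpha> i v) = (\<Sum>i\<in>I. c i * g p \<gamma> (\<alpha> i))"
  using tensor_sym[OF \<gamma> CT_sum_mem[OF \<alpha>, of I "\<lambda>i. i" c]] tensor_sum[OF \<gamma> \<alpha>, of I "\<lambda>i. i" c] tensor_sym[OF \<gamma> \<alpha>] by simp

end

end

context affine_connection
begin

lemma cov_deriv_tensor_eq: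
  assumes p: "p \<in> U" and E: "frame_near p E" and Z: "vf_near p Z" and g: "sym_bilinear_at p g"
  shows "cov_deriv_tensor M D g Z (coframe M E a) (coframe M E b) p
    = Z p (\<lambda>q. g q (coframe M E a q) (coframe M E b q))
      + (\<Sum>d\<in>UNIV. coframe M E a p (D Z (E d) p) * g p (coframe M E d p) (coframe M E b p))
      + (\<Sum>d\<in>UNIV. coframe M E b p (D Z (E d) p) * g p (coframe M E a p) (coframe M E d p))"
proof -
  have "g p (cov_deriv_form M D Z (coframe M E a) p) (coframe M E b p)
     = (\<Sum>d\<in>UNIV. - coframe M E a p (D Z (E d) p) * g p (coframe M E d p) (coframe M E b p))"
    unfolding cov_deriv_coframe[OF p E Z]
    by (rule tensor_sum[OF g coframe_CT[OF E]]) (rule coframe_CT[OF E])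
  moreover have "g p (coframe M E a p) (cov_deriv_form M D Z (coframe M E b) p)
     = (\<Sum>d\<in>UNIV. - coframe M E b p (D Z (E d) p) * g p (coframe M E a p) (coframe M E d p))"
    unfolding cov_deriv_coframe[OF p E Z]
    by (rule tensor_sum_right[OF g coframe_CT[OF E]]) (rule coframe_CT[OF E])
  ultimately show ?thesis by (simp add: cov_deriv_tensor_def sum_negf)
qed

lemma differential_CT: "differential M f p \<in> CT p"
  by (rule CT_I) (simp_all add: differential_def TT_lincomb)

lemma ext_cov_deriv_CT:
  assumes "frame_near p E"
  shows "ext_cov_deriv M D g E a b p \<in> CT p"
proof -
  have "(\<lambda>v. 1 * (1 * differential M (\<lambda>q. g q (coframe M E a q) (coframe M E b q)) p v
     + 1 * (\<Sum>c\<in>UNIV. g p (coframe M E c p) (coframe M E b p) * conn_form M D E a c p v))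
     + 1 * (\<Sum>c\<in>UNIV. g p (coframe M E a p) (coframe M E c p) * conn_form M D E b c p v)) \<in> CT p"
    by (rule CT_lincomb[OF CT_lincomb[OF differential_CT CT_sum_mem] CT_sum_mem])
      (rule conn_form_CT[OF assms])+
  then show ?thesis unfolding ext_cov_deriv_def by (simp add: mult.commute)
qed

lemma ext_cov_deriv_eq:
  assumes p: "p \<in> U" and E: "frame_near p E" and Z: "vf_near p Z"
  shows "ext_cov_deriv M D g E a b p (Z p)
    = Z p (\<lambda>q. g q (coframe M E a q) (coframe M E b q))
      + (\<Sum>d\<in>UNIV. coframe M E a p (D Z (E d) p) * g p (coframe M E d p) (coframe M E b p))
      + (\<Sum>d\<in>UNIV. coframe M E b p (D Z (E d) p) * g p (coframe M E a p) (coframe M E d p))"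
  unfolding ext_cov_deriv_def conn_form_eq[OF p E Z]
  by (simp add: differential_def vf_near_TT[OF Z])

text \<open>Evaluated on \<open>E c p\<close>, the exterior equation is the component equation with
  index \<open>c\<close>. Both of its sides are covectors at \<open>p\<close>, so they are
  determined by these values.\<close>

lemma metrisability_eq_iff_ext:
  assumes g: "sym_tensor M U g"
  shows "metrisability_eq M U D g \<mu> \<longleftrightarrow> metrisability_eq_ext M U D g \<mu>"
proof -
  have "(\<forall>a b c. cov_deriv_tensor M D g (E c) (coframe M E a) (coframe M E b) p =
          coframe M E a p (\<mu> p) * of_bool (b = c) + coframe M E b p (\<mu> p) * of_bool (a = c))
    \<longleftrightarrow> (\<forall>a b. ext_cov_deriv M D g E a b p =
          (\<lambda>v. coframe M E a p (\<mu> p) * coframe M E b p v + coframe M E b p (\<mu> p) * coframe M E a p v))"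
    if W: "open W" "W \<subseteq> U" "frame M W E" and pW: "p \<in> W" for W E p
  proof -
    have p: "p \<in> U" using W pW by auto
    have E: "frame_near p E" by (rule frame_nearI[OF W(3,1) pW])
    have 1: "cov_deriv_tensor M D g (E c) (coframe M E a) (coframe M E b) p = ext_cov_deriv M D g E a b p (E c p)" for a b c
      unfolding cov_deriv_tensor_eq[OF p E frame_near_vf[OF E] sym_tensor_at[OF g p]]
        ext_cov_deriv_eq[OF p E frame_near_vf[OF E]] ..
    have 2: "ext_cov_deriv M D g E a b p =
          (\<lambda>v. coframe M E a p (\<mu> p) * coframe M E b p v + coframe M E b p (\<mu> p) * coframe M E a p v)
       \<longleftrightarrow> (\<forall>c. ext_cov_deriv M D g E a b p (E c p) =
          coframe M E a p (\<mu> p) * of_bool (b = c) + coframe M E b p (\<mu> p) * of_bool (a = c))" for a b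
    proof
      assume "\<forall>c. ext_cov_deriv M D g E a b p (E c p) =
          coframe M E a p (\<mu> p) * of_bool (b = c) + coframe M E b p (\<mu> p) * of_bool (a = c)"
      then show "ext_cov_deriv M D g E a b p =
          (\<lambda>v. coframe M E a p (\<mu> p) * coframe M E b p v + coframe M E b p (\<mu> p) * coframe M E a p v)"
        by (intro CT_eqI[OF E ext_cov_deriv_CT[OF E] CT_lincomb[OF coframe_CT[OF E] coframe_CT[OF E]]])
          (simp add: coframe_frame[OF E])
    qed (simp add: coframe_frame[OF E])
    show ?thesis unfolding 1 2 ..
  qed
  then show ?thesis unfolding metrisability_eq_def metrisability_eq_ext_def by meson
qed

end


section \<open>Curvature and the symmetric Schouten tensor\<close>

context manifold
begin

text \<open>Agreement is asked for on tangent vectors alone because \<open>log_det_form\<close> is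
  not set to 0 elsewhere and is thus not literally a covector. It is asked for near \<open>p\<close>
  because the fields differentiate the values.\<close>

lemma ext_deriv_cong:
  assumes X: "vf_near p X" and Y: "vf_near p Y" and AB: "\<forall>\<^sub>F q in nhds p. \<forall>v\<in>TT q. A q v = B q v"
  shows "ext_deriv M A X Y p = ext_deriv M B X Y p"
proof -
  have ev: "\<forall>\<^sub>F q in nhds p. A q (Z q) = B q (Z q)" if Z: "vf_near p Z" for Z
    using eventually_conj[OF AB vf_near_eventually[OF Z]]
    by eventually_elim (simp add: vf_near_TT)
  have "A p (lie_bracket M X Y p) = B p (lie_bracket M X Y p)"
    by (rule eventually_nhds_x_imp_x[OF ev[OF vf_near_lie_bracket[OF X Y]]])
  then show ?thesis
    unfolding ext_deriv_def
    using tv_cong[OF vf_near_TT[OF X] ev[OF Y]] tv_cong[OF vf_near_TT[OF Y] ev[OF X]] by simp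
qed

lemma ext_deriv_lincomb:
  assumes X: "vf_near p X" and Y: "vf_near p Y" and A: "form_near p A" and B: "form_near p B"
  shows "ext_deriv M (\<lambda>q v. a * A q v + b * B q v) X Y p = a * ext_deriv M A X Y p + b * ext_deriv M B X Y p"
proof -
  have *: "Z p (\<lambda>q. a * A q (Z' q) + b * B q (Z' q)) = a * Z p (\<lambda>q. A q (Z' q)) + b * Z p (\<lambda>q. B q (Z' q))"
    if "vf_near p Z" "vf_near p Z'" for Z Z'
    using tv_add[OF vf_near_TT[OF that(1)] sm_cmult[OF form_near_sm[OF A that(2)]] sm_cmult[OF form_near_sm[OF B that(2)]]]
      tv_cmult[OF vf_near_TT[OF that(1)] form_near_sm[OF A that(2)]]
      tv_cmult[OF vf_near_TT[OF that(1)] form_near_sm[OF B that(2)]] by simp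
  show ?thesis unfolding ext_deriv_def *[OF X Y] *[OF Y X] by (simp add: algebra_simps)
qed

lemma ext_deriv_sum:
  assumes X: "vf_near p X" and Y: "vf_near p Y" and A: "\<And>i. i \<in> I \<Longrightarrow> form_near p (A i)"
  shows "ext_deriv M (\<lambda>q v. \<Sum>i\<in>I. A i q v) X Y p = (\<Sum>i\<in>I. ext_deriv M (A i) X Y p)"
proof -
  have *: "Z p (\<lambda>q. \<Sum>i\<in>I. A i q (Z' q)) = (\<Sum>i\<in>I. Z p (\<lambda>q. A i q (Z' q)))"
    if "vf_near p Z" "vf_near p Z'" for Z Z'
    by (rule tv_sum[OF vf_near_TT[OF that(1)]]) (rule form_near_sm[OF A that(2)])
  show ?thesis unfolding ext_deriv_def *[OF X Y] *[OF Y X] by (simp add: sum_subtractf)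
qed

text \<open>The columns of the inverse matrix solve linear systems with matrix \<open>G\<close> and
  constant right-hand sides, so they are smooth by Cramer's rule.\<close>

lemma ex_smooth_inverse:
  fixes G :: "'k::finite \<Rightarrow> 'k \<Rightarrow> 'm \<Rightarrow> real"
  assumes G: "\<And>a b. sm p (G a b)" and P: "\<forall>\<^sub>F q in nhds p. P q"
    and det: "\<And>q. P q \<Longrightarrow> det (\<chi> i j. G i j q) \<noteq> 0"
  obtains H where "\<And>a b. sm p (H a b)"
    "\<And>q a c. P q \<Longrightarrow> (\<Sum>b\<in>UNIV. H a b q * G b c q) = of_bool (a = c)"
    "\<And>q a c. P q \<Longrightarrow> (\<Sum>b\<in>UNIV. G a b q * H b c q) = of_bool (a = c)"
proof
  define H where "H a b q = matrix_inv (\<chi> i j. G i j q) $ a $ b" for a b q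
  have mi: "(\<chi> i j. G i j q) ** matrix_inv (\<chi> i j. G i j q) = mat 1 \<and>
      matrix_inv (\<chi> i j. G i j q) ** (\<chi> i j. G i j q) = mat 1" if "P q" for q
  proof -
    have "invertible (\<chi> i j. G i j q)" using det[OF that] by (simp add: invertible_det_nz)
    then show ?thesis unfolding invertible_def matrix_inv_def by (rule someI_ex)
  qed
  have l: "(\<Sum>b\<in>UNIV. H a b q * G b c q) = of_bool (a = c)" if "P q" for q a c
    using arg_cong[OF conjunct2[OF mi[OF that]], of "\<lambda>m. m $ a $ c"]
    by (simp add: matrix_matrix_mult_def mat_def H_def)
  have r: "(\<Sum>b\<in>UNIV. G a b q * H b c q) = of_bool (a = c)" if "P q" for q a c
    using arg_cong[OF conjunct1[OF mi[OF that]], of "\<lambda>m. m $ a $ c"]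
    by (simp add: matrix_matrix_mult_def mat_def H_def)
  show "(\<Sum>b\<in>UNIV. H a b q * G b c q) = of_bool (a = c)"
    "(\<Sum>b\<in>UNIV. G a b q * H b c q) = of_bool (a = c)" if "P q" for q a c
    using l[OF that] r[OF that] by simp_all
  show "sm p (H a b)" for a b
  proof (rule linear_system_sm[of p "\<lambda>q i j. G i j q" "\<lambda>q i. of_bool (i = b)" P "\<lambda>q j. H j b q", OF G sm_const _ P])
    show "\<not> P q" if "det (\<chi> i j. G i j q) = 0" for q using det[of q] that by argo
    show "(\<Sum>j\<in>UNIV. G i j q * H j b q) = of_bool (i = b)" if "P q" for q i
      using r[OF that] .
  qed
qed

lemma tv_inverse_matrix:
  fixes G H :: "'k::finite \<Rightarrow> 'k \<Rightarrow> 'm \<Rightarrow> real"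
  assumes G: "\<And>a b. sm p (G a b)" and H: "\<And>a b. sm p (H a b)"
    and HG: "\<And>a c. \<forall>\<^sub>F q in nhds p. (\<Sum>b\<in>UNIV. H a b q * G b c q) = of_bool (a = c)"
    and Z: "Z \<in> TT p"
  shows "(\<Sum>b\<in>UNIV. Z (H a b) * G b c p) = - (\<Sum>b\<in>UNIV. H a b p * Z (G b c))"
proof -
  have "Z (\<lambda>q. \<Sum>b\<in>UNIV. H a b q * G b c q) = Z (\<lambda>q. of_bool (a = c))"
    by (rule tv_cong[OF Z HG])
  moreover have "Z (\<lambda>q. \<Sum>b\<in>UNIV. H a b q * G b c q) = (\<Sum>b\<in>UNIV. Z (\<lambda>q. H a b q * G b c q))"
    by (rule tv_sum[OF Z]) (rule sm_mult[OF H G])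
  moreover have "Z (\<lambda>q. H a b q * G b c q) = H a b p * Z (G b c) + G b c p * Z (H a b)" for b
    by (rule tv_mult[OF Z H G])
  ultimately show ?thesis using tv_const[OF Z] by (simp add: sum.distrib mult.commute)
qed

text \<open>The form \<open>tr (G\<^sup>-\<^sup>1 dG) = d log |det G|\<close>.\<close>

definition log_det_form :: "('k::finite \<Rightarrow> 'k \<Rightarrow> 'm \<Rightarrow> real) \<Rightarrow> ('k \<Rightarrow> 'k \<Rightarrow> 'm \<Rightarrow> real) \<Rightarrow> 'm form" where
  "log_det_form H G q v = (\<Sum>a\<in>UNIV. \<Sum>b\<in>UNIV. H a b q * v (G b a))"

text \<open>Put \<open>R Z\<close> for the matrix \<open>H * Z(G)\<close>. Since \<open>H\<close> is
  inverse to \<open>G\<close>, its derivative along \<open>Z\<close> is \<open>- R Z * H\<close>, so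
  the first-order part of the exterior derivative is a difference of traces of
  \<open>R X * R Y\<close> and \<open>R Y * R X\<close>, which is 0. The second derivatives of
  \<open>G\<close> are cancelled by the bracket term.\<close>

lemma log_det_form_closed:
  fixes G H :: "'k::finite \<Rightarrow> 'k \<Rightarrow> 'm \<Rightarrow> real"
  assumes G: "\<And>a b. sm p (G a b)" and H: "\<And>a b. sm p (H a b)"
    and HG: "\<And>a c. \<forall>\<^sub>F q in nhds p. (\<Sum>b\<in>UNIV. H a b q * G b c q) = of_bool (a = c)"
    and GH: "\<And>a c. (\<Sum>b\<in>UNIV. G a b p * H b c p) = of_bool (a = c)"
    and X: "vf_near p X" and Y: "vf_near p Y"
  shows "ext_deriv M (log_det_form H G) X Y p = 0"
proof -
  define R where "R Z a c = (\<Sum>b\<in>UNIV. H a b p * Z p (G b c))" for Z :: "'m vfield" and a c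
  have R: "(\<Sum>a\<in>UNIV. \<Sum>b\<in>UNIV. Z p (H a b) * W p (G b a)) = - (\<Sum>a\<in>UNIV. \<Sum>c\<in>UNIV. R Z a c * R W c a)"
    if Z: "vf_near p Z" for Z W
  proof -
    have "Z p (H a b) = - (\<Sum>c\<in>UNIV. R Z a c * H c b p)" for a b
    proof -
      have "(\<Sum>c\<in>UNIV. (\<Sum>d\<in>UNIV. Z p (H a d) * G d c p) * H c b p)
        = (\<Sum>d\<in>UNIV. Z p (H a d) * (\<Sum>c\<in>UNIV. G d c p * H c b p))"
        unfolding sum_distrib_left sum_distrib_right mult.assoc by (rule sum.swap)
      also have "\<dots> = Z p (H a b)" unfolding GH by simp
      finally show ?thesis
        unfolding tv_inverse_matrix[OF G H HG vf_near_TT[OF Z]] R_def by (simp add: sum_negf)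
    qed
    then have "(\<Sum>a\<in>UNIV. \<Sum>b\<in>UNIV. Z p (H a b) * W p (G b a))
      = - (\<Sum>a\<in>UNIV. \<Sum>b\<in>UNIV. \<Sum>c\<in>UNIV. R Z a c * (H c b p * W p (G b a)))"
      by (simp add: sum_negf sum_distrib_right mult.assoc)
    also have "(\<Sum>a\<in>UNIV. \<Sum>b\<in>UNIV. \<Sum>c\<in>UNIV. R Z a c * (H c b p * W p (G b a)))
      = (\<Sum>a\<in>UNIV. \<Sum>c\<in>UNIV. \<Sum>b\<in>UNIV. R Z a c * (H c b p * W p (G b a)))"
      by (intro sum.cong refl sum.swap)
    finally show ?thesis by (simp add: R_def[of W] sum_distrib_left)
  qed
  have D: "Z p (\<lambda>q. log_det_form H G q (W q))
     = (\<Sum>a\<in>UNIV. \<Sum>b\<in>UNIV. Z p (H a b) * W p (G b a)) + (\<Sum>a\<in>UNIV. \<Sum>b\<in>UNIV. H a b p * Z p (\<lambda>q. W q (G b a)))"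
    if Z: "vf_near p Z" and W: "vf_near p W" for Z W
  proof -
    note Zp = vf_near_TT[OF Z] and WG = vf_near_sm[OF W G]
    have "Z p (\<lambda>q. log_det_form H G q (W q)) = (\<Sum>a\<in>UNIV. Z p (\<lambda>q. \<Sum>b\<in>UNIV. H a b q * W q (G b a)))"
      unfolding log_det_form_def by (rule tv_sum[OF Zp]) (rule sm_sum, rule sm_mult[OF H WG])
    also have "\<dots> = (\<Sum>a\<in>UNIV. \<Sum>b\<in>UNIV. Z p (\<lambda>q. H a b q * W q (G b a)))"
      by (intro sum.cong refl, rule tv_sum[OF Zp]) (rule sm_mult[OF H WG])
    also have "\<dots> = (\<Sum>a\<in>UNIV. \<Sum>b\<in>UNIV. H a b p * Z p (\<lambda>q. W q (G b a)) + W p (G b a) * Z p (H a b))"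
      by (intro sum.cong refl tv_mult[OF Zp H WG])
    finally show ?thesis by (simp add: sum.distrib mult.commute add.commute)
  qed
  have "log_det_form H G p (lie_bracket M X Y p)
    = (\<Sum>a\<in>UNIV. \<Sum>b\<in>UNIV. H a b p * X p (\<lambda>q. Y q (G b a))) - (\<Sum>a\<in>UNIV. \<Sum>b\<in>UNIV. H a b p * Y p (\<lambda>q. X q (G b a)))"
    unfolding log_det_form_def lie_bracket_def by (simp add: G right_diff_distrib sum_subtractf)
  moreover have "(\<Sum>a\<in>UNIV. \<Sum>c\<in>UNIV. R X a c * R Y c a) = (\<Sum>a\<in>UNIV. \<Sum>c\<in>UNIV. R Y a c * R X c a)"
    by (subst sum.swap) (simp add: mult.commute)
  ultimately show ?thesis
    unfolding ext_deriv_def D[OF X Y] D[OF Y X] R[OF X] R[OF Y] by simp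
qed

section \<open>The Jacobi identity\<close>

lemma lie_bracket_apply: "sm p f \<Longrightarrow> lie_bracket M X Y p f = X p (\<lambda>q. Y q f) - Y p (\<lambda>q. X q f)"
  by (simp add: lie_bracket_def)

lemma lie_bracket_nested:
  assumes X: "vf_near p X" and Y: "vf_near p Y" and Z: "vf_near p Z" and f: "sm p f"
  shows "lie_bracket M X (lie_bracket M Y Z) p f
    = X p (\<lambda>q. Y q (\<lambda>r. Z r f)) - X p (\<lambda>q. Z q (\<lambda>r. Y r f))
      - (Y p (\<lambda>q. Z q (\<lambda>r. X r f)) - Z p (\<lambda>q. Y q (\<lambda>r. X r f)))"
proof -
  have "X p (\<lambda>q. lie_bracket M Y Z q f) = X p (\<lambda>q. Y q (\<lambda>r. Z r f) - Z q (\<lambda>r. Y r f))"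
  proof (rule tv_cong[OF vf_near_TT[OF X]])
    show "\<forall>\<^sub>F q in nhds p. lie_bracket M Y Z q f = Y q (\<lambda>r. Z r f) - Z q (\<lambda>r. Y r f)"
      using sm_eventually[OF f] by eventually_elim (simp add: lie_bracket_def)
  qed
  also have "\<dots> = X p (\<lambda>q. Y q (\<lambda>r. Z r f)) - X p (\<lambda>q. Z q (\<lambda>r. Y r f))"
    by (rule tv_diff[OF vf_near_TT[OF X] vf_near_sm[OF Y vf_near_sm[OF Z f]] vf_near_sm[OF Z vf_near_sm[OF Y f]]])
  finally show ?thesis
    unfolding lie_bracket_apply[OF f, of X] lie_bracket_apply[OF vf_near_sm[OF X f], of Y Z] by simp
qed

lemma jacobi:
  assumes X: "vf_near p X" and Y: "vf_near p Y" and Z: "vf_near p Z"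
  shows "lie_bracket M X (lie_bracket M Y Z) p f + lie_bracket M Y (lie_bracket M Z X) p f
    + lie_bracket M Z (lie_bracket M X Y) p f = 0"
proof (cases "sm p f")
  case True
  show ?thesis
    unfolding lie_bracket_nested[OF X Y Z True] lie_bracket_nested[OF Y Z X True]
      lie_bracket_nested[OF Z X Y True] by simp
qed (simp add: lie_bracket_def)

end

section \<open>Curvature operator, Bianchi identity and Ricci tensor\<close>

context affine_connection
begin

definition curv :: "'m vfield \<Rightarrow> 'm vfield \<Rightarrow> 'm vfield \<Rightarrow> 'm vfield" where
  "curv X Y Z p = (\<lambda>f. D X (D Y Z) p f - D Y (D X Z) p f - D (lie_bracket M X Y) Z p f)"

definition trace_form :: "('n \<Rightarrow> 'm vfield) \<Rightarrow> 'm form" where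
  "trace_form E q v = (\<Sum>c\<in>UNIV. conn_form M D E c c q v)"

context
  fixes p assumes p: "p \<in> U"
begin

lemma curv_TT:
  assumes X: "vf_near p X" and Y: "vf_near p Y" and Z: "vf_near p Z"
  shows "curv X Y Z p \<in> TT p"
proof -
  have T: "D X (D Y Z) p \<in> TT p" "D Y (D X Z) p \<in> TT p" "D (lie_bracket M X Y) Z p \<in> TT p"
    by (rule vf_near_TT[OF conn_vf[OF p X conn_vf[OF p Y Z]]]
      vf_near_TT[OF conn_vf[OF p Y conn_vf[OF p X Z]]]
      vf_near_TT[OF conn_vf[OF p vf_near_lie_bracket[OF X Y] Z]])+
  have "(\<lambda>f. 1 * (1 * D X (D Y Z) p f + (-1) * D Y (D X Z) p f) + (-1) * D (lie_bracket M X Y) Z p f) \<in> TT p"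
    by (intro TT_lincomb T)
  then show ?thesis by (simp add: curv_def)
qed

lemma CT_curv:
  assumes X: "vf_near p X" and Y: "vf_near p Y" and Z: "vf_near p Z" and \<alpha>: "\<alpha> \<in> CT p"
  shows "\<alpha> (curv X Y Z p) = \<alpha> (D X (D Y Z) p) - \<alpha> (D Y (D X Z) p) - \<alpha> (D (lie_bracket M X Y) Z p)"
proof -
  have T: "D X (D Y Z) p \<in> TT p" "D Y (D X Z) p \<in> TT p" "D (lie_bracket M X Y) Z p \<in> TT p"
    by (rule vf_near_TT[OF conn_vf[OF p X conn_vf[OF p Y Z]]]
      vf_near_TT[OF conn_vf[OF p Y conn_vf[OF p X Z]]]
      vf_near_TT[OF conn_vf[OF p vf_near_lie_bracket[OF X Y] Z]])+
  have "(\<lambda>f. D X (D Y Z) p f - D Y (D X Z) p f) \<in> TT p"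
    using TT_lincomb[OF T(1,2), of 1 "-1"] by simp
  from CT_diff[OF \<alpha> this T(3)] CT_diff[OF \<alpha> T(1,2)] show ?thesis by (simp add: curv_def)
qed

lemma curv_swap:
  assumes X: "vf_near p X" and Y: "vf_near p Y" and Z: "vf_near p Z"
  shows "curv Y X Z p f = - curv X Y Z p f"
proof -
  have "lie_bracket M Y X = (\<lambda>q f. (-1) * lie_bracket M X Y q f)"
    by (intro ext) (simp add: lie_bracket_def)
  then have "D (lie_bracket M Y X) Z p f = - D (lie_bracket M X Y) Z p f"
    using fun_cong[OF conn_scale(1)[OF p vf_near_lie_bracket[OF X Y] Z sm_const], of "-1" f] by simp
  then show ?thesis by (simp add: curv_def)
qed

text \<open>Vanishing torsion reduces the cyclic sum to the Jacobi identity.\<close>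

lemma first_bianchi:
  assumes X: "vf_near p X" and Y: "vf_near p Y" and Z: "vf_near p Z"
  shows "curv X Y Z p f + curv Y Z X p f + curv Z X Y p f = 0"
proof -
  \<comment> \<open>The nine terms of the cyclic sum are regrouped by the outermost direction of
    differentiation. Torsion freeness, used once for \<open>B\<close>, \<open>C\<close> and once for
    \<open>A\<close> and their bracket, makes each group a nested bracket.\<close>
  have *: "D A (D B C) p f - D A (D C B) p f - D (lie_bracket M B C) A p f = lie_bracket M A (lie_bracket M B C) p f"
    if A: "vf_near p A" and B: "vf_near p B" and C: "vf_near p C" for A B C
  proof -
    note L = vf_near_lie_bracket[OF B C] and CB = conn_vf[OF p C B]
    have "D A (D B C) p = D A (\<lambda>q f. D C B q f + lie_bracket M B C q f) p"
    proof (rule conn_cong[OF p A vf_near_add[OF CB L]])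
      show "\<forall>\<^sub>F q in nhds p. D B C q = (\<lambda>f. D C B q f + lie_bracket M B C q f)"
        using eventually_conj[OF eventually_U[OF p] eventually_conj[OF vf_near_eventually[OF B] vf_near_eventually[OF C]]]
      proof eventually_elim
        case (elim q)
        show ?case by (rule conn_torsion) (use elim in simp_all)
      qed
    qed simp
    also have "\<dots> = (\<lambda>f. D A (D C B) p f + D A (lie_bracket M B C) p f)"
      by (rule conn_add_right[OF p A CB L])
    finally show ?thesis
      using conn_torsion[OF p A L] by simp
  qed
  show ?thesis
    unfolding curv_def using *[OF X Y Z] *[OF Y Z X] *[OF Z X Y] jacobi[OF X Y Z, of f] by linarith
qed

context
  fixes E assumes E: "frame_near p E"
begin

text \<open>Cartan's second structure equation. Iterating the component formula for the derivative
  along \<open>W\<close> and then \<open>Z\<close> gives a derivative of a connection form plus a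
  product of two; antisymmetrising produces the exterior derivative and the wedge product.\<close>

lemma curv_form_eq:
  assumes X: "vf_near p X" and Y: "vf_near p Y"
  shows "curv_form M D E a b X Y p = coframe M E a p (curv X Y (E b) p)"
proof -
  note vE = frame_near_vf[OF E]
  have ev: "\<forall>\<^sub>F q in nhds p. conn_form M D E a b q (Z q) = coframe M E a q (D Z (E b) q)" if "vf_near p Z" for Z a b
    using eventually_conj[OF eventually_U[OF p] eventually_conj[OF frame_near_eventually[OF E] vf_near_eventually[OF that]]]
    by eventually_elim (simp add: conn_form_eq)
  have D2: "coframe M E a p (D Z (D W (E b)) p) = Z p (\<lambda>q. conn_form M D E a b q (W q))
      + (\<Sum>c\<in>UNIV. conn_form M D E a c p (Z p) * conn_form M D E c b p (W p))"
    if Z: "vf_near p Z" and W: "vf_near p W" for Z W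
    unfolding coframe_conn[OF p E Z conn_vf[OF p W vE]] tv_cong[OF vf_near_TT[OF Z] ev[OF W]]
      conn_form_eq[OF p E Z] conn_form_eq[OF p E W]
    by (simp add: mult.commute)
  show ?thesis
    unfolding CT_curv[OF X Y vE coframe_CT[OF E]] D2[OF X Y] D2[OF Y X]
      curv_form_def ext_deriv_def wedge_def conn_form_eq[OF p E vf_near_lie_bracket[OF X Y]]
    by (simp add: sum_subtractf)
qed

text \<open>The trace of the quadratic term vanishes: renaming the two summation indices exchanges
  the factors of the wedge product and changes its sign.\<close>

lemma ext_deriv_trace_form:
  assumes X: "vf_near p X" and Y: "vf_near p Y"
  shows "ext_deriv M (trace_form E) X Y p = (\<Sum>c\<in>UNIV. coframe M E c p (curv X Y (E c) p))"
proof -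
  have "(\<Sum>c\<in>UNIV. \<Sum>d\<in>UNIV. wedge (conn_form M D E c d) (conn_form M D E d c) X Y p) = 0"
    unfolding wedge_def sum_subtractf by (subst sum.swap) (simp add: mult.commute)
  moreover have "ext_deriv M (trace_form E) X Y p = (\<Sum>c\<in>UNIV. ext_deriv M (conn_form M D E c c) X Y p)"
    unfolding trace_form_def[abs_def] by (rule ext_deriv_sum[OF X Y form_near_conn_form[OF p E]])
  ultimately show ?thesis
    unfolding curv_form_eq[OF X Y, symmetric] curv_form_def by (simp add: sum.distrib)
qed

text \<open>Contraction of the first Bianchi identity. Two of the three cyclic terms become Ricci
  components, up to sign and order, and the third becomes the trace of the curvature
  operator.\<close>

lemma ricci_antisymmetric_part:
  "ricci M D E a b p - ricci M D E b a p = ext_deriv M (trace_form E) (E a) (E b) p"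
proof -
  note v = frame_near_vf[OF E]
  have "coframe M E c p (curv (E c) (E b) (E a) p) - coframe M E c p (curv (E c) (E a) (E b) p)
      = coframe M E c p (curv (E a) (E b) (E c) p)" for c
  proof -
    have "curv (E a) (E b) (E c) p = (\<lambda>f. curv (E c) (E b) (E a) p f - curv (E c) (E a) (E b) p f)"
    proof
      fix f
      show "curv (E a) (E b) (E c) p f = curv (E c) (E b) (E a) p f - curv (E c) (E a) (E b) p f"
        using first_bianchi[OF v[of c] v[of b] v[of a], of f] curv_swap[OF v[of a] v[of b] v[of c], of f]
          curv_swap[OF v[of c] v[of a] v[of b], of f] by linarith
    qed
    then show ?thesis using CT_diff[OF coframe_CT[OF E] curv_TT[OF v v v] curv_TT[OF v v v]] by simp
  qed
  then show ?thesis
    unfolding ext_deriv_trace_form[OF v v] ricci_def curvature_def curv_form_eq[OF v v] sum_subtractf[symmetric]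
    by simp
qed

end

end

text \<open>The symmetrised Ricci part drops out of the difference, and the remaining factor
  \<open>1 / (real CARD('n) + 1)\<close> is not 0.\<close>

lemma schouten_symmetric_iff:
  "schouten M D E a b p = schouten M D E b a p \<longleftrightarrow> ricci M D E a b p = ricci M D E b a p"
proof -
  have "schouten M D E a b p - schouten M D E b a p
    = - (1 / (real CARD('n) + 1)) * (ricci M D E a b p - ricci M D E b a p)"
  proof -
    have "(m * ((x + y) / 2) - k * ((x - y) / 2)) - (m * ((y + x) / 2) - k * ((y - x) / 2)) = - k * (x - y)"
      for m k x y :: real
      by (simp add: algebra_simps add_divide_distrib diff_divide_distrib)
    then show ?thesis unfolding schouten_def .
  qed
  moreover have "1 / (real CARD('n) + 1) \<noteq> 0" by simp
  ultimately show ?thesis by (metis eq_iff_diff_eq_0 mult_eq_0_iff neg_equal_0_iff_equal)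
qed

lemma symmetric_schouten_iff:
  "symmetric_schouten M U D \<longleftrightarrow>
    (\<forall>p\<in>U. \<forall>E. frame_near p E \<longrightarrow> (\<forall>a b. ext_deriv M (trace_form E) (E a) (E b) p = 0))"
proof
  assume s: "symmetric_schouten M U D"
  show "\<forall>p\<in>U. \<forall>E. frame_near p E \<longrightarrow> (\<forall>a b. ext_deriv M (trace_form E) (E a) (E b) p = 0)"
  proof (intro ballI allI impI)
    fix p E a b assume p: "p \<in> U" and E: "frame_near p E"
    obtain W where W: "open W" "p \<in> W" "frame M W E" using E unfolding frame_near_def by auto
    have "frame M (W \<inter> U) E" using W(3) by (rule frame_subset) simp
    then have "schouten M D E a b p = schouten M D E b a p"
      using s[unfolded symmetric_schouten_def, rule_format, of "W \<inter> U" E p a b] W p open_U by auto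
    then show "ext_deriv M (trace_form E) (E a) (E b) p = 0"
      unfolding schouten_symmetric_iff ricci_antisymmetric_part[OF p E, symmetric] by simp
  qed
next
  assume *: "\<forall>p\<in>U. \<forall>E. frame_near p E \<longrightarrow> (\<forall>a b. ext_deriv M (trace_form E) (E a) (E b) p = 0)"
  show "symmetric_schouten M U D"
    unfolding symmetric_schouten_def schouten_symmetric_iff
  proof (intro allI impI ballI)
    fix W E p a b assume W: "open W" "W \<subseteq> U" "frame M W E" and pW: "p \<in> W"
    have p: "p \<in> U" and E: "frame_near p E" using W pW by (auto intro: frame_nearI)
    show "ricci M D E a b p = ricci M D E b a p"
      using ricci_antisymmetric_part[OF p E, of a b] * p E by simp
  qed
qed

lemma form_near_trace_form:
  assumes p: "p \<in> U" and E: "frame_near p E"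
  shows "form_near p (trace_form E)"
proof (rule form_nearI_components[OF E])
  show "\<forall>\<^sub>F q in nhds p. trace_form E q \<in> CT q"
    using frame_near_eventually[OF E]
  proof eventually_elim
    case (elim q)
    have "(\<lambda>v. \<Sum>c\<in>UNIV. 1 * conn_form M D E c c q v) \<in> CT q"
      by (rule CT_sum_mem) (rule conn_form_CT[OF elim])
    then show ?case by (simp add: trace_form_def[abs_def])
  qed
  show "sm p (\<lambda>q. trace_form E q (E a q))" for a
    unfolding trace_form_def by (intro sm_sum form_near_sm[OF form_near_conn_form[OF p E] frame_near_vf[OF E]])
qed

text \<open>For a torsionless connection the exterior derivative of \<open>A\<close> is the
  antisymmetrised covariant derivative. The latter depends bilinearly on the values of the two
  fields at \<open>p\<close>, so a frame is enough to test it; using the connection avoids expanding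
  the Lie bracket in the frame.\<close>

lemma ext_deriv_eq_zeroI:
  assumes p: "p \<in> U" and E: "frame_near p E" and A: "form_near p A"
    and zero: "\<And>a b. ext_deriv M A (E a) (E b) p = 0" and X: "vf_near p X" and Y: "vf_near p Y"
  shows "ext_deriv M A X Y p = 0"
proof -
  \<comment> \<open>\<open>B Z W\<close> is the covariant derivative of \<open>A\<close> along
    \<open>Z\<close>, evaluated on \<open>W\<close>.\<close>
  define B where "B Z W = Z p (\<lambda>q. A q (W q)) - A p (D Z W p)" for Z W
  note v = frame_near_vf[OF E]
  have ext: "ext_deriv M A Z W p = B Z W - B W Z" if Z: "vf_near p Z" and W: "vf_near p W" for Z W
  proof -
    have "A p (lie_bracket M Z W p) = A p (\<lambda>f. D Z W p f - D W Z p f)"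
      using conn_torsion[OF p Z W] by simp
    also have "\<dots> = A p (D Z W p) - A p (D W Z p)"
      by (rule CT_diff[OF form_near_CT[OF A] vf_near_TT[OF conn_vf[OF p Z W]] vf_near_TT[OF conn_vf[OF p W Z]]])
    finally show ?thesis by (simp add: ext_deriv_def B_def)
  qed
  have right: "B Z W = (\<Sum>b\<in>UNIV. coframe M E b p (W p) * B Z (E b))" if Z: "vf_near p Z" and W: "vf_near p W" for Z W
    unfolding B_def by (rule nabla_form_tensorial[OF p E Z W A])
  have left: "B Z (E b) = (\<Sum>a\<in>UNIV. coframe M E a p (Z p) * B (E a) (E b))" if Z: "vf_near p Z" for Z b
  proof -
    have "A p (D Z (E b) p) = (\<Sum>a\<in>UNIV. coframe M E a p (Z p) * A p (D (E a) (E b) p))"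
      unfolding conn_expand_left[OF p E Z v]
      by (rule CT_sum[OF form_near_CT[OF A]]) (rule vf_near_TT[OF conn_vf[OF p v v]])
    moreover have "Z p (\<lambda>q. A q (E b q)) = (\<Sum>a\<in>UNIV. coframe M E a p (Z p) * E a p (\<lambda>q. A q (E b q)))"
      by (rule fun_cong[OF coframe_expand[OF E vf_near_TT[OF Z]]])
    ultimately show ?thesis by (simp add: B_def right_diff_distrib sum_subtractf)
  qed
  have "B (E a) (E b) = B (E b) (E a)" for a b using ext[OF v[of a] v[of b]] zero by simp
  then have sym: "(\<Sum>b\<in>UNIV. \<Sum>a\<in>UNIV. coframe M E b p (Y p) * (coframe M E a p (X p) * B (E a) (E b)))
     = (\<Sum>b\<in>UNIV. \<Sum>a\<in>UNIV. coframe M E b p (X p) * (coframe M E a p (Y p) * B (E a) (E b)))"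
    by (subst sum.swap) (intro sum.cong refl, simp add: mult.left_commute)
  have "B Z W = (\<Sum>b\<in>UNIV. \<Sum>a\<in>UNIV. coframe M E b p (W p) * (coframe M E a p (Z p) * B (E a) (E b)))"
    if Z: "vf_near p Z" and W: "vf_near p W" for Z W
    unfolding right[OF Z W] left[OF Z] by (simp add: sum_distrib_left)
  from this[OF X Y] this[OF Y X] sym show ?thesis unfolding ext[OF X Y] by simp
qed

end


section \<open>Metrics and their inverse tensors\<close>

text \<open>In matrix notation, \<open>H (T G + G S) H = H T + S H\<close> for mutually inverse
  \<open>H\<close> and \<open>G\<close>.\<close>

lemma sum_inverse_conj:
  fixes H G T S :: "'k::finite \<Rightarrow> 'k \<Rightarrow> real"
  assumes HG: "\<And>a c. (\<Sum>b\<in>UNIV. H a b * G b c) = of_bool (a = c)"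
    and GH: "\<And>a c. (\<Sum>b\<in>UNIV. G a b * H b c) = of_bool (a = c)"
  shows "(\<Sum>b\<in>UNIV. \<Sum>c\<in>UNIV. H a b * ((\<Sum>e\<in>UNIV. T b e * G e c) + (\<Sum>e\<in>UNIV. G b e * S e c)) * H c d)
    = (\<Sum>b\<in>UNIV. H a b * T b d) + (\<Sum>c\<in>UNIV. S a c * H c d)"
proof -
  have "(\<Sum>b\<in>UNIV. \<Sum>c\<in>UNIV. H a b * (\<Sum>e\<in>UNIV. T b e * G e c) * H c d)
    = (\<Sum>b\<in>UNIV. \<Sum>e\<in>UNIV. H a b * T b e * (\<Sum>c\<in>UNIV. G e c * H c d))"
    unfolding sum_distrib_left sum_distrib_right
    by (rule sum.cong[OF refl], subst sum.swap) (simp add: mult.assoc)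
  also have "\<dots> = (\<Sum>b\<in>UNIV. H a b * T b d)" unfolding GH by simp
  finally have 1: "(\<Sum>b\<in>UNIV. \<Sum>c\<in>UNIV. H a b * (\<Sum>e\<in>UNIV. T b e * G e c) * H c d) = (\<Sum>b\<in>UNIV. H a b * T b d)" .
  have "(\<Sum>b\<in>UNIV. \<Sum>c\<in>UNIV. H a b * (\<Sum>e\<in>UNIV. G b e * S e c) * H c d)
    = (\<Sum>c\<in>UNIV. \<Sum>b\<in>UNIV. \<Sum>e\<in>UNIV. H a b * G b e * (S e c * H c d))"
    unfolding sum_distrib_left sum_distrib_right by (subst sum.swap) (simp add: mult.assoc)
  also have "\<dots> = (\<Sum>c\<in>UNIV. \<Sum>e\<in>UNIV. (\<Sum>b\<in>UNIV. H a b * G b e) * (S e c * H c d))"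
    unfolding sum_distrib_right by (intro sum.cong refl sum.swap)
  also have "\<dots> = (\<Sum>c\<in>UNIV. S a c * H c d)" unfolding HG by simp
  finally have 2: "(\<Sum>b\<in>UNIV. \<Sum>c\<in>UNIV. H a b * (\<Sum>e\<in>UNIV. G b e * S e c) * H c d) = (\<Sum>c\<in>UNIV. S a c * H c d)" .
  show ?thesis unfolding distrib_left distrib_right sum.distrib 1 2 ..
qed

context manifold
begin

text \<open>From \<open>Z(H) = - H Z(G) H\<close>. Being parallel has the shape
  \<open>Z(G) = T G + G S\<close>, with \<open>T\<close> and \<open>S\<close> built from connection
  coefficients, and the conclusion has the same shape for the inverse. It carries parallelism from a
  metric to its inverse tensor and back.\<close>

lemma tv_inverse_matrix_conj:
  fixes G H :: "'k::finite \<Rightarrow> 'k \<Rightarrow> 'm \<Rightarrow> real"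
  assumes G: "\<And>a b. sm p (G a b)" and H: "\<And>a b. sm p (H a b)"
    and HG: "\<And>a c. \<forall>\<^sub>F q in nhds p. (\<Sum>b\<in>UNIV. H a b q * G b c q) = of_bool (a = c)"
    and GH: "\<And>a c. (\<Sum>b\<in>UNIV. G a b p * H b c p) = of_bool (a = c)"
    and Z: "Z \<in> TT p"
    and ZG: "\<And>b c. Z (G b c) = (\<Sum>e\<in>UNIV. T b e * G e c p) + (\<Sum>e\<in>UNIV. G b e p * S e c)"
  shows "Z (H a d) = - (\<Sum>b\<in>UNIV. H a b p * T b d) - (\<Sum>c\<in>UNIV. S a c * H c d p)"
proof -
  have "(\<Sum>c\<in>UNIV. (\<Sum>b\<in>UNIV. Z (H a b) * G b c p) * H c d p)
    = (\<Sum>b\<in>UNIV. Z (H a b) * (\<Sum>c\<in>UNIV. G b c p * H c d p))"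
    unfolding sum_distrib_left sum_distrib_right mult.assoc by (rule sum.swap)
  also have "\<dots> = Z (H a d)" unfolding GH by simp
  finally have "Z (H a d) = - (\<Sum>c\<in>UNIV. \<Sum>b\<in>UNIV. H a b p * Z (G b c) * H c d p)"
    unfolding tv_inverse_matrix[OF G H HG Z] by (simp add: sum_negf sum_distrib_right)
  also have "(\<Sum>c\<in>UNIV. \<Sum>b\<in>UNIV. H a b p * Z (G b c) * H c d p)
     = (\<Sum>b\<in>UNIV. \<Sum>c\<in>UNIV. H a b p * Z (G b c) * H c d p)" by (rule sum.swap)
  also have "\<dots> = (\<Sum>b\<in>UNIV. H a b p * T b d) + (\<Sum>c\<in>UNIV. S a c * H c d p)"
    unfolding ZG by (rule sum_inverse_conj[OF eventually_nhds_x_imp_x[OF HG] GH])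
  finally show ?thesis by simp
qed

text \<open>Given by the property that determines it, so that independence of a frame needs no
  argument; the matrix formula is derived afterwards where smoothness is required.\<close>

definition sharp :: "('m \<Rightarrow> 'm tvec \<Rightarrow> 'm tvec \<Rightarrow> real) \<Rightarrow> 'm \<Rightarrow> 'm covec \<Rightarrow> 'm tvec" where
  "sharp g p \<alpha> = (THE v. v \<in> TT p \<and> (\<forall>w\<in>TT p. g p v w = \<alpha> w))"

text \<open>Applied to a second tangent vector, \<open>flat g p u v\<close> is the metric with lower
  indices that is inverse to the tensor \<open>g\<close>, and it is used as such from
  \<open>metric_flat\<close> on.\<close>

definition flat :: "('m \<Rightarrow> 'm covec \<Rightarrow> 'm covec \<Rightarrow> real) \<Rightarrow> 'm \<Rightarrow> 'm tvec \<Rightarrow> 'm covec" where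
  "flat g p u = (THE \<alpha>. \<alpha> \<in> CT p \<and> (\<forall>\<beta>\<in>CT p. g p \<alpha> \<beta> = \<beta> u))"

end

section \<open>From a nondegenerate tensor with upper indices to a metric\<close>

locale tensor_field = manifold M
  for M :: "('m::{t2_space, second_countable_topology}, 'n::finite) atlas" +
  fixes U :: "'m set" and g :: "'m \<Rightarrow> 'm covec \<Rightarrow> 'm covec \<Rightarrow> real"
  assumes open_U: "open U" and sym_tensor: "sym_tensor M U g" and nondegenerate: "nondegenerate_tensor M U g"
begin

lemma bilinear: "p \<in> U \<Longrightarrow> sym_bilinear_at p g"
  by (rule sym_tensor_at[OF sym_tensor])

lemma tensor_sm:
  assumes p: "p \<in> U" and \<alpha>: "form_near p \<alpha>" and \<beta>: "form_near p \<beta>"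
  shows "sm p (\<lambda>q. g q (\<alpha> q) (\<beta> q))"
proof -
  obtain W where W: "open W" "p \<in> W" "\<forall>q\<in>W. q \<in> U \<and> form_near q \<alpha> \<and> form_near q \<beta>"
    using eventually_conj[OF eventually_nhds_open[OF open_U p, of "\<lambda>q. q \<in> U"] eventually_conj[OF form_near_eventually[OF \<alpha>] form_near_eventually[OF \<beta>]]]
    unfolding eventually_nhds by auto
  have "one_form M W \<alpha>" "one_form M W \<beta>" "W \<subseteq> U" using W(3) by (auto simp: one_form_iff[OF W(1)])
  then have "smooth_fun M W (\<lambda>q. g q (\<alpha> q) (\<beta> q))"
    using sym_tensor W(1) unfolding sym_tensor_def by simp
  then show ?thesis using W(1,2) by (simp add: smooth_fun_iff)
qed

lemma det_components:
  assumes p: "p \<in> U" and E: "frame_near p E"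
  shows "det (\<chi> i j. g p (coframe M E i p) (coframe M E j p)) \<noteq> 0"
proof (rule det_nonzeroI[of "\<lambda>i j. g p (coframe M E i p) (coframe M E j p)"])
  fix c j assume c: "\<And>i. (\<Sum>j\<in>UNIV. g p (coframe M E i p) (coframe M E j p) * c j) = 0"
  note \<theta> = coframe_CT[OF E]
  let ?\<alpha> = "\<lambda>v. \<Sum>j\<in>UNIV. c j * coframe M E j p v"
  have \<alpha>: "?\<alpha> \<in> CT p" by (rule CT_sum_mem[OF \<theta>])
  have "g p ?\<alpha> \<beta> = 0" if \<beta>: "\<beta> \<in> CT p" for \<beta>
  proof -
    have *: "g p ?\<alpha> (coframe M E i p) = 0" for i
    proof -
      have "g p ?\<alpha> (coframe M E i p) = g p (coframe M E i p) ?\<alpha>"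
        by (rule tensor_sym[OF bilinear[OF p] \<alpha> \<theta>])
      also have "\<dots> = (\<Sum>j\<in>UNIV. c j * g p (coframe M E i p) (coframe M E j p))"
        by (rule tensor_sum_right[OF bilinear[OF p] \<theta>]) (rule \<theta>)
      finally show ?thesis using c[of i] by (simp add: mult.commute)
    qed
    have "g p ?\<alpha> \<beta> = g p ?\<alpha> (\<lambda>v. \<Sum>i\<in>UNIV. \<beta> (E i p) * coframe M E i p v)"
      using CT_expand[OF E \<beta>] by (rule arg_cong)
    also have "\<dots> = (\<Sum>i\<in>UNIV. \<beta> (E i p) * g p ?\<alpha> (coframe M E i p))"
      by (rule tensor_sum_right[OF bilinear[OF p] \<alpha>]) (rule \<theta>)
    finally show ?thesis unfolding * by simp
  qed
  then have "?\<alpha> = (\<lambda>v. 0)"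
    using nondegenerate[unfolded nondegenerate_tensor_def, rule_format, OF p \<alpha>] by simp
  from fun_cong[OF this, of "E j p"] show "c j = 0" by (simp add: coframe_frame[OF E])
qed

lemma ex_inverse:
  assumes p: "p \<in> U" and E: "frame_near p E"
  obtains K where "\<forall>a b. sm p (K a b)"
    "\<forall>q a c. q \<in> U \<longrightarrow> frame_near q E \<longrightarrow>
       (\<Sum>b\<in>UNIV. K a b q * g q (coframe M E b q) (coframe M E c q)) = of_bool (a = c)"
    "\<forall>q a c. q \<in> U \<longrightarrow> frame_near q E \<longrightarrow>
       (\<Sum>b\<in>UNIV. g q (coframe M E a q) (coframe M E b q) * K b c q) = of_bool (a = c)"
proof -
  have P: "\<forall>\<^sub>F q in nhds p. q \<in> U \<and> frame_near q E"
    using eventually_nhds_open[OF open_U p, of "\<lambda>q. q \<in> U"] frame_near_eventually[OF E]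
    by (rule eventually_conj) simp
  show ?thesis
  proof (rule ex_smooth_inverse[of p "\<lambda>a b q. g q (coframe M E a q) (coframe M E b q)", OF _ P])
    show "sm p (\<lambda>q. g q (coframe M E a q) (coframe M E b q))" for a b
      by (rule tensor_sm[OF p form_near_coframe[OF E] form_near_coframe[OF E]])
    show "det (\<chi> i j. g q (coframe M E i q) (coframe M E j q)) \<noteq> 0" if "q \<in> U \<and> frame_near q E" for q
      by (rule det_components) (use that in auto)
    fix K :: "'n \<Rightarrow> 'n \<Rightarrow> 'm \<Rightarrow> real"
    assume K: "\<And>a b. sm p (K a b)"
      "\<And>q a c. q \<in> U \<and> frame_near q E \<Longrightarrow> (\<Sum>b\<in>UNIV. K a b q * g q (coframe M E b q) (coframe M E c q)) = of_bool (a = c)"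
      "\<And>q a c. q \<in> U \<and> frame_near q E \<Longrightarrow> (\<Sum>b\<in>UNIV. g q (coframe M E a q) (coframe M E b q) * K b c q) = of_bool (a = c)"
    show thesis by (rule that[of K]) (simp_all add: K)
  qed
qed

lemma flat_eqI:
  assumes p: "p \<in> U" and \<alpha>: "\<alpha> \<in> CT p" and eq: "\<And>\<beta>. \<beta> \<in> CT p \<Longrightarrow> g p \<alpha> \<beta> = \<beta> u"
  shows "flat g p u = \<alpha>"
  unfolding flat_def
proof (rule the_equality)
  show "\<alpha> \<in> CT p \<and> (\<forall>\<beta>\<in>CT p. g p \<alpha> \<beta> = \<beta> u)" using \<alpha> eq by simp
  fix \<alpha>' assume \<alpha>': "\<alpha>' \<in> CT p \<and> (\<forall>\<beta>\<in>CT p. g p \<alpha>' \<beta> = \<beta> u)"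
  let ?\<delta> = "\<lambda>v. 1 * \<alpha>' v + (-1) * \<alpha> v"
  have \<delta>: "?\<delta> \<in> CT p" using \<alpha>' \<alpha> by (intro CT_lincomb) simp_all
  have "g p ?\<delta> \<beta> = 0" if "\<beta> \<in> CT p" for \<beta>
    using tensor_linear[OF bilinear[OF p] conjunct1[OF \<alpha>'] \<alpha> that, of 1 "-1"] \<alpha>' eq[OF that] that by simp
  then have "?\<delta> = (\<lambda>v. 0)"
    using nondegenerate[unfolded nondegenerate_tensor_def, rule_format, OF p \<delta>] by simp
  then show "\<alpha>' = \<alpha>" by (simp add: fun_eq_iff)
qed

lemma
  assumes p: "p \<in> U" and E: "frame_near p E" and u: "u \<in> TT p"
    and K: "\<And>a c. (\<Sum>b\<in>UNIV. K a b * g p (coframe M E b p) (coframe M E c p)) = of_bool (a = c)"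
  shows flat_formula: "flat g p u = (\<lambda>v. \<Sum>a\<in>UNIV. (\<Sum>b\<in>UNIV. coframe M E b p u * K b a) * coframe M E a p v)"
    and flat_formula_apply: "\<beta> \<in> CT p \<Longrightarrow> g p (flat g p u) \<beta> = \<beta> u"
proof -
  note \<theta> = coframe_CT[OF E]
  let ?\<alpha> = "\<lambda>v. \<Sum>a\<in>UNIV. (\<Sum>b\<in>UNIV. coframe M E b p u * K b a) * coframe M E a p v"
  have \<alpha>: "?\<alpha> \<in> CT p" by (rule CT_sum_mem[OF \<theta>])
  have *: "g p ?\<alpha> (coframe M E c p) = coframe M E c p u" for c
  proof -
    have "g p ?\<alpha> (coframe M E c p) = (\<Sum>a\<in>UNIV. (\<Sum>b\<in>UNIV. coframe M E b p u * K b a) * g p (coframe M E a p) (coframe M E c p))"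
      by (rule tensor_sum[OF bilinear[OF p] \<theta>]) (rule \<theta>)
    also have "\<dots> = (\<Sum>b\<in>UNIV. coframe M E b p u * (\<Sum>a\<in>UNIV. K b a * g p (coframe M E a p) (coframe M E c p)))"
      unfolding sum_distrib_left sum_distrib_right mult.assoc by (rule sum.swap)
    finally show ?thesis unfolding K by simp
  qed
  have ap: "g p ?\<alpha> \<beta> = \<beta> u" if \<beta>: "\<beta> \<in> CT p" for \<beta>
  proof -
    have "g p ?\<alpha> \<beta> = g p ?\<alpha> (\<lambda>v. \<Sum>c\<in>UNIV. \<beta> (E c p) * coframe M E c p v)"
      using CT_expand[OF E \<beta>] by (rule arg_cong)
    also have "\<dots> = (\<Sum>c\<in>UNIV. \<beta> (E c p) * g p ?\<alpha> (coframe M E c p))"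
      by (rule tensor_sum_right[OF bilinear[OF p] \<alpha>]) (rule \<theta>)
    also have "\<dots> = (\<Sum>c\<in>UNIV. \<beta> (E c p) * coframe M E c p u)" unfolding * ..
    also have "\<dots> = \<beta> u" by (rule fun_cong[OF CT_expand[OF E \<beta>], symmetric])
    finally show ?thesis .
  qed
  show f: "flat g p u = ?\<alpha>" by (rule flat_eqI[OF p \<alpha> ap])
  show "g p (flat g p u) \<beta> = \<beta> u" if "\<beta> \<in> CT p" unfolding f by (rule ap[OF that])
qed

lemma flat:
  assumes p: "p \<in> U" and u: "u \<in> TT p"
  shows flat_CT: "flat g p u \<in> CT p" and flat_apply: "\<beta> \<in> CT p \<Longrightarrow> g p (flat g p u) \<beta> = \<beta> u"
proof -
  obtain E where E: "frame_near p E" by (rule ex_frame)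
  obtain K where K': "\<forall>a b. sm p (K a b)" "\<forall>q a c. q \<in> U \<longrightarrow> frame_near q E \<longrightarrow>
       (\<Sum>b\<in>UNIV. K a b q * g q (coframe M E b q) (coframe M E c q)) = of_bool (a = c)"
    "\<forall>q a c. q \<in> U \<longrightarrow> frame_near q E \<longrightarrow>
       (\<Sum>b\<in>UNIV. g q (coframe M E a q) (coframe M E b q) * K b c q) = of_bool (a = c)"
    by (rule ex_inverse[OF p E])
  note K = K'[rule_format]
  show "flat g p u \<in> CT p"
    unfolding flat_formula[OF p E u K(2)[OF p E]] by (rule CT_sum_mem[OF coframe_CT[OF E]])
  show "g p (flat g p u) \<beta> = \<beta> u" if "\<beta> \<in> CT p"
    by (rule flat_formula_apply[OF p E u K(2)[OF p E] that])
qed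

text \<open>Both values are the tensor \<open>g\<close> on the covectors \<open>flat g p u\<close>
  and \<open>flat g p v\<close>, in the two orders.\<close>

lemma flat_sym: "p \<in> U \<Longrightarrow> u \<in> TT p \<Longrightarrow> v \<in> TT p \<Longrightarrow> flat g p u v = flat g p v u"
  using flat_apply[of p u "flat g p v"] flat_apply[of p v "flat g p u"]
    tensor_sym[OF bilinear, of p "flat g p u" "flat g p v"] flat_CT by simp

lemma flat_components:
  assumes p: "p \<in> U" and E: "frame_near p E"
    and K: "\<And>a c. (\<Sum>b\<in>UNIV. K a b * g p (coframe M E b p) (coframe M E c p)) = of_bool (a = c)"
  shows "flat g p (E a p) (E b p) = K a b"
proof -
  have "flat g p (E a p) (E b p) = (\<Sum>d\<in>UNIV. (\<Sum>c\<in>UNIV. coframe M E c p (E a p) * K c d) * coframe M E d p (E b p))"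
    by (rule fun_cong[OF flat_formula[OF p E frame_near_TT[OF E] K]])
  then show ?thesis by (simp add: coframe_frame[OF E])
qed

lemma flat_lincomb:
  assumes p: "p \<in> U" and u: "u \<in> TT p" and v: "v \<in> TT p"
  shows "flat g p (\<lambda>f. a * u f + b * v f) = (\<lambda>w. a * flat g p u w + b * flat g p v w)"
proof (rule flat_eqI[OF p])
  show "(\<lambda>w. a * flat g p u w + b * flat g p v w) \<in> CT p"
    by (rule CT_lincomb[OF flat_CT[OF p u] flat_CT[OF p v]])
  fix \<beta> assume \<beta>: "\<beta> \<in> CT p"
  show "g p (\<lambda>w. a * flat g p u w + b * flat g p v w) \<beta> = \<beta> (\<lambda>f. a * u f + b * v f)"
    unfolding tensor_linear[OF bilinear[OF p] flat_CT[OF p u] flat_CT[OF p v] \<beta>] CT_linear[OF \<beta> u v]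
      flat_apply[OF p u \<beta>] flat_apply[OF p v \<beta>] ..
qed

lemma form_near_flat:
  assumes p: "p \<in> U" and X: "vf_near p X"
  shows "form_near p (\<lambda>q. flat g q (X q))"
proof -
  obtain E where E: "frame_near p E" by (rule ex_frame)
  obtain K where K': "\<forall>a b. sm p (K a b)" "\<forall>q a c. q \<in> U \<longrightarrow> frame_near q E \<longrightarrow>
       (\<Sum>b\<in>UNIV. K a b q * g q (coframe M E b q) (coframe M E c q)) = of_bool (a = c)"
    "\<forall>q a c. q \<in> U \<longrightarrow> frame_near q E \<longrightarrow>
       (\<Sum>b\<in>UNIV. g q (coframe M E a q) (coframe M E b q) * K b c q) = of_bool (a = c)"
    by (rule ex_inverse[OF p E])
  note K = K'[rule_format]
  have ev: "\<forall>\<^sub>F q in nhds p. q \<in> U \<and> frame_near q E \<and> vf_near q X"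
    by (rule eventually_conj[OF eventually_nhds_open[OF open_U p] eventually_conj[OF frame_near_eventually[OF E] vf_near_eventually[OF X]]])
  show ?thesis
  proof (rule form_nearI_components[OF E])
    show "\<forall>\<^sub>F q in nhds p. flat g q (X q) \<in> CT q"
      using ev by eventually_elim (simp add: flat_CT vf_near_TT)
    fix a
    have "\<forall>\<^sub>F q in nhds p. (\<Sum>b\<in>UNIV. coframe M E b q (X q) * K b a q) = flat g q (X q) (E a q)"
      using ev
    proof eventually_elim
      case (elim q)
      then have q: "q \<in> U" and Eq: "frame_near q E" and Xq: "X q \<in> TT q" by (simp_all add: vf_near_TT)
      have "flat g q (X q) (E a q) = (\<Sum>d\<in>UNIV. (\<Sum>b\<in>UNIV. coframe M E b q (X q) * K b d q) * coframe M E d q (E a q))"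
        by (rule fun_cong[OF flat_formula[OF q Eq Xq K(2)[OF q Eq]]])
      then show ?case by (simp add: coframe_frame[OF Eq])
    qed
    then show "sm p (\<lambda>q. flat g q (X q) (E a q))"
      by (rule sm_cong) (intro sm_sum sm_mult coframe_sm[OF E X] K(1))
  qed
qed

lemma metric_flat: "metric M U (flat g)"
  unfolding metric_def
proof (intro conjI ballI allI impI)
  fix p assume p: "p \<in> U"
  show "flat g p u v = flat g p v u" if "u \<in> TT p" "v \<in> TT p" for u v
    by (rule flat_sym[OF p that])
  show "flat g p (\<lambda>f. a * u f + b * v f) w = a * flat g p u w + b * flat g p v w"
    if "u \<in> TT p" "v \<in> TT p" for u v w a b
    using flat_lincomb[OF p that] by simp
  show "u = (\<lambda>f. 0)" if u: "u \<in> TT p" and z: "\<forall>v\<in>TT p. flat g p u v = 0" for u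
  proof -
    obtain E where E: "frame_near p E" by (rule ex_frame)
    have "flat g p u = (\<lambda>v. 0)"
      by (rule CT_eqI[OF E flat_CT[OF p u] CT_zero]) (simp add: z frame_near_TT[OF E])
    then have "\<beta> u = 0" if "\<beta> \<in> CT p" for \<beta>
      using flat_apply[OF p u that] tensor_linear[OF bilinear[OF p] CT_zero CT_zero that, of 0 0] by simp
    then have "coframe M E a p u = coframe M E a p (\<lambda>f. 0)" for a
      using coframe_CT[OF E] CT_zero_vec[OF coframe_CT[OF E]] by simp
    then show ?thesis by (rule TT_eqI[OF E u TT_zero])
  qed
next
  fix W X Y assume W: "open W" "W \<subseteq> U" "vector_field M W X" "vector_field M W Y"
  show "smooth_fun M W (\<lambda>p. flat g p (X p) (Y p))"
    unfolding smooth_fun_iff[OF W(1)]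
  proof
    fix p assume p: "p \<in> W"
    show "sm p (\<lambda>p. flat g p (X p) (Y p))"
      by (rule form_near_sm[OF form_near_flat[OF _ vf_nearI[OF W(3,1) p]] vf_nearI[OF W(4,1) p]])
        (use p W(2) in auto)
  qed
qed

end

section \<open>From a metric to its inverse tensor\<close>

locale metric_field = manifold M
  for M :: "('m::{t2_space, second_countable_topology}, 'n::finite) atlas" +
  fixes U :: "'m set" and g :: "'m \<Rightarrow> 'm tvec \<Rightarrow> 'm tvec \<Rightarrow> real"
  assumes open_U: "open U" and metric: "metric M U g"
begin

context
  fixes p assumes p: "p \<in> U"
begin

lemma metric_sym: "u \<in> TT p \<Longrightarrow> v \<in> TT p \<Longrightarrow> g p u v = g p v u"
  and metric_linear: "u \<in> TT p \<Longrightarrow> v \<in> TT p \<Longrightarrow> w \<in> TT p \<Longrightarrow>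
    g p (\<lambda>f. a * u f + b * v f) w = a * g p u w + b * g p v w"
  and metric_nondegenerate: "u \<in> TT p \<Longrightarrow> (\<And>v. v \<in> TT p \<Longrightarrow> g p u v = 0) \<Longrightarrow> u = (\<lambda>f. 0)"
  using bspec[OF conjunct1[OF metric[unfolded metric_def]] p] by simp_all

lemma metric_sum:
  assumes w: "w \<in> TT p"
  shows "(\<And>i. i \<in> I \<Longrightarrow> v i \<in> TT p) \<Longrightarrow> g p (\<lambda>f. \<Sum>i\<in>I. c i * v i f) w = (\<Sum>i\<in>I. c i * g p (v i) w)"
proof (induction I rule: infinite_finite_induct)
  case (insert i I)
  have "g p (\<lambda>f. c i * v i f + 1 * (\<Sum>i\<in>I. c i * v i f)) w
    = c i * g p (v i) w + 1 * g p (\<lambda>f. \<Sum>i\<in>I. c i * v i f) w"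
    by (rule metric_linear[OF _ TT_sum w]) (use insert.prems in simp_all)
  with insert show ?case by simp
qed (use metric_linear[OF TT_zero TT_zero w, of 0 0] in simp_all)

lemma metric_expand:
  assumes E: "frame_near p E" and v: "v \<in> TT p" and w: "w \<in> TT p"
  shows "g p v w = (\<Sum>a\<in>UNIV. coframe M E a p v * g p (E a p) w)"
proof -
  have "g p v w = g p (\<lambda>f. \<Sum>a\<in>UNIV. coframe M E a p v * E a p f) w"
    using coframe_expand[OF E v] by (rule arg_cong)
  also have "\<dots> = (\<Sum>a\<in>UNIV. coframe M E a p v * g p (E a p) w)"
    by (rule metric_sum[OF w]) (rule frame_near_TT[OF E])
  finally show ?thesis .
qed

lemma metric_sm:
  assumes X: "vf_near p X" and Y: "vf_near p Y"
  shows "sm p (\<lambda>q. g q (X q) (Y q))"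
proof -
  obtain W where W: "open W" "p \<in> W" "\<forall>q\<in>W. q \<in> U \<and> vf_near q X \<and> vf_near q Y"
    using eventually_conj[OF eventually_nhds_open[OF open_U p, of "\<lambda>q. q \<in> U"] eventually_conj[OF vf_near_eventually[OF X] vf_near_eventually[OF Y]]]
    unfolding eventually_nhds by auto
  have "vector_field M W X" "vector_field M W Y" "W \<subseteq> U" using W(3) by (auto simp: vector_field_iff[OF W(1)])
  then have "smooth_fun M W (\<lambda>q. g q (X q) (Y q))"
    using metric W(1) unfolding metric_def by simp
  then show ?thesis using W(1,2) by (simp add: smooth_fun_iff)
qed

lemma metric_det_components:
  assumes E: "frame_near p E"
  shows "det (\<chi> i j. g p (E i p) (E j p)) \<noteq> 0"
proof (rule det_nonzeroI[of "\<lambda>i j. g p (E i p) (E j p)"])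
  fix c j assume c: "\<And>i. (\<Sum>j\<in>UNIV. g p (E i p) (E j p) * c j) = 0"
  note T = frame_near_TT[OF E]
  let ?v = "\<lambda>f. \<Sum>j\<in>UNIV. c j * E j p f"
  have v: "?v \<in> TT p" by (rule TT_sum[OF T])
  have *: "g p (E i p) ?v = 0" for i
  proof -
    have "g p (E i p) ?v = g p ?v (E i p)" by (rule metric_sym[OF T v])
    also have "\<dots> = (\<Sum>j\<in>UNIV. c j * g p (E j p) (E i p))" by (rule metric_sum[OF T]) (rule T)
    finally show ?thesis using c[of i] metric_sym[OF T[of i] T] by (simp add: mult.commute)
  qed
  have "?v = (\<lambda>f. 0)"
  proof (rule metric_nondegenerate[OF v])
    fix w assume w: "w \<in> TT p"
    have "g p ?v w = g p w ?v" by (rule metric_sym[OF v w])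
    also have "\<dots> = (\<Sum>i\<in>UNIV. coframe M E i p w * g p (E i p) ?v)" by (rule metric_expand[OF E w v])
    finally show "g p ?v w = 0" unfolding * by simp
  qed
  from coframe_eqI[OF E this[symmetric], of j] show "c j = 0"
    using CT_zero_vec[OF coframe_CT[OF E]] by simp
qed

lemma sharp_eqI:
  assumes v: "v \<in> TT p" and eq: "\<And>w. w \<in> TT p \<Longrightarrow> g p v w = \<alpha> w"
  shows "sharp g p \<alpha> = v"
  unfolding sharp_def
proof (rule the_equality)
  show "v \<in> TT p \<and> (\<forall>w\<in>TT p. g p v w = \<alpha> w)" using v eq by simp
  fix v' assume v': "v' \<in> TT p \<and> (\<forall>w\<in>TT p. g p v' w = \<alpha> w)"
  let ?\<delta> = "\<lambda>f. 1 * v' f + (-1) * v f"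
  have \<delta>: "?\<delta> \<in> TT p" using v' v by (intro TT_lincomb) simp_all
  have "?\<delta> = (\<lambda>f. 0)"
  proof (rule metric_nondegenerate[OF \<delta>])
    fix w assume "w \<in> TT p"
    then show "g p ?\<delta> w = 0"
      using metric_linear[OF conjunct1[OF v'] v, of w 1 "-1"] v' eq by simp
  qed
  then show "v' = v" by (simp add: fun_eq_iff)
qed

lemma
  assumes E: "frame_near p E" and \<alpha>: "\<alpha> \<in> CT p"
    and H: "\<And>a c. (\<Sum>b\<in>UNIV. H a b * g p (E b p) (E c p)) = of_bool (a = c)"
  shows sharp_formula: "sharp g p \<alpha> = (\<lambda>f. \<Sum>a\<in>UNIV. (\<Sum>b\<in>UNIV. \<alpha> (E b p) * H b a) * E a p f)"
    and sharp_formula_apply: "w \<in> TT p \<Longrightarrow> g p (sharp g p \<alpha>) w = \<alpha> w"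
proof -
  note T = frame_near_TT[OF E]
  let ?v = "\<lambda>f. \<Sum>a\<in>UNIV. (\<Sum>b\<in>UNIV. \<alpha> (E b p) * H b a) * E a p f"
  have v: "?v \<in> TT p" by (rule TT_sum[OF T])
  have *: "g p (E c p) ?v = \<alpha> (E c p)" for c
  proof -
    have "g p (E c p) ?v = g p ?v (E c p)" by (rule metric_sym[OF T v])
    also have "\<dots> = (\<Sum>a\<in>UNIV. (\<Sum>b\<in>UNIV. \<alpha> (E b p) * H b a) * g p (E a p) (E c p))"
      by (rule metric_sum[OF T]) (rule T)
    also have "\<dots> = (\<Sum>b\<in>UNIV. \<alpha> (E b p) * (\<Sum>a\<in>UNIV. H b a * g p (E a p) (E c p)))"
      unfolding sum_distrib_left sum_distrib_right mult.assoc by (rule sum.swap)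
    finally show ?thesis unfolding H by simp
  qed
  have ap: "g p ?v w = \<alpha> w" if w: "w \<in> TT p" for w
  proof -
    have "g p ?v w = g p w ?v" by (rule metric_sym[OF v w])
    also have "\<dots> = (\<Sum>i\<in>UNIV. coframe M E i p w * g p (E i p) ?v)" by (rule metric_expand[OF E w v])
    also have "\<dots> = (\<Sum>i\<in>UNIV. \<alpha> (E i p) * coframe M E i p w)" unfolding * by (simp add: mult.commute)
    also have "\<dots> = \<alpha> w" by (rule fun_cong[OF CT_expand[OF E \<alpha>], symmetric])
    finally show ?thesis .
  qed
  show f: "sharp g p \<alpha> = ?v" by (rule sharp_eqI[OF v ap])
  show "g p (sharp g p \<alpha>) w = \<alpha> w" if "w \<in> TT p" unfolding f by (rule ap[OF that])
qed

end

lemma metric_ex_inverse: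
  assumes p: "p \<in> U" and E: "frame_near p E"
  obtains H where "\<forall>a b. sm p (H a b)"
    "\<forall>q a c. q \<in> U \<longrightarrow> frame_near q E \<longrightarrow> (\<Sum>b\<in>UNIV. H a b q * g q (E b q) (E c q)) = of_bool (a = c)"
    "\<forall>q a c. q \<in> U \<longrightarrow> frame_near q E \<longrightarrow> (\<Sum>b\<in>UNIV. g q (E a q) (E b q) * H b c q) = of_bool (a = c)"
proof -
  have P: "\<forall>\<^sub>F q in nhds p. q \<in> U \<and> frame_near q E"
    using eventually_nhds_open[OF open_U p, of "\<lambda>q. q \<in> U"] frame_near_eventually[OF E]
    by (rule eventually_conj) simp
  show ?thesis
  proof (rule ex_smooth_inverse[of p "\<lambda>a b q. g q (E a q) (E b q)", OF _ P])
    show "sm p (\<lambda>q. g q (E a q) (E b q))" for a b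
      by (rule metric_sm[OF p frame_near_vf[OF E] frame_near_vf[OF E]])
    show "det (\<chi> i j. g q (E i q) (E j q)) \<noteq> 0" if "q \<in> U \<and> frame_near q E" for q
      by (rule metric_det_components) (use that in auto)
    fix H :: "'n \<Rightarrow> 'n \<Rightarrow> 'm \<Rightarrow> real"
    assume H: "\<And>a b. sm p (H a b)"
      "\<And>q a c. q \<in> U \<and> frame_near q E \<Longrightarrow> (\<Sum>b\<in>UNIV. H a b q * g q (E b q) (E c q)) = of_bool (a = c)"
      "\<And>q a c. q \<in> U \<and> frame_near q E \<Longrightarrow> (\<Sum>b\<in>UNIV. g q (E a q) (E b q) * H b c q) = of_bool (a = c)"
    show thesis by (rule that[of H]) (simp_all add: H)
  qed
qed

lemma sharp:
  assumes p: "p \<in> U" and \<alpha>: "\<alpha> \<in> CT p"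
  shows sharp_TT: "sharp g p \<alpha> \<in> TT p" and sharp_apply: "w \<in> TT p \<Longrightarrow> g p (sharp g p \<alpha>) w = \<alpha> w"
proof -
  obtain E where E: "frame_near p E" by (rule ex_frame)
  obtain H where H': "\<forall>a b. sm p (H a b)" "\<forall>q a c. q \<in> U \<longrightarrow> frame_near q E \<longrightarrow> (\<Sum>b\<in>UNIV. H a b q * g q (E b q) (E c q)) = of_bool (a = c)"
    "\<forall>q a c. q \<in> U \<longrightarrow> frame_near q E \<longrightarrow> (\<Sum>b\<in>UNIV. g q (E a q) (E b q) * H b c q) = of_bool (a = c)"
    by (rule metric_ex_inverse[OF p E])
  note H = H'[rule_format]
  show "sharp g p \<alpha> \<in> TT p"
    unfolding sharp_formula[OF p E \<alpha> H(2)[OF p E]] by (rule TT_sum[OF frame_near_TT[OF E]])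
  show "g p (sharp g p \<alpha>) w = \<alpha> w" if "w \<in> TT p"
    by (rule sharp_formula_apply[OF p E \<alpha> H(2)[OF p E] that])
qed

text \<open>By the property of \<open>sharp\<close> this is \<open>g\<close> evaluated on the
  vectors dual to \<open>\<alpha>\<close> and \<open>\<beta>\<close>, which is the source of its
  symmetry.\<close>

definition inverse_metric :: "'m \<Rightarrow> 'm covec \<Rightarrow> 'm covec \<Rightarrow> real" where
  "inverse_metric p \<alpha> \<beta> = \<beta> (sharp g p \<alpha>)"

lemma vf_near_sharp:
  assumes p: "p \<in> U" and \<alpha>: "form_near p \<alpha>"
  shows "vf_near p (\<lambda>q. sharp g q (\<alpha> q))"
proof -
  obtain E where E: "frame_near p E" by (rule ex_frame)
  obtain H where H': "\<forall>a b. sm p (H a b)" "\<forall>q a c. q \<in> U \<longrightarrow> frame_near q E \<longrightarrow> (\<Sum>b\<in>UNIV. H a b q * g q (E b q) (E c q)) = of_bool (a = c)"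
    "\<forall>q a c. q \<in> U \<longrightarrow> frame_near q E \<longrightarrow> (\<Sum>b\<in>UNIV. g q (E a q) (E b q) * H b c q) = of_bool (a = c)"
    by (rule metric_ex_inverse[OF p E])
  note H = H'[rule_format]
  have ev: "\<forall>\<^sub>F q in nhds p. q \<in> U \<and> frame_near q E \<and> form_near q \<alpha>"
    by (rule eventually_conj[OF eventually_nhds_open[OF open_U p] eventually_conj[OF frame_near_eventually[OF E] form_near_eventually[OF \<alpha>]]])
  show ?thesis
  proof (rule vf_nearI_components[OF E])
    show "\<forall>\<^sub>F q in nhds p. sharp g q (\<alpha> q) \<in> TT q"
      using ev by eventually_elim (simp add: sharp_TT form_near_CT)
    fix a
    have "\<forall>\<^sub>F q in nhds p. (\<Sum>b\<in>UNIV. \<alpha> q (E b q) * H b a q) = coframe M E a q (sharp g q (\<alpha> q))"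
      using ev
    proof eventually_elim
      case (elim q)
      then have q: "q \<in> U" and Eq: "frame_near q E" and \<alpha>q: "\<alpha> q \<in> CT q" by (simp_all add: form_near_CT)
      show ?case
        unfolding sharp_formula[OF q Eq \<alpha>q H(2)[OF q Eq]] coframe_lincomb[OF Eq] ..
    qed
    then show "sm p (\<lambda>q. coframe M E a q (sharp g q (\<alpha> q)))"
      by (rule sm_cong) (intro sm_sum sm_mult form_near_sm[OF \<alpha> frame_near_vf[OF E]] H(1))
  qed
qed

lemma sharp_lincomb:
  assumes p: "p \<in> U" and \<alpha>: "\<alpha> \<in> CT p" and \<beta>: "\<beta> \<in> CT p"
  shows "sharp g p (\<lambda>v. a * \<alpha> v + b * \<beta> v) = (\<lambda>f. a * sharp g p \<alpha> f + b * sharp g p \<beta> f)"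
proof (rule sharp_eqI[OF p])
  show "(\<lambda>f. a * sharp g p \<alpha> f + b * sharp g p \<beta> f) \<in> TT p"
    by (rule TT_lincomb[OF sharp_TT[OF p \<alpha>] sharp_TT[OF p \<beta>]])
  fix w assume w: "w \<in> TT p"
  show "g p (\<lambda>f. a * sharp g p \<alpha> f + b * sharp g p \<beta> f) w = a * \<alpha> w + b * \<beta> w"
    unfolding metric_linear[OF p sharp_TT[OF p \<alpha>] sharp_TT[OF p \<beta>] w]
      sharp_apply[OF p \<alpha> w] sharp_apply[OF p \<beta> w] ..
qed

lemma tensor_field_inverse_metric: "tensor_field M U inverse_metric"
proof unfold_locales
  show "sym_tensor M U inverse_metric"
    unfolding sym_tensor_def
  proof (intro conjI ballI allI impI)
    fix p \<alpha> \<beta> assume p: "p \<in> U" and \<alpha>: "\<alpha> \<in> CT p" and \<beta>: "\<beta> \<in> CT p"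
    show "inverse_metric p \<alpha> \<beta> = inverse_metric p \<beta> \<alpha>"
      using sharp_apply[OF p \<alpha> sharp_TT[OF p \<beta>]] sharp_apply[OF p \<beta> sharp_TT[OF p \<alpha>]]
        metric_sym[OF p sharp_TT[OF p \<alpha>] sharp_TT[OF p \<beta>]] by (simp add: inverse_metric_def)
    show "inverse_metric p (\<lambda>v. a * \<alpha> v + b * \<beta> v) \<gamma> = a * inverse_metric p \<alpha> \<gamma> + b * inverse_metric p \<beta> \<gamma>"
      if "\<gamma> \<in> CT p" for a b \<gamma>
      unfolding inverse_metric_def sharp_lincomb[OF p \<alpha> \<beta>]
        CT_linear[OF that sharp_TT[OF p \<alpha>] sharp_TT[OF p \<beta>]] ..
  next
    fix W \<alpha> \<beta> assume W: "open W" "W \<subseteq> U" "one_form M W \<alpha>" "one_form M W \<beta>"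
    show "smooth_fun M W (\<lambda>p. inverse_metric p (\<alpha> p) (\<beta> p))"
      unfolding smooth_fun_iff[OF W(1)] inverse_metric_def
    proof
      fix p assume p: "p \<in> W"
      show "sm p (\<lambda>p. \<beta> p (sharp g p (\<alpha> p)))"
        by (rule form_near_sm[OF form_nearI[OF W(4,1) p] vf_near_sharp[OF _ form_nearI[OF W(3,1) p]]])
          (use p W(2) in auto)
    qed
  qed
  show "nondegenerate_tensor M U inverse_metric"
    unfolding nondegenerate_tensor_def
  proof (intro ballI impI)
    fix p \<alpha> assume p: "p \<in> U" and \<alpha>: "\<alpha> \<in> CT p" and z: "\<forall>\<beta>\<in>CT p. inverse_metric p \<alpha> \<beta> = 0"
    obtain E where E: "frame_near p E" by (rule ex_frame)
    have "sharp g p \<alpha> = (\<lambda>f. 0)"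
      by (rule TT_eqI[OF E sharp_TT[OF p \<alpha>] TT_zero])
        (use z coframe_CT[OF E] CT_zero_vec[OF coframe_CT[OF E]] in \<open>simp add: inverse_metric_def\<close>)
    then have "\<alpha> (E a p) = 0" for a
      using sharp_apply[OF p \<alpha> frame_near_TT[OF E]] metric_linear[OF p TT_zero TT_zero frame_near_TT[OF E], of 0 0] by simp
    then show "\<alpha> = (\<lambda>v. 0)" by (intro CT_eqI[OF E \<alpha> CT_zero])
  qed
qed (rule open_U)

lemma inverse_metric_components:
  assumes p: "p \<in> U" and E: "frame_near p E"
    and H: "\<And>a c. (\<Sum>b\<in>UNIV. H a b * g p (E b p) (E c p)) = of_bool (a = c)"
  shows "inverse_metric p (coframe M E a p) (coframe M E b p) = H a b"
  unfolding inverse_metric_def sharp_formula[OF p E coframe_CT[OF E] H] coframe_lincomb[OF E]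
  by (simp add: coframe_frame[OF E])

end


section \<open>Closed forms and projective changes\<close>

text \<open>Index calculation for metric compatibility: \<open>x\<close> and \<open>y\<close> are
  the components of two fields, \<open>K\<close> is the metric and \<open>\<Gamma>\<close> holds the
  connection coefficients. The derivative of \<open>K\<close> splits into the connection terms of
  the first field and those of the second.\<close>

lemma sum_leibniz_bilinear:
  fixes x y :: "'k::finite \<Rightarrow> real" and K \<Gamma> :: "'k \<Rightarrow> 'k \<Rightarrow> real"
  shows "(\<Sum>a\<in>UNIV. \<Sum>b\<in>UNIV. x b * y a * ((\<Sum>c\<in>UNIV. K b c * \<Gamma> c a) + (\<Sum>c\<in>UNIV. \<Gamma> c b * K c a)))
    = (\<Sum>a\<in>UNIV. (\<Sum>b\<in>UNIV. (\<Sum>c\<in>UNIV. x c * \<Gamma> b c) * K b a) * y a)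
      + (\<Sum>a\<in>UNIV. (\<Sum>b\<in>UNIV. x b * K b a) * (\<Sum>c\<in>UNIV. y c * \<Gamma> a c))"
proof -
  have "(\<Sum>a\<in>UNIV. \<Sum>b\<in>UNIV. x b * y a * (\<Sum>c\<in>UNIV. \<Gamma> c b * K c a))
    = (\<Sum>a\<in>UNIV. \<Sum>b\<in>UNIV. \<Sum>c\<in>UNIV. x b * y a * (\<Gamma> c b * K c a))"
    by (simp add: sum_distrib_left)
  also have "\<dots> = (\<Sum>a\<in>UNIV. \<Sum>c\<in>UNIV. \<Sum>b\<in>UNIV. x b * y a * (\<Gamma> c b * K c a))"
    by (rule sum.cong[OF refl]) (rule sum.swap)
  also have "\<dots> = (\<Sum>a\<in>UNIV. (\<Sum>b\<in>UNIV. (\<Sum>c\<in>UNIV. x c * \<Gamma> b c) * K b a) * y a)"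
    by (simp add: sum_distrib_left sum_distrib_right mult_ac)
  finally have 1: "(\<Sum>a\<in>UNIV. \<Sum>b\<in>UNIV. x b * y a * (\<Sum>c\<in>UNIV. \<Gamma> c b * K c a))
    = (\<Sum>a\<in>UNIV. (\<Sum>b\<in>UNIV. (\<Sum>c\<in>UNIV. x c * \<Gamma> b c) * K b a) * y a)" .
  have "(\<Sum>a\<in>UNIV. \<Sum>b\<in>UNIV. x b * y a * (\<Sum>c\<in>UNIV. K b c * \<Gamma> c a))
    = (\<Sum>a\<in>UNIV. \<Sum>b\<in>UNIV. \<Sum>c\<in>UNIV. x b * y a * (K b c * \<Gamma> c a))"
    by (simp add: sum_distrib_left)
  also have "\<dots> = (\<Sum>a\<in>UNIV. \<Sum>c\<in>UNIV. \<Sum>b\<in>UNIV. x b * y a * (K b c * \<Gamma> c a))"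
    by (rule sum.cong[OF refl]) (rule sum.swap)
  also have "\<dots> = (\<Sum>c\<in>UNIV. \<Sum>a\<in>UNIV. \<Sum>b\<in>UNIV. x b * y a * (K b c * \<Gamma> c a))"
    by (rule sum.swap)
  also have "\<dots> = (\<Sum>a\<in>UNIV. (\<Sum>b\<in>UNIV. x b * K b a) * (\<Sum>c\<in>UNIV. y c * \<Gamma> a c))"
    by (simp add: sum_product mult_ac sum_distrib_left sum_distrib_right)
  finally show ?thesis by (simp add: distrib_left sum.distrib 1)
qed

section \<open>Closed forms and the Poincare lemma in charts\<close>

context manifold
begin

lemma closed_formI:
  assumes "open U" "\<And>p. p \<in> U \<Longrightarrow> form_near p A"
    "\<And>p X Y. p \<in> U \<Longrightarrow> vf_near p X \<Longrightarrow> vf_near p Y \<Longrightarrow> ext_deriv M A X Y p = 0"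
  shows "closed_form M U A"
  unfolding closed_form_def
proof (intro conjI allI impI ballI)
  show "one_form M U A" using assms(2) by (simp add: one_form_iff[OF assms(1)])
  fix W X Y p assume W: "open W" "W \<subseteq> U" "vector_field M W X" "vector_field M W Y" and p: "p \<in> W"
  show "ext_deriv M A X Y p = 0"
    by (rule assms(3)[OF _ vf_nearI[OF W(3,1) p] vf_nearI[OF W(4,1) p]]) (use W(2) p in auto)
qed

text \<open>Coordinate fields have constant derivatives on coordinate functions, so their bracket
  annihilates these functions, and a tangent vector is determined by its values on them.\<close>

lemma coord_vec_commute:
  assumes Vx: "(V, x) \<in> M" and p: "p \<in> V"
  shows "lie_bracket M (coord_vec V x i) (coord_vec V x j) p = (\<lambda>f. 0)"
proof (rule tangent_eqI_coords[OF Vx p _ TT_zero])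
  note v = frame_near_vf[OF frame_near_chart[OF Vx p]]
  show "lie_bracket M (coord_vec V x i) (coord_vec V x j) p \<in> TT p"
    by (rule vf_near_TT[OF vf_near_lie_bracket[OF v v]])
  fix k
  have "coord_vec V x i p (\<lambda>q. coord_vec V x j q (\<lambda>q. x q $ k)) = 0" for i j
  proof -
    have "coord_vec V x i p (\<lambda>q. coord_vec V x j q (\<lambda>q. x q $ k)) = coord_vec V x i p (\<lambda>q. of_bool (j = k))"
      by (rule tv_cong[OF coord_vec_TT[OF Vx p]], rule eventually_nhds_open[OF chart_open[OF Vx] p])
        (rule coord_vec_coordinate[OF Vx])
    then show ?thesis using tv_const[OF coord_vec_TT[OF Vx p]] by simp
  qed
  then show "lie_bracket M (coord_vec V x i) (coord_vec V x j) p (\<lambda>q. x q $ k) = 0"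
    unfolding lie_bracket_apply[OF sm_coordinate[OF Vx p]] by simp
qed

text \<open>Take for \<open>B\<close> the preimage of a small ball in a chart. Coordinate fields
  commute, so closedness tested on them says that the mixed partial derivatives of the coefficients
  agree, and the Euclidean primitive is pulled back.\<close>

lemma ex_nbhd_closed_forms_are_gradients:
  assumes U: "open U" "p \<in> U"
  obtains B where "open B" "p \<in> B" "B \<subseteq> U" "closed_forms_are_gradients M B"
proof -
  obtain V x where Vx: "(V, x) \<in> M" and p: "p \<in> V" by (rule ex_chart)
  have "x p \<in> x ` (U \<inter> V)" using U p by blast
  then obtain r where r: "r > 0" "ball (x p) r \<subseteq> x ` (U \<inter> V)"
    using chart_open_image[OF Vx U(1)] open_contains_ball by blast
  define B where "B = {q \<in> V. x q \<in> ball (x p) r}"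
  have B: "open B" unfolding B_def by (rule chart_open_preimage[OF Vx open_ball])
  have pB: "p \<in> B" using p r(1) by (simp add: B_def)
  have BV: "B \<subseteq> V" by (auto simp: B_def)
  have BU: "B \<subseteq> U"
  proof
    fix q assume "q \<in> B"
    then have q: "q \<in> V" "x q \<in> ball (x p) r" by (simp_all add: B_def)
    then obtain q' where "q' \<in> U" "q' \<in> V" "x q = x q'" using r(2) by blast
    then show "q \<in> U" using chart_inv[OF Vx] q(1) by metis
  qed
  have ball: "\<exists>q\<in>B. z = x q" if "z \<in> ball (x p) r" for z
    using r(2) that by (auto simp: B_def)
  have "\<exists>\<phi>. smooth_fun M B \<phi> \<and> (\<forall>q\<in>B. A q = differential M \<phi> q)" if A: "closed_form M B A" for A
  proof -
    have A1: "form_near q A" if "q \<in> B" for q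
      using A that by (simp add: closed_form_def one_form_iff[OF B])
    note E = frame_near_chart[OF Vx]
    \<comment> \<open>The coefficients of \<open>A\<close> in the coordinate coframe, transported to
      the ball.\<close>
    define u where "u i z = A (inv_into V x z) (coord_vec V x i (inv_into V x z))" for i z
    have Asm: "sm q (\<lambda>q. A q (coord_vec V x i q))" if "q \<in> B" for q i
      using form_near_sm[OF A1[OF that] frame_near_vf[OF E]] that BV by blast
    have pu: "partial_deriv i (u j) (x q) = coord_vec V x i q (\<lambda>q. A q (coord_vec V x j q))" if "q \<in> B" for i j q
      unfolding u_def[abs_def] using Asm[OF that] by (simp add: coord_vec_def[of V x i])
    have u_smooth: "smooth_on (ball (x p) r) (u i)" for i
    proof (rule smooth_on_local)
      fix z assume "z \<in> ball (x p) r"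
      then obtain q where q: "q \<in> B" "z = x q" using ball by blast
      show "\<exists>T. open T \<and> z \<in> T \<and> smooth_on T (u i)"
        using Asm[OF q(1), of i] smooth_near_chart[OF Vx, of q "\<lambda>q. A q (coord_vec V x i q)"] q BV
        unfolding u_def[abs_def] by auto
    qed
    have u_closed: "partial_deriv i (u j) z = partial_deriv j (u i) z" if "z \<in> ball (x p) r" for i j z
    proof -
      obtain q where q: "q \<in> B" "z = x q" using ball[OF \<open>z \<in> ball (x p) r\<close>] by blast
      have qV: "q \<in> V" using q BV by blast
      have vf: "vector_field M B (coord_vec V x i)" for i
        using frame_subset[OF frame_chart[OF Vx] BV] by (simp add: frame_def)
      have "ext_deriv M A (coord_vec V x i) (coord_vec V x j) q = 0"
        using A[unfolded closed_form_def] vf B q(1) by simp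
      then show ?thesis
        unfolding ext_deriv_def coord_vec_commute[OF Vx qV] CT_zero_vec[OF form_near_CT[OF A1[OF q(1)]]]
          q(2) pu[OF q(1)] by simp
    qed
    define \<phi>0 where "\<phi>0 = (\<lambda>z. \<Sum>i\<in>UNIV. (z $ i + - x p $ i) * ray_mean (x p) 0 (u i) z)"
    have \<phi>0: "smooth_on (ball (x p) r) \<phi>0" "z \<in> ball (x p) r \<Longrightarrow> partial_deriv j \<phi>0 z = u j z" for z j
      unfolding \<phi>0_def using poincare_ball[OF u_smooth u_closed] by blast+
    define \<phi> where "\<phi> q = \<phi>0 (x q)" for q
    have "smooth_fun M B \<phi>"
      unfolding smooth_fun_iff[OF B] \<phi>_def
    proof
      fix q assume q: "q \<in> B"
      show "sm q (\<lambda>q. \<phi>0 (x q))"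
        by (rule sm_chart_pullback[OF Vx _ open_ball _ \<phi>0(1)]) (use q in \<open>auto simp: B_def\<close>)
    qed
    moreover have "A q = differential M \<phi> q" if q: "q \<in> B" for q
    proof (rule CT_eqI[OF E form_near_CT[OF A1[OF q]]])
      show qV: "q \<in> V" using q BV by blast
      show "differential M \<phi> q \<in> CT q"
        by (rule CT_I) (simp_all add: differential_def TT_lincomb)
      fix j
      have qb: "x q \<in> ball (x p) r" using q by (simp add: B_def)
      have "coord_vec V x j q \<phi> = partial_deriv j (\<lambda>z. \<phi> (inv_into V x z)) (x q)"
        using \<open>smooth_fun M B \<phi>\<close> q by (simp add: coord_vec_def smooth_fun_iff[OF B])
      also have "\<dots> = partial_deriv j \<phi>0 (x q)"
      proof (rule partial_deriv_cong[OF open_ball qb])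
        fix z assume "z \<in> ball (x p) r"
        then obtain q' where "q' \<in> B" "z = x q'" using ball by blast
        then show "\<phi> (inv_into V x z) = \<phi>0 z" using BV chart_inv[OF Vx] by (auto simp: \<phi>_def)
      qed
      also have "\<dots> = u j (x q)" by (rule \<phi>0(2)[OF qb])
      also have "\<dots> = A q (coord_vec V x j q)" unfolding u_def chart_inv[OF Vx qV] ..
      finally show "A q (coord_vec V x j q) = differential M \<phi> q (coord_vec V x j q)"
        by (simp add: differential_def coord_vec_TT[OF Vx qV])
    qed
    ultimately show ?thesis by blast
  qed
  then have "closed_forms_are_gradients M B" unfolding closed_forms_are_gradients_def by simp
  then show ?thesis by (rule that[OF B pB BU])
qed


section \<open>Projective changes\<close>

lemma form_near_lincomb:
  assumes A: "form_near p A" and B: "form_near p B"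
  shows "form_near p (\<lambda>q v. a * A q v + b * B q v)"
proof -
  obtain E where E: "frame_near p E" by (rule ex_frame)
  show ?thesis
  proof (rule form_nearI_components[OF E])
    show "\<forall>\<^sub>F q in nhds p. (\<lambda>v. a * A q v + b * B q v) \<in> CT q"
      using eventually_conj[OF form_near_eventually[OF A] form_near_eventually[OF B]]
      by eventually_elim (simp add: CT_lincomb form_near_CT)
    show "sm p (\<lambda>q. a * A q (E c q) + b * B q (E c q))" for c
      by (intro sm_add sm_cmult form_near_sm[OF A frame_near_vf[OF E]] form_near_sm[OF B frame_near_vf[OF E]])
  qed
qed

text \<open>Keeps hold of the one-form that \<open>projectively_equivalent\<close> hides under an
  existential quantifier, and speaks of germs in place of open subsets.\<close>

definition projective_change :: "'m set \<Rightarrow> 'm conn \<Rightarrow> 'm conn \<Rightarrow> 'm form \<Rightarrow> bool" where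
  "projective_change U D' D A \<longleftrightarrow> (\<forall>p\<in>U. form_near p A \<and> (\<forall>X Y. vf_near p X \<longrightarrow> vf_near p Y \<longrightarrow>
     D' X Y p = (\<lambda>f. D X Y p f + A p (X p) * Y p f + A p (Y p) * X p f)))"

lemma projectively_equivalent_iff:
  assumes U: "open U"
  shows "projectively_equivalent M U D' D \<longleftrightarrow> (\<exists>A. projective_change U D' D A)"
proof -
  have "(one_form M U A \<and>
        (\<forall>W X Y. open W \<longrightarrow> W \<subseteq> U \<longrightarrow> vector_field M W X \<longrightarrow> vector_field M W Y \<longrightarrow>
           (\<forall>p\<in>W. D' X Y p = (\<lambda>f. D X Y p f + A p (X p) * Y p f + A p (Y p) * X p f))))
     \<longleftrightarrow> projective_change U D' D A" for A
  proof
    assume *: "one_form M U A \<and>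
        (\<forall>W X Y. open W \<longrightarrow> W \<subseteq> U \<longrightarrow> vector_field M W X \<longrightarrow> vector_field M W Y \<longrightarrow>
           (\<forall>p\<in>W. D' X Y p = (\<lambda>f. D X Y p f + A p (X p) * Y p f + A p (Y p) * X p f)))"
    show "projective_change U D' D A"
      unfolding projective_change_def
    proof (intro ballI conjI allI impI)
      fix p X Y assume p: "p \<in> U"
      show "form_near p A" using * p by (simp add: one_form_iff[OF U])
      assume X: "vf_near p X" and Y: "vf_near p Y"
      have "\<forall>\<^sub>F q in nhds p. q \<in> U \<and> vf_near q X \<and> vf_near q Y"
        by (rule eventually_conj[OF eventually_nhds_open[OF U p] eventually_conj[OF vf_near_eventually[OF X] vf_near_eventually[OF Y]]])
      then obtain W where W: "open W" "p \<in> W" "\<forall>q\<in>W. q \<in> U \<and> vf_near q X \<and> vf_near q Y"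
        unfolding eventually_nhds by auto
      have "W \<subseteq> U" "vector_field M W X" "vector_field M W Y"
        using W(3) by (auto simp: vector_field_iff[OF W(1)])
      then show "D' X Y p = (\<lambda>f. D X Y p f + A p (X p) * Y p f + A p (Y p) * X p f)"
        using conjunct2[OF *, rule_format, OF W(1) _ _ _ W(2)] by simp
    qed
  next
    assume *: "projective_change U D' D A"
    show "one_form M U A \<and>
        (\<forall>W X Y. open W \<longrightarrow> W \<subseteq> U \<longrightarrow> vector_field M W X \<longrightarrow> vector_field M W Y \<longrightarrow>
           (\<forall>p\<in>W. D' X Y p = (\<lambda>f. D X Y p f + A p (X p) * Y p f + A p (Y p) * X p f)))"
    proof (intro conjI allI impI ballI)
      show "one_form M U A" using * by (simp add: one_form_iff[OF U] projective_change_def)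
      fix W X Y p assume W: "open W" "W \<subseteq> U" "vector_field M W X" "vector_field M W Y" and p: "p \<in> W"
      show "D' X Y p = (\<lambda>f. D X Y p f + A p (X p) * Y p f + A p (Y p) * X p f)"
        using * W(2) p vf_nearI[OF W(3,1) p] vf_nearI[OF W(4,1) p] by (auto simp: projective_change_def)
    qed
  qed
  then show ?thesis unfolding projectively_equivalent_def by simp
qed

text \<open>The inverse change is by \<open>- A\<close>; it is spelled as a linear combination so
  that \<open>form_near_lincomb\<close> applies as it stands.\<close>

lemma projective_change_sym:
  assumes "projective_change U D' D A"
  shows "projective_change U D D' (\<lambda>q v. (-1) * A q v + 0 * A q v)"
  unfolding projective_change_def
proof (intro ballI conjI allI impI)
  fix p X Y assume p: "p \<in> U"
  have A: "form_near p A" using assms p by (simp add: projective_change_def)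
  show "form_near p (\<lambda>q v. (-1) * A q v + 0 * A q v)" by (rule form_near_lincomb[OF A A])
  assume "vf_near p X" "vf_near p Y"
  then have "D' X Y p = (\<lambda>f. D X Y p f + A p (X p) * Y p f + A p (Y p) * X p f)"
    using assms p by (simp add: projective_change_def)
  then show "D X Y p = (\<lambda>f. D' X Y p f + ((-1) * A p (X p) + 0 * A p (X p)) * Y p f + ((-1) * A p (Y p) + 0 * A p (Y p)) * X p f)"
    by simp
qed

lemma projective_change_trans:
  assumes "projective_change U D1 D2 A" "projective_change U D2 D3 B"
  shows "projective_change U D1 D3 (\<lambda>q v. 1 * A q v + 1 * B q v)"
  unfolding projective_change_def
proof (intro ballI conjI allI impI)
  fix p X Y assume p: "p \<in> U"
  show "form_near p (\<lambda>q v. 1 * A q v + 1 * B q v)"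
    by (rule form_near_lincomb) (use assms p in \<open>simp_all add: projective_change_def\<close>)
  assume "vf_near p X" "vf_near p Y"
  then have "D1 X Y p = (\<lambda>f. D2 X Y p f + A p (X p) * Y p f + A p (Y p) * X p f)"
    "D2 X Y p = (\<lambda>f. D3 X Y p f + B p (X p) * Y p f + B p (Y p) * X p f)"
    using assms p by (simp_all add: projective_change_def)
  then show "D1 X Y p = (\<lambda>f. D3 X Y p f + (1 * A p (X p) + 1 * B p (X p)) * Y p f + (1 * A p (Y p) + 1 * B p (Y p)) * X p f)"
    by (simp add: algebra_simps)
qed

lemma projectively_equivalent_sym:
  assumes "open U" "projectively_equivalent M U D D'"
  shows "projectively_equivalent M U D' D"
proof -
  obtain A where "projective_change U D D' A" using assms by (auto simp: projectively_equivalent_iff)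
  from projective_change_sym[OF this] show ?thesis
    unfolding projectively_equivalent_iff[OF assms(1)] by blast
qed

lemma projectively_equivalent_trans:
  assumes "open U" "projectively_equivalent M U D1 D2" "projectively_equivalent M U D2 D3"
  shows "projectively_equivalent M U D1 D3"
proof -
  obtain A B where "projective_change U D1 D2 A" "projective_change U D2 D3 B"
    using assms by (auto simp: projectively_equivalent_iff)
  from projective_change_trans[OF this] show ?thesis
    unfolding projectively_equivalent_iff[OF assms(1)] by blast
qed

end

context affine_connection
begin

text \<open>The added term is symmetric in \<open>X\<close> and \<open>Y\<close>, so the torsion
  stays 0, and linear over functions in both, so the Leibniz rule survives. This is the source of
  the Levi-Civita connection constructed later.\<close>

lemma torsionless_projective_change:
  assumes A: "\<And>p. p \<in> U \<Longrightarrow> form_near p A"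
  shows "torsionless_connection M U (\<lambda>X Y p f. D X Y p f + A p (X p) * Y p f + A p (Y p) * X p f)"
    (is "torsionless_connection M U ?D'")
  unfolding torsionless_connection_def connection_def
proof (rule conjI; intro allI impI)
  fix W X Y assume W: "open W" "W \<subseteq> U" "vector_field M W X" "vector_field M W Y"
  have p: "p \<in> U" if "p \<in> W" for p using W(2) that by blast
  have X: "vf_near p X" and Y: "vf_near p Y" if "p \<in> W" for p
    using W that by (simp_all add: vector_field_iff[OF W(1)])
  have Ap: "A p \<in> CT p" if "p \<in> W" for p by (rule form_near_CT[OF A[OF p[OF that]]])
  show "\<forall>p\<in>W. (\<lambda>f. ?D' X Y p f - ?D' Y X p f) = lie_bracket M X Y p"
  proof (intro ballI ext)
    fix q f assume q: "q \<in> W"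
    show "?D' X Y q f - ?D' Y X q f = lie_bracket M X Y q f"
      using fun_cong[OF conn_torsion[OF p[OF q] X[OF q] Y[OF q]], of f] by simp
  qed
  have "vector_field M W (?D' X Y)"
    unfolding vector_field_iff[OF W(1)]
  proof
    fix q assume q: "q \<in> W"
    note f = form_near_sm[OF A[OF p[OF q]]]
    show "vf_near q (\<lambda>p f. D X Y p f + A p (X p) * Y p f + A p (Y p) * X p f)"
      by (rule vf_near_add[OF vf_near_add[OF conn_vf[OF p[OF q] X[OF q] Y[OF q]]
            vf_near_scale[OF f[OF X[OF q]] Y[OF q]]] vf_near_scale[OF f[OF Y[OF q]] X[OF q]]])
  qed
  moreover have "\<forall>p\<in>W. ?D' (\<lambda>q f. X q f + X' q f) Y p = (\<lambda>f. ?D' X Y p f + ?D' X' Y p f)"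
    if X': "vector_field M W X'" for X'
  proof (intro ballI ext)
    fix q f assume q: "q \<in> W"
    have X'q: "vf_near q X'" using X' q by (simp add: vector_field_iff[OF W(1)])
    show "?D' (\<lambda>q f. X q f + X' q f) Y q f = ?D' X Y q f + ?D' X' Y q f"
      unfolding conn_add_left[OF p[OF q] X[OF q] X'q Y[OF q]] CT_add[OF Ap[OF q] vf_near_TT[OF X[OF q]] vf_near_TT[OF X'q]]
      by (simp add: algebra_simps)
  qed
  moreover have "\<forall>p\<in>W. ?D' X (\<lambda>q f. Y q f + Y' q f) p = (\<lambda>f. ?D' X Y p f + ?D' X Y' p f)"
    if Y': "vector_field M W Y'" for Y'
  proof (intro ballI ext)
    fix q f assume q: "q \<in> W"
    have Y'q: "vf_near q Y'" using Y' q by (simp add: vector_field_iff[OF W(1)])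
    show "?D' X (\<lambda>q f. Y q f + Y' q f) q f = ?D' X Y q f + ?D' X Y' q f"
      unfolding conn_add_right[OF p[OF q] X[OF q] Y[OF q] Y'q] CT_add[OF Ap[OF q] vf_near_TT[OF Y[OF q]] vf_near_TT[OF Y'q]]
      by (simp add: algebra_simps)
  qed
  moreover have "\<forall>p\<in>W. ?D' (\<lambda>q f. h q * X q f) Y p = (\<lambda>f. h p * ?D' X Y p f) \<and>
       ?D' X (\<lambda>q f. h q * Y q f) p = (\<lambda>f. h p * ?D' X Y p f + X p h * Y p f)"
    if h: "smooth_fun M W h" for h
  proof (intro ballI conjI ext)
    fix q f assume q: "q \<in> W"
    have hq: "sm q h" using h q by (simp add: smooth_fun_iff[OF W(1)])
    show "?D' (\<lambda>q f. h q * X q f) Y q f = h q * ?D' X Y q f"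
      unfolding conn_scale(1)[OF p[OF q] X[OF q] Y[OF q] hq] CT_scale[OF Ap[OF q] vf_near_TT[OF X[OF q]]]
      by (simp add: algebra_simps)
    show "?D' X (\<lambda>q f. h q * Y q f) q f = h q * ?D' X Y q f + X q h * Y q f"
      unfolding conn_scale(2)[OF p[OF q] X[OF q] Y[OF q] hq] CT_scale[OF Ap[OF q] vf_near_TT[OF Y[OF q]]]
      by (simp add: algebra_simps)
  qed
  moreover have "\<forall>p\<in>W. ?D' X' Y' p = ?D' X Y p" if eq: "\<forall>p\<in>W. X' p = X p \<and> Y' p = Y p" for X' Y'
  proof (intro ballI ext)
    fix q f assume q: "q \<in> W"
    have "D X' Y' q = D X Y q"
      by (rule conn_cong[OF p[OF q] X[OF q] Y[OF q]]; rule eventually_nhds_open[OF W(1) q]) (use eq in simp_all)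
    then show "?D' X' Y' q f = ?D' X Y q f" using eq q by simp
  qed
  ultimately show "vector_field M W (?D' X Y) \<and>
        (\<forall>X'. vector_field M W X' \<longrightarrow>
           (\<forall>p\<in>W. ?D' (\<lambda>q f. X q f + X' q f) Y p = (\<lambda>f. ?D' X Y p f + ?D' X' Y p f))) \<and>
        (\<forall>Y'. vector_field M W Y' \<longrightarrow>
           (\<forall>p\<in>W. ?D' X (\<lambda>q f. Y q f + Y' q f) p = (\<lambda>f. ?D' X Y p f + ?D' X Y' p f))) \<and>
        (\<forall>h. smooth_fun M W h \<longrightarrow>
           (\<forall>p\<in>W. ?D' (\<lambda>q f. h q * X q f) Y p = (\<lambda>f. h p * ?D' X Y p f) \<and>
                  ?D' X (\<lambda>q f. h q * Y q f) p = (\<lambda>f. h p * ?D' X Y p f + X p h * Y p f))) \<and>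
        (\<forall>X' Y'. (\<forall>p\<in>W. X' p = X p \<and> Y' p = Y p) \<longrightarrow> (\<forall>p\<in>W. ?D' X' Y' p = ?D' X Y p))"
    by (intro conjI allI impI)
qed

lemma metrisability_eq_ext_iff:
  "metrisability_eq_ext M U D g \<mu> \<longleftrightarrow>
    (\<forall>p\<in>U. \<forall>E. frame_near p E \<longrightarrow> (\<forall>a b. ext_cov_deriv M D g E a b p =
          (\<lambda>v. coframe M E a p (\<mu> p) * coframe M E b p v + coframe M E b p (\<mu> p) * coframe M E a p v)))"
  (is "?L \<longleftrightarrow> ?R")
proof
  assume L: ?L
  show ?R
  proof (intro ballI allI impI)
    fix p E a b assume p: "p \<in> U" and E: "frame_near p E"
    obtain W where W: "open W" "p \<in> W" "frame M W E" using E unfolding frame_near_def by auto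
    have "frame M (W \<inter> U) E" using W(3) by (rule frame_subset) simp
    then show "ext_cov_deriv M D g E a b p =
          (\<lambda>v. coframe M E a p (\<mu> p) * coframe M E b p v + coframe M E b p (\<mu> p) * coframe M E a p v)"
      using L[unfolded metrisability_eq_ext_def, rule_format, of "W \<inter> U" E p a b] W p open_U by auto
  qed
next
  assume R: ?R
  show ?L
    unfolding metrisability_eq_ext_def
  proof (intro allI impI ballI)
    fix W E p a b assume W: "open W" "W \<subseteq> U" "frame M W E" and p: "p \<in> W"
    show "ext_cov_deriv M D g E a b p =
          (\<lambda>v. coframe M E a p (\<mu> p) * coframe M E b p v + coframe M E b p (\<mu> p) * coframe M E a p v)"
      using R frame_nearI[OF W(3,1) p] W(2) p by blast
  qed
qed

end


section \<open>The metrisability equation\<close>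

context manifold
begin

text \<open>The axioms of a derivation speak of sums and products only. The chain rule for
  \<open>exp\<close> is therefore taken from the expansion in coordinate vectors, where it is a rule
  for partial derivatives.\<close>

lemma tv_exp:
  assumes v: "v \<in> TT p" and f: "sm p f"
  shows "v (\<lambda>q. exp (f q)) = exp (f p) * v f"
proof -
  obtain V x where Vx: "(V, x) \<in> M" and p: "p \<in> V" by (rule ex_chart)
  have c: "coord_vec V x i p (\<lambda>q. exp (f q)) = exp (f p) * coord_vec V x i p f" for i
    using partial_deriv_compose_real(1)[where h = exp, OF chart_differentiable[OF Vx p f] DERIV_exp, of i]
    by (simp add: coord_vec_def f sm_exp[OF f] chart_inv[OF Vx p])
  have ex: "v h = (\<Sum>i\<in>UNIV. v (\<lambda>q. x q $ i) * coord_vec V x i p h)" for h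
    by (rule fun_cong[OF tangent_expand_coords[OF Vx p v]])
  have "v (\<lambda>q. exp (f q)) = (\<Sum>i\<in>UNIV. v (\<lambda>q. x q $ i) * coord_vec V x i p (\<lambda>q. exp (f q)))"
    by (rule ex)
  also have "\<dots> = exp (f p) * (\<Sum>i\<in>UNIV. v (\<lambda>q. x q $ i) * coord_vec V x i p f)"
    unfolding c by (simp add: sum_distrib_left mult.left_commute)
  also have "\<dots> = exp (f p) * v f" by (rule arg_cong[OF ex[symmetric]])
  finally show ?thesis .
qed

lemma tensor_field_conformal:
  assumes "tensor_field M U g" and \<phi>: "\<And>p. p \<in> U \<Longrightarrow> sm p \<phi>"
  shows "tensor_field M U (\<lambda>p \<alpha> \<beta>. exp (\<phi> p) * g p \<alpha> \<beta>)"
proof -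
  interpret tensor_field M U g by fact
  show ?thesis
  proof unfold_locales
    show "sym_tensor M U (\<lambda>p \<alpha> \<beta>. exp (\<phi> p) * g p \<alpha> \<beta>)"
      unfolding sym_tensor_def
    proof (intro conjI ballI allI impI)
      fix p \<alpha> \<beta> assume p: "p \<in> U" and \<alpha>: "\<alpha> \<in> CT p" and \<beta>: "\<beta> \<in> CT p"
      show "exp (\<phi> p) * g p \<alpha> \<beta> = exp (\<phi> p) * g p \<beta> \<alpha>"
        using tensor_sym[OF bilinear[OF p] \<alpha> \<beta>] by simp
      show "exp (\<phi> p) * g p (\<lambda>v. a * \<alpha> v + b * \<beta> v) \<gamma> = a * (exp (\<phi> p) * g p \<alpha> \<gamma>) + b * (exp (\<phi> p) * g p \<beta> \<gamma>)"
        if "\<gamma> \<in> CT p" for a b \<gamma>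
        unfolding tensor_linear[OF bilinear[OF p] \<alpha> \<beta> that] by (simp add: algebra_simps)
    next
      fix W \<alpha> \<beta> assume W: "open W" "W \<subseteq> U" "one_form M W \<alpha>" "one_form M W \<beta>"
      show "smooth_fun M W (\<lambda>p. exp (\<phi> p) * g p (\<alpha> p) (\<beta> p))"
        unfolding smooth_fun_iff[OF W(1)]
      proof
        fix p assume p: "p \<in> W"
        then have pU: "p \<in> U" using W(2) by blast
        show "sm p (\<lambda>p. exp (\<phi> p) * g p (\<alpha> p) (\<beta> p))"
          by (rule sm_mult[OF sm_exp[OF \<phi>[OF pU]] tensor_sm[OF pU form_nearI[OF W(3,1) p] form_nearI[OF W(4,1) p]]])
      qed
    qed
    show "nondegenerate_tensor M U (\<lambda>p \<alpha> \<beta>. exp (\<phi> p) * g p \<alpha> \<beta>)"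
      using nondegenerate unfolding nondegenerate_tensor_def by simp
  qed (rule open_U)
qed

lemma ext_deriv_zero:
  assumes "vf_near p X" "vf_near p Y"
  shows "ext_deriv M (\<lambda>q v. 0) X Y p = 0"
  unfolding ext_deriv_def using tv_const[OF vf_near_TT[OF assms(1)]] tv_const[OF vf_near_TT[OF assms(2)]] by simp

text \<open>Meant for the coefficients of a projectively changed connection: \<open>f d\<close> is
  the old coefficient, the Kronecker term comes from \<open>A(Z)\<close> times the identity, and
  \<open>h d * t\<close> from \<open>A(E\<^sub>d)\<close> times a component of
  \<open>Z\<close>.\<close>

lemma sum_kronecker_expand:
  fixes f h G :: "'k::finite \<Rightarrow> real"
  shows "(\<Sum>d\<in>UNIV. (f d + c * of_bool (a = d) + h d * t) * (e * G d))
    = e * ((\<Sum>d\<in>UNIV. f d * G d) + c * G a + t * (\<Sum>d\<in>UNIV. h d * G d))"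
proof -
  have "(f d + c * of_bool (a = d) + h d * t) * (e * G d)
    = e * (f d * G d) + of_bool (a = d) * (e * c * G d) + e * t * (h d * G d)" for d
    by (simp add: algebra_simps)
  moreover have "(\<Sum>d\<in>UNIV. of_bool (a = d) * (e * c * G d)) = e * c * G a" by simp
  ultimately show ?thesis
    by (simp only: sum.distrib sum_distrib_left[symmetric]) (simp add: algebra_simps)
qed

text \<open>For \<open>A = d\<phi>\<close> the terms \<open>2 A\<^sub>c g\<^sup>a\<^sup>b\<close> produced by the projective change are
  cancelled by the conformal factor.\<close>

lemma ext_cov_deriv_projective_change:
  assumes D: "affine_connection M U D" and D': "affine_connection M U D'"
    and g: "tensor_field M U g" and \<phi>: "sm p \<phi>"
    and D'D: "projective_change U D' D A" and A: "A p = differential M \<phi> p"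
    and p: "p \<in> U" and E: "frame_near p E" and Z: "vf_near p Z"
  shows "ext_cov_deriv M D' (\<lambda>q \<alpha> \<beta>. exp (- 2 * \<phi> q) * g q \<alpha> \<beta>) E a b p (Z p)
    = exp (- 2 * \<phi> p) * (ext_cov_deriv M D g E a b p (Z p)
        + coframe M E a p (Z p) * g p (A p) (coframe M E b p)
        + coframe M E b p (Z p) * g p (coframe M E a p) (A p))"
proof -
  interpret D: affine_connection M U D by fact
  interpret D': affine_connection M U D' by fact
  interpret tensor_field M U g by fact
  note \<theta> = coframe_CT[OF E] and v = frame_near_vf[OF E] and T = frame_near_TT[OF E]
  let ?G = "\<lambda>a b q. g q (coframe M E a q) (coframe M E b q)" and ?e = "exp (- 2 * \<phi> p)"
  have Ap: "A p \<in> CT p" using D'D p by (simp add: projective_change_def form_near_CT)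
  have AZ: "A p (Z p) = Z p \<phi>" by (simp add: A differential_def vf_near_TT[OF Z])
  have Zexp: "Z p (\<lambda>q. exp (- 2 * \<phi> q)) = ?e * (- 2 * Z p \<phi>)"
    using tv_exp[OF vf_near_TT[OF Z] sm_cmult[OF \<phi>, of "-2"]] tv_cmult[OF vf_near_TT[OF Z] \<phi>, of "-2"] by simp
  \<comment> \<open>The exponent \<open>- 2 * \<phi>\<close> is chosen so that
    \<open>- 2 * A p (Z p)\<close> appears here: each of the two upper indices contributes one
    \<open>A p (Z p)\<close> in \<open>s1\<close> and \<open>s2\<close>.\<close>
  have ZG: "Z p (\<lambda>q. exp (- 2 * \<phi> q) * ?G a b q) = ?e * (Z p (?G a b) - 2 * A p (Z p) * ?G a b p)"
    using tv_mult[OF vf_near_TT[OF Z] sm_exp[OF sm_cmult[OF \<phi>, of "-2"]] tensor_sm[OF p form_near_coframe[OF E] form_near_coframe[OF E]], of a b]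
    unfolding Zexp AZ by (simp add: algebra_simps)
  have \<Gamma>: "coframe M E a p (D' Z (E d) p) = coframe M E a p (D Z (E d) p) + A p (Z p) * of_bool (a = d) + A p (E d p) * coframe M E a p (Z p)" for a d
  proof -
    have "D' Z (E d) p = (\<lambda>f. (D Z (E d) p f + A p (Z p) * E d p f) + A p (E d p) * Z p f)"
      using D'D p Z v by (simp add: projective_change_def)
    then show ?thesis
      using CT_add[OF \<theta> TT_add[OF vf_near_TT[OF D.conn_vf[OF p Z v]] TT_scale[OF T]] TT_scale[OF vf_near_TT[OF Z]]]
        CT_add[OF \<theta> vf_near_TT[OF D.conn_vf[OF p Z v]] TT_scale[OF T]]
        CT_scale[OF \<theta> T] CT_scale[OF \<theta> vf_near_TT[OF Z]]
      by (simp add: coframe_frame[OF E])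
  qed
  have gA: "g p (A p) (coframe M E b p) = (\<Sum>d\<in>UNIV. A p (E d p) * ?G d b p)" for b
  proof -
    have "g p (A p) (coframe M E b p) = g p (\<lambda>v. \<Sum>d\<in>UNIV. A p (E d p) * coframe M E d p v) (coframe M E b p)"
      using CT_expand[OF E Ap] by (rule arg_cong[where f = "\<lambda>\<alpha>. g p \<alpha> (coframe M E b p)"])
    also have "\<dots> = (\<Sum>d\<in>UNIV. A p (E d p) * ?G d b p)" by (rule tensor_sum[OF bilinear[OF p] \<theta>]) (rule \<theta>)
    finally show ?thesis .
  qed
  have gA': "g p (coframe M E a p) (A p) = (\<Sum>d\<in>UNIV. A p (E d p) * ?G a d p)" for a
    unfolding tensor_sym[OF bilinear[OF p] \<theta> Ap] gA
    by (intro sum.cong refl arg_cong2[of _ _ _ _ "(*)"] tensor_sym[OF bilinear[OF p] \<theta> \<theta>])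
  have s1: "(\<Sum>d\<in>UNIV. coframe M E a p (D' Z (E d) p) * (?e * ?G d b p))
    = ?e * ((\<Sum>d\<in>UNIV. coframe M E a p (D Z (E d) p) * ?G d b p) + A p (Z p) * ?G a b p + coframe M E a p (Z p) * g p (A p) (coframe M E b p))"
    unfolding \<Gamma> gA by (rule sum_kronecker_expand)
  have s2: "(\<Sum>d\<in>UNIV. coframe M E b p (D' Z (E d) p) * (?e * ?G a d p))
    = ?e * ((\<Sum>d\<in>UNIV. coframe M E b p (D Z (E d) p) * ?G a d p) + A p (Z p) * ?G a b p + coframe M E b p (Z p) * g p (coframe M E a p) (A p))"
    unfolding \<Gamma> gA' by (rule sum_kronecker_expand)
  show ?thesis
    unfolding D'.ext_cov_deriv_eq[OF p E Z] D.ext_cov_deriv_eq[OF p E Z] ZG s1 s2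
    by (simp add: algebra_simps)
qed

end

section \<open>The trace of the metrisability equation\<close>

context affine_connection
begin

context
  fixes g \<mu> assumes g: "tensor_field M U g" and \<mu>: "vector_field M U \<mu>"
    and metrisability: "metrisability_eq_ext M U D g \<mu>"
begin

interpretation g: tensor_field M U g by (rule g)

text \<open>Contracting the metrisability equation with the inverse of \<open>g\<^sup>a\<^sup>b\<close>.\<close>

lemma log_det_trace_form:
  assumes p: "p \<in> U" and E: "frame_near p E" and v: "v \<in> TT p"
    and KG: "\<And>a c. (\<Sum>b\<in>UNIV. K a b p * g p (coframe M E b p) (coframe M E c p)) = of_bool (a = c)"
    and GK: "\<And>a c. (\<Sum>b\<in>UNIV. g p (coframe M E a p) (coframe M E b p) * K b c p) = of_bool (a = c)"
  shows "log_det_form K (\<lambda>a b q. g q (coframe M E a q) (coframe M E b q)) p v + 2 * trace_form E p v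
    = 2 * flat g p (\<mu> p) v"
proof -
  let ?G = "\<lambda>a b q. g q (coframe M E a q) (coframe M E b q)"
  let ?m = "\<lambda>a. coframe M E a p (\<mu> p)" and ?t = "\<lambda>a. coframe M E a p v" and ?\<Gamma> = "\<lambda>a b. conn_form M D E a b p v"
  have \<mu>p: "\<mu> p \<in> TT p" using \<mu> p by (simp add: vector_field_def)
  have K_sym: "K a b p = K b a p" for a b
    using g.flat_components[OF p E KG, of a b] g.flat_components[OF p E KG, of b a]
      g.flat_sym[OF p frame_near_TT[OF E] frame_near_TT[OF E], of a b] by simp
  have fl: "flat g p (\<mu> p) v = (\<Sum>a\<in>UNIV. (\<Sum>b\<in>UNIV. ?m b * K b a p) * ?t a)"
    by (rule fun_cong[OF g.flat_formula[OF p E \<mu>p KG]])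
  have vG: "v (?G b a) + (\<Sum>c\<in>UNIV. ?\<Gamma> b c * ?G c a p) + (\<Sum>c\<in>UNIV. ?\<Gamma> a c * ?G b c p) = ?m b * ?t a + ?m a * ?t b" for a b
    using fun_cong[OF metrisability[unfolded metrisability_eq_ext_iff, rule_format, OF p E, of b a], of v] v
    by (simp add: ext_cov_deriv_def differential_def)
  \<comment> \<open>Contraction of \<open>vG\<close> with the inverse matrix. Each of the two terms
    with \<open>\<mu>\<close> gives \<open>flat g p (\<mu> p) v\<close>, because \<open>K\<close> is
    symmetric; each of the two connection terms gives the trace form.\<close>
  have "(\<Sum>a\<in>UNIV. \<Sum>b\<in>UNIV. K a b p * (v (?G b a) + (\<Sum>c\<in>UNIV. ?\<Gamma> b c * ?G c a p) + (\<Sum>c\<in>UNIV. ?\<Gamma> a c * ?G b c p)))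
    = (\<Sum>a\<in>UNIV. \<Sum>b\<in>UNIV. K a b p * (?m b * ?t a + ?m a * ?t b))"
    unfolding vG ..
  also have "\<dots> = (\<Sum>a\<in>UNIV. \<Sum>b\<in>UNIV. K a b p * (?m b * ?t a)) + (\<Sum>a\<in>UNIV. \<Sum>b\<in>UNIV. K a b p * (?m a * ?t b))"
    by (simp add: distrib_left sum.distrib)
  also have "(\<Sum>a\<in>UNIV. \<Sum>b\<in>UNIV. K a b p * (?m a * ?t b)) = (\<Sum>b\<in>UNIV. \<Sum>a\<in>UNIV. K a b p * (?m a * ?t b))"
    by (rule sum.swap)
  also have "\<dots> = flat g p (\<mu> p) v" unfolding fl by (simp add: sum_distrib_right sum_distrib_left mult_ac)
  also have "(\<Sum>a\<in>UNIV. \<Sum>b\<in>UNIV. K a b p * (?m b * ?t a)) = flat g p (\<mu> p) v"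
  proof -
    have "K a b p * (?m b * ?t a) = ?m b * K b a p * ?t a" for a b by (subst K_sym) simp
    then show ?thesis unfolding fl sum_distrib_right by (intro sum.cong refl)
  qed
  finally have "(\<Sum>a\<in>UNIV. \<Sum>b\<in>UNIV. K a b p * v (?G b a))
     + (\<Sum>a\<in>UNIV. \<Sum>b\<in>UNIV. K a b p * (\<Sum>c\<in>UNIV. ?\<Gamma> b c * ?G c a p))
     + (\<Sum>a\<in>UNIV. \<Sum>b\<in>UNIV. K a b p * (\<Sum>c\<in>UNIV. ?\<Gamma> a c * ?G b c p)) = 2 * flat g p (\<mu> p) v"
    by (simp add: distrib_left sum.distrib)
  moreover have "(\<Sum>a\<in>UNIV. \<Sum>b\<in>UNIV. K a b p * (\<Sum>c\<in>UNIV. ?\<Gamma> a c * ?G b c p)) = trace_form E p v"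
  proof -
    have "(\<Sum>b\<in>UNIV. K a b p * (\<Sum>c\<in>UNIV. ?\<Gamma> a c * ?G b c p)) = ?\<Gamma> a a" for a
    proof -
      have "(\<Sum>b\<in>UNIV. K a b p * (\<Sum>c\<in>UNIV. ?\<Gamma> a c * ?G b c p)) = (\<Sum>b\<in>UNIV. \<Sum>c\<in>UNIV. ?\<Gamma> a c * (K a b p * ?G b c p))"
        by (simp add: sum_distrib_left mult.left_commute)
      also have "\<dots> = (\<Sum>c\<in>UNIV. ?\<Gamma> a c * (\<Sum>b\<in>UNIV. K a b p * ?G b c p))"
        unfolding sum_distrib_left by (rule sum.swap)
      finally show ?thesis unfolding KG by simp
    qed
    then show ?thesis by (simp add: trace_form_def)
  qed
  moreover have "(\<Sum>a\<in>UNIV. \<Sum>b\<in>UNIV. K a b p * (\<Sum>c\<in>UNIV. ?\<Gamma> b c * ?G c a p)) = trace_form E p v"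
  proof -
    have "(\<Sum>a\<in>UNIV. K a b p * (\<Sum>c\<in>UNIV. ?\<Gamma> b c * ?G c a p)) = ?\<Gamma> b b" for b
    proof -
      have "(\<Sum>a\<in>UNIV. K a b p * (\<Sum>c\<in>UNIV. ?\<Gamma> b c * ?G c a p)) = (\<Sum>a\<in>UNIV. \<Sum>c\<in>UNIV. ?\<Gamma> b c * (?G c a p * K a b p))"
        by (simp add: sum_distrib_left mult_ac)
      also have "\<dots> = (\<Sum>c\<in>UNIV. ?\<Gamma> b c * (\<Sum>a\<in>UNIV. ?G c a p * K a b p))"
        unfolding sum_distrib_left by (rule sum.swap)
      finally show ?thesis unfolding GK by simp
    qed
    then show ?thesis by (subst sum.swap) (simp add: trace_form_def)
  qed
  ultimately show ?thesis unfolding log_det_form_def by simp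
qed

text \<open>The exterior derivative of the contracted equation: the logarithmic term is closed, and
  the common factor 2 cancels. Relating the two exterior derivatives, and not just their vanishing,
  lets one lemma serve both conclusions about special connections.\<close>

lemma ext_deriv_flat:
  assumes p: "p \<in> U" and E: "frame_near p E" and X: "vf_near p X" and Y: "vf_near p Y"
  shows "ext_deriv M (\<lambda>q. flat g q (\<mu> q)) X Y p = ext_deriv M (trace_form E) X Y p"
proof -
  obtain K where K': "\<forall>a b. sm p (K a b)" "\<forall>q a c. q \<in> U \<longrightarrow> frame_near q E \<longrightarrow>
       (\<Sum>b\<in>UNIV. K a b q * g q (coframe M E b q) (coframe M E c q)) = of_bool (a = c)"
    "\<forall>q a c. q \<in> U \<longrightarrow> frame_near q E \<longrightarrow>
       (\<Sum>b\<in>UNIV. g q (coframe M E a q) (coframe M E b q) * K b c q) = of_bool (a = c)"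
    by (rule g.ex_inverse[OF p E])
  note K = K'[rule_format]
  let ?G = "\<lambda>a b q. g q (coframe M E a q) (coframe M E b q)"
  have ev: "\<forall>\<^sub>F q in nhds p. q \<in> U \<and> frame_near q E"
    by (rule eventually_conj[OF eventually_U[OF p] frame_near_eventually[OF E]])
  have \<mu>p: "vf_near p \<mu>" using \<mu> p by (simp add: vector_field_iff[OF open_U])
  have F: "form_near p (\<lambda>q. flat g q (\<mu> q))" by (rule g.form_near_flat[OF p \<mu>p])
  have "ext_deriv M (log_det_form K ?G) X Y p = 0"
  proof (rule log_det_form_closed[where G = ?G and H = K, OF _ K(1) _ K(3)[OF p E] X Y])
    show "sm p (?G a b)" for a b by (rule g.tensor_sm[OF p form_near_coframe[OF E] form_near_coframe[OF E]])
    show "\<forall>\<^sub>F q in nhds p. (\<Sum>b\<in>UNIV. K a b q * ?G b c q) = of_bool (a = c)" for a c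
      using ev by eventually_elim (simp add: K(2))
  qed
  moreover have "ext_deriv M (log_det_form K ?G) X Y p
    = ext_deriv M (\<lambda>q v. 2 * flat g q (\<mu> q) v + (- 2) * trace_form E q v) X Y p"
  proof (rule ext_deriv_cong[OF X Y])
    show "\<forall>\<^sub>F q in nhds p. \<forall>v\<in>TT q. log_det_form K ?G q v = 2 * flat g q (\<mu> q) v + (- 2) * trace_form E q v"
      using ev
    proof eventually_elim
      case (elim q)
      then have q: "q \<in> U" "frame_near q E" by simp_all
      show ?case
      proof
        fix v assume "v \<in> TT q"
        from log_det_trace_form[where K = K, OF q this K(2)[OF q] K(3)[OF q]]
        show "log_det_form K ?G q v = 2 * flat g q (\<mu> q) v + (- 2) * trace_form E q v" by simp
      qed
    qed
  qed
  ultimately show ?thesis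
    unfolding ext_deriv_lincomb[OF X Y F form_near_trace_form[OF p E]] by simp
qed

lemma closed_form_flat:
  assumes "symmetric_schouten M U D"
  shows "closed_form M U (\<lambda>p. flat g p (\<mu> p))"
proof (rule closed_formI[OF open_U])
  fix p assume p: "p \<in> U"
  have \<mu>p: "vf_near p \<mu>" using \<mu> p by (simp add: vector_field_iff[OF open_U])
  show F: "form_near p (\<lambda>q. flat g q (\<mu> q))" by (rule g.form_near_flat[OF p \<mu>p])
  fix X Y assume X: "vf_near p X" and Y: "vf_near p Y"
  obtain E where E: "frame_near p E" by (rule ex_frame)
  show "ext_deriv M (\<lambda>q. flat g q (\<mu> q)) X Y p = 0"
  proof (rule ext_deriv_eq_zeroI[OF p E F _ X Y])
    fix a b
    show "ext_deriv M (\<lambda>q. flat g q (\<mu> q)) (E a) (E b) p = 0"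
      unfolding ext_deriv_flat[OF p E frame_near_vf[OF E] frame_near_vf[OF E]]
      using assms p E by (simp add: symmetric_schouten_iff)
  qed
qed

end

lemma symmetric_schouten_if_parallel:
  assumes g: "tensor_field M U g" and par: "metrisability_eq_ext M U D g (\<lambda>p f. 0)"
  shows "symmetric_schouten M U D"
  unfolding symmetric_schouten_iff
proof (intro ballI allI impI)
  interpret g: tensor_field M U g by (rule g)
  fix p E a b assume p: "p \<in> U" and E: "frame_near p E"
  note v = frame_near_vf[OF E]
  have zero: "vector_field M U (\<lambda>p f. 0)" by (simp add: vector_field_iff[OF open_U] vf_near_zero)
  have "flat g q (\<lambda>f. 0) = (\<lambda>v. 0)" if "q \<in> U" for q
    using g.flat_lincomb[OF that TT_zero TT_zero, of 0 0] by simp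
  then have "\<forall>\<^sub>F q in nhds p. \<forall>v\<in>TT q. flat g q (\<lambda>f. 0) v = 0"
    using eventually_U[OF p] by (auto elim: eventually_mono)
  from ext_deriv_cong[OF v v this] show "ext_deriv M (trace_form E) (E a) (E b) p = 0"
    unfolding ext_deriv_flat[OF g zero par p E v v, symmetric] ext_deriv_zero[OF v v] .
qed

text \<open>In matrix form a parallel tensor satisfies
  \<open>Z(G) = - \<Gamma> G - G \<Gamma>'\<close>, with \<open>\<Gamma>'\<close> the transpose, so
  the inverse satisfies \<open>Z(K) = K \<Gamma> + \<Gamma>' K\<close>. Inserted into the product
  rule for the components of \<open>flat g q (X q) (Y q)\<close>, this supplies the connection terms
  of the two covariant derivatives.\<close>

lemma levi_civita_if_parallel:
  assumes g: "tensor_field M U g" and par: "metrisability_eq_ext M U D g (\<lambda>p f. 0)"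
  shows "levi_civita M U (flat g) D"
  unfolding levi_civita_def
proof (intro conjI allI impI ballI)
  show "torsionless_connection M U D" by (rule torsionless)
  interpret g: tensor_field M U g by (rule g)
  fix W X Y Z p assume W: "open W" "W \<subseteq> U" "vector_field M W X" "vector_field M W Y" "vector_field M W Z" and pW: "p \<in> W"
  have p: "p \<in> U" using W(2) pW by blast
  have X: "vf_near p X" and Y: "vf_near p Y" and Z: "vf_near p Z"
    using W pW by (auto intro: vf_nearI)
  obtain E where E: "frame_near p E" by (rule ex_frame)
  note v = frame_near_vf[OF E] and Zp = vf_near_TT[OF Z]
  obtain K where K': "\<forall>a b. sm p (K a b)" "\<forall>q a c. q \<in> U \<longrightarrow> frame_near q E \<longrightarrow>
       (\<Sum>b\<in>UNIV. K a b q * g q (coframe M E b q) (coframe M E c q)) = of_bool (a = c)"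
    "\<forall>q a c. q \<in> U \<longrightarrow> frame_near q E \<longrightarrow>
       (\<Sum>b\<in>UNIV. g q (coframe M E a q) (coframe M E b q) * K b c q) = of_bool (a = c)"
    by (rule g.ex_inverse[OF p E])
  note K = K'[rule_format]
  let ?G = "\<lambda>a b q. g q (coframe M E a q) (coframe M E b q)"
  define \<Gamma> where "\<Gamma> a b = coframe M E a p (D Z (E b) p)" for a b
  define x y where "x a q = coframe M E a q (X q)" and "y a q = coframe M E a q (Y q)" for a q
  have x: "sm p (x a)" and y: "sm p (y a)" for a
    unfolding x_def y_def by (rule coframe_sm[OF E X], rule coframe_sm[OF E Y])
  have ev: "\<forall>\<^sub>F q in nhds p. q \<in> U \<and> frame_near q E \<and> vf_near q X"
    by (rule eventually_conj[OF eventually_U[OF p] eventually_conj[OF frame_near_eventually[OF E] vf_near_eventually[OF X]]])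
  have ZG: "Z p (?G b c) = (\<Sum>e\<in>UNIV. (- \<Gamma> b e) * ?G e c p) + (\<Sum>e\<in>UNIV. ?G b e p * (- \<Gamma> c e))" for b c
  proof -
    have "ext_cov_deriv M D g E b c p (Z p) = 0"
      using par[unfolded metrisability_eq_ext_iff, rule_format, OF p E, of b c] CT_zero_vec[OF coframe_CT[OF E]] by simp
    then show ?thesis
      unfolding ext_cov_deriv_eq[OF p E Z] by (simp add: \<Gamma>_def sum_negf mult.commute)
  qed
  have ZK: "Z p (K a d) = (\<Sum>b\<in>UNIV. K a b p * \<Gamma> b d) + (\<Sum>c\<in>UNIV. \<Gamma> c a * K c d p)" for a d
  proof -
    have "Z p (K a d) = - (\<Sum>b\<in>UNIV. K a b p * (- \<Gamma> b d)) - (\<Sum>c\<in>UNIV. (- \<Gamma> c a) * K c d p)"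
    proof (rule tv_inverse_matrix_conj[where G = ?G and T = "\<lambda>b e. - \<Gamma> b e" and S = "\<lambda>e c. - \<Gamma> c e", OF _ K(1) _ K(3)[OF p E] Zp ZG])
      show "sm p (?G a b)" for a b by (rule g.tensor_sm[OF p form_near_coframe[OF E] form_near_coframe[OF E]])
      show "\<forall>\<^sub>F q in nhds p. (\<Sum>b\<in>UNIV. K a b q * ?G b c q) = of_bool (a = c)" for a c
        using ev by eventually_elim (simp add: K(2))
    qed
    then show ?thesis by (simp add: sum_negf)
  qed
  have fl: "flat g p u w = (\<Sum>a\<in>UNIV. (\<Sum>b\<in>UNIV. coframe M E b p u * K b a p) * coframe M E a p w)"
    if "u \<in> TT p" for u w
    by (rule fun_cong[OF g.flat_formula[OF p E that K(2)[OF p E]]])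
  have "Z p (\<lambda>q. flat g q (X q) (Y q)) = Z p (\<lambda>q. \<Sum>a\<in>UNIV. (\<Sum>b\<in>UNIV. x b q * K b a q) * y a q)"
  proof (rule tv_cong[OF Zp])
    show "\<forall>\<^sub>F q in nhds p. flat g q (X q) (Y q) = (\<Sum>a\<in>UNIV. (\<Sum>b\<in>UNIV. x b q * K b a q) * y a q)"
      using ev
    proof eventually_elim
      case (elim q)
      then have q: "q \<in> U" "frame_near q E" "X q \<in> TT q" by (simp_all add: vf_near_TT)
      show ?case unfolding x_def y_def by (rule fun_cong[OF g.flat_formula[OF q K(2)[OF q(1,2)]]])
    qed
  qed
  also have "\<dots> = (\<Sum>a\<in>UNIV. (\<Sum>b\<in>UNIV. x b p * K b a p) * Z p (y a) + y a p * (\<Sum>b\<in>UNIV. x b p * Z p (K b a) + K b a p * Z p (x b)))"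
  proof -
    have xK: "sm p (\<lambda>q. \<Sum>b\<in>UNIV. x b q * K b a q)" for a by (rule sm_sum) (rule sm_mult[OF x K(1)])
    have "Z p (\<lambda>q. \<Sum>b\<in>UNIV. x b q * K b a q) = (\<Sum>b\<in>UNIV. x b p * Z p (K b a) + K b a p * Z p (x b))" for a
      using tv_sum[OF Zp, of UNIV "\<lambda>b q. x b q * K b a q"] sm_mult[OF x K(1)] tv_mult[OF Zp x K(1)] by simp
    then show ?thesis
      using tv_sum[OF Zp, of UNIV "\<lambda>a q. (\<Sum>b\<in>UNIV. x b q * K b a q) * y a q"] sm_mult[OF xK y] tv_mult[OF Zp xK y] by simp
  qed
  also have "\<dots> = (\<Sum>a\<in>UNIV. \<Sum>b\<in>UNIV. x b p * y a p * ((\<Sum>c\<in>UNIV. K b c p * \<Gamma> c a) + (\<Sum>c\<in>UNIV. \<Gamma> c b * K c a p)))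
     + (\<Sum>a\<in>UNIV. (\<Sum>b\<in>UNIV. Z p (x b) * K b a p) * y a p) + (\<Sum>a\<in>UNIV. (\<Sum>b\<in>UNIV. x b p * K b a p) * Z p (y a))"
    unfolding ZK by (simp add: sum.distrib distrib_left sum_distrib_left sum_distrib_right mult_ac)
  also have "\<dots> = flat g p (D Z X p) (Y p) + flat g p (X p) (D Z Y p)"
    unfolding fl[OF vf_near_TT[OF conn_vf[OF p Z X]]] fl[OF vf_near_TT[OF X]]
      coframe_conn[OF p E Z X] coframe_conn[OF p E Z Y]
      sum_leibniz_bilinear[where x = "\<lambda>a. x a p" and y = "\<lambda>a. y a p" and K = "\<lambda>a b. K a b p" and \<Gamma> = \<Gamma>]
      x_def[symmetric] y_def[symmetric] \<Gamma>_def[symmetric]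
    by (simp add: sum.distrib distrib_left distrib_right)
  finally show "Z p (\<lambda>q. flat g q (X q) (Y q)) = flat g p (D Z X p) (Y p) + flat g p (X p) (D Z Y p)" .
qed

text \<open>The same passage in the other direction: metric compatibility on frame fields reads
  \<open>Z(G) = \<Gamma>' G + G \<Gamma>\<close>, and the derivative of the inverse matrix then
  cancels the connection terms in \<open>ext_cov_deriv\<close>.\<close>

lemma parallel_if_levi_civita:
  assumes gm: "metric_field M U g" and lc: "levi_civita M U g D"
  shows "metrisability_eq_ext M U D (metric_field.inverse_metric M g) (\<lambda>p f. 0)"
  unfolding metrisability_eq_ext_iff
proof (intro ballI allI impI)
  interpret g: metric_field M U g by (rule gm)
  fix p E a b assume p: "p \<in> U" and E: "frame_near p E"
  note v = frame_near_vf[OF E] and T = frame_near_TT[OF E]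
  obtain H where H': "\<forall>a b. sm p (H a b)" "\<forall>q a c. q \<in> U \<longrightarrow> frame_near q E \<longrightarrow> (\<Sum>b\<in>UNIV. H a b q * g q (E b q) (E c q)) = of_bool (a = c)"
    "\<forall>q a c. q \<in> U \<longrightarrow> frame_near q E \<longrightarrow> (\<Sum>b\<in>UNIV. g q (E a q) (E b q) * H b c q) = of_bool (a = c)"
    by (rule g.metric_ex_inverse[OF p E])
  note H = H'[rule_format]
  have ev: "\<forall>\<^sub>F q in nhds p. q \<in> U \<and> frame_near q E"
    by (rule eventually_conj[OF eventually_U[OF p] frame_near_eventually[OF E]])
  have inv: "g.inverse_metric q (coframe M E a q) (coframe M E b q) = H a b q" if "q \<in> U" "frame_near q E" for q a b
    by (rule g.inverse_metric_components[OF that H(2)[OF that]])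
  have "ext_cov_deriv M D g.inverse_metric E a b p (E k p) = 0" for k
  proof -
    define \<Gamma> where "\<Gamma> a b = coframe M E a p (D (E k) (E b) p)" for a b
    obtain W where W: "open W" "p \<in> W" "frame M W E" using E unfolding frame_near_def by auto
    have ZG: "E k p (\<lambda>q. g q (E b q) (E c q)) = (\<Sum>e\<in>UNIV. \<Gamma> e b * g p (E e p) (E c p)) + (\<Sum>e\<in>UNIV. g p (E b p) (E e p) * \<Gamma> e c)" for b c
    proof -
      have fr: "vector_field M (W \<inter> U) (E a)" for a
        using frame_subset[OF W(3), of "W \<inter> U"] by (simp add: frame_def)
      have DT: "D (E k) (E c) p \<in> TT p" for c by (rule vf_near_TT[OF conn_vf[OF p v v]])
      have "E k p (\<lambda>q. g q (E b q) (E c q)) = g p (D (E k) (E b) p) (E c p) + g p (E b p) (D (E k) (E c) p)"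
        using conjunct2[OF lc[unfolded levi_civita_def], rule_format, of "W \<inter> U" "E b" "E c" "E k" p] fr W(1,2) p open_U by auto
      also have "g p (E b p) (D (E k) (E c) p) = g p (D (E k) (E c) p) (E b p)" by (rule g.metric_sym[OF p T DT])
      also have "\<dots> = (\<Sum>e\<in>UNIV. coframe M E e p (D (E k) (E c) p) * g p (E e p) (E b p))"
        by (rule g.metric_expand[OF p E DT T])
      also have "\<dots> = (\<Sum>e\<in>UNIV. g p (E b p) (E e p) * \<Gamma> e c)"
        unfolding \<Gamma>_def by (intro sum.cong refl) (simp add: g.metric_sym[OF p T T] mult.commute)
      also have "g p (D (E k) (E b) p) (E c p) = (\<Sum>e\<in>UNIV. \<Gamma> e b * g p (E e p) (E c p))"
        unfolding \<Gamma>_def by (rule g.metric_expand[OF p E DT T])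
      finally show ?thesis .
    qed
    have "E k p (H a b) = - (\<Sum>c\<in>UNIV. H a c p * \<Gamma> b c) - (\<Sum>c\<in>UNIV. \<Gamma> a c * H c b p)"
    proof (rule tv_inverse_matrix_conj[where G = "\<lambda>b c q. g q (E b q) (E c q)" and T = "\<lambda>b e. \<Gamma> e b" and S = \<Gamma>, OF _ H(1) _ H(3)[OF p E] T ZG])
      show "sm p (\<lambda>q. g q (E a q) (E b q))" for a b by (rule g.metric_sm[OF p v v])
      show "\<forall>\<^sub>F q in nhds p. (\<Sum>b\<in>UNIV. H a b q * g q (E b q) (E c q)) = of_bool (a = c)" for a c
        using ev by eventually_elim (simp add: H(2))
    qed
    moreover have "E k p (\<lambda>q. g.inverse_metric q (coframe M E a q) (coframe M E b q)) = E k p (H a b)"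
      by (rule tv_cong[OF T]) (use ev in eventually_elim, simp add: inv)
    ultimately show ?thesis
      unfolding ext_cov_deriv_eq[OF p E v] inv[OF p E] \<Gamma>_def by (simp add: mult.commute)
  qed
  then have "ext_cov_deriv M D g.inverse_metric E a b p = (\<lambda>v. 0)"
    by (intro CT_eqI[OF E ext_cov_deriv_CT[OF E] CT_zero])
  then show "ext_cov_deriv M D g.inverse_metric E a b p = (\<lambda>v. coframe M E a p (\<lambda>f. 0) * coframe M E b p v
      + coframe M E b p (\<lambda>f. 0) * coframe M E a p v)"
    by (simp add: CT_zero_vec[OF coframe_CT[OF E]])
qed

end


section \<open>Metrisability of projective classes\<close>

context manifold
begin

section \<open>Restriction to smaller open sets\<close>

lemma metric_subset: "metric M U g \<Longrightarrow> B \<subseteq> U \<Longrightarrow> metric M B g"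
  unfolding metric_def by (auto dest: order_trans)

lemma connection_subset: "connection M U D \<Longrightarrow> B \<subseteq> U \<Longrightarrow> connection M B D"
  unfolding connection_def by (meson order_trans)

lemma torsionless_connection_subset:
  "torsionless_connection M U D \<Longrightarrow> B \<subseteq> U \<Longrightarrow> torsionless_connection M B D"
  unfolding torsionless_connection_def by (auto intro: connection_subset dest: order_trans)

lemma levi_civita_subset: "levi_civita M U g D \<Longrightarrow> B \<subseteq> U \<Longrightarrow> levi_civita M B g D"
  unfolding levi_civita_def by (auto intro: torsionless_connection_subset dest: order_trans)

lemma projectively_equivalent_subset:
  assumes "projectively_equivalent M U D' D" "B \<subseteq> U" "open U" "open B"
  shows "projectively_equivalent M B D' D"
proof -
  obtain A where "projective_change U D' D A"
    using assms(1) unfolding projectively_equivalent_iff[OF assms(3)] by blast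
  then have "projective_change B D' D A" using assms(2) by (simp add: projective_change_def subset_iff)
  then show ?thesis unfolding projectively_equivalent_iff[OF assms(4)] by blast
qed

lemma projectively_metric_subset:
  "projectively_metric M U D \<Longrightarrow> B \<subseteq> U \<Longrightarrow> open U \<Longrightarrow> open B \<Longrightarrow> projectively_metric M B D"
  unfolding projectively_metric_def
  using metric_subset levi_civita_subset projectively_equivalent_subset by meson

lemma tensor_field_subset:
  assumes "tensor_field M U g" "B \<subseteq> U" "open B"
  shows "tensor_field M B g"
proof -
  interpret tensor_field M U g by fact
  show ?thesis
  proof unfold_locales
    show "open B" by fact
    show "sym_tensor M B g"
      using sym_tensor assms(2) unfolding sym_tensor_def by (auto dest: order_trans)
    show "nondegenerate_tensor M B g"
      using nondegenerate assms(2) unfolding nondegenerate_tensor_def by blast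
  qed
qed

lemma closed_form_subset:
  assumes "closed_form M U A" "B \<subseteq> U"
  shows "closed_form M B A"
  using assms one_form_subset unfolding closed_form_def by (auto dest: order_trans)

lemma affine_connectionI: "open U \<Longrightarrow> torsionless_connection M U D \<Longrightarrow> affine_connection M U D"
  by unfold_locales

text \<open>The added map sends \<open>Y\<close> to \<open>A(v) Y + A(Y) v\<close>. The first
  summand is a multiple of the identity with trace \<open>n A(v)\<close>; the second has rank at
  most one and trace \<open>A(v)\<close>.\<close>

lemma trace_form_projective_change:
  assumes D: "affine_connection M U D" and D': "affine_connection M U D'"
    and ch: "projective_change U D' D A"
    and p: "p \<in> U" and E: "frame_near p E" and v: "v \<in> TT p"
  shows "affine_connection.trace_form M D' E p v = affine_connection.trace_form M D E p v + (real CARD('n) + 1) * A p v"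
proof -
  interpret D: affine_connection M U D by fact
  interpret D': affine_connection M U D' by fact
  note \<theta> = coframe_CT[OF E] and T = frame_near_TT[OF E] and vE = frame_near_vf[OF E]
  have A: "A p \<in> CT p" using ch p by (simp add: projective_change_def form_near_CT)
  \<comment> \<open>The change formula is about fields, so \<open>v\<close> is extended with
    constant coefficients in the frame.\<close>
  define Z where "Z q f = (\<Sum>b\<in>UNIV. coframe M E b p v * E b q f)" for q f
  have Z: "vf_near p Z" unfolding Z_def[abs_def] by (rule vf_near_sum) (rule sm_const, rule vE)
  have Zp: "Z p = v" unfolding Z_def[abs_def] by (rule coframe_expand[OF E v, symmetric])
  have \<Gamma>: "conn_form M D' E c c p v = conn_form M D E c c p v + A p v + A p (E c p) * coframe M E c p v" for c
  proof -
    have "D' Z (E c) p = (\<lambda>f. (D Z (E c) p f + A p v * E c p f) + A p (E c p) * v f)"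
      using ch p Z vE Zp by (simp add: projective_change_def)
    then have "coframe M E c p (D' Z (E c) p) = coframe M E c p (D Z (E c) p) + A p v + A p (E c p) * coframe M E c p v"
      using CT_add[OF \<theta> TT_add[OF vf_near_TT[OF D.conn_vf[OF p Z vE]] TT_scale[OF T]] TT_scale[OF v]]
        CT_add[OF \<theta> vf_near_TT[OF D.conn_vf[OF p Z vE]] TT_scale[OF T]]
        CT_scale[OF \<theta> T] CT_scale[OF \<theta> v]
      by (simp add: coframe_frame[OF E])
    then show ?thesis
      using D.conn_form_eq[OF p E Z] D'.conn_form_eq[OF p E Z] Zp by simp
  qed
  have "(\<Sum>c\<in>UNIV. A p (E c p) * coframe M E c p v) = A p v"
    by (rule fun_cong[OF CT_expand[OF E A], symmetric])
  then show ?thesis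
    unfolding D.trace_form_def D'.trace_form_def \<Gamma> by (simp add: sum.distrib algebra_simps)
qed

lemma projective_change_closed:
  assumes D: "affine_connection M U D" and D': "affine_connection M U D'"
    and ch: "projective_change U D' D A"
    and sD: "symmetric_schouten M U D" and sD': "symmetric_schouten M U D'"
  shows "closed_form M U A"
proof -
  interpret D: affine_connection M U D by fact
  interpret D': affine_connection M U D' by fact
  have A: "form_near p A" if "p \<in> U" for p using ch that by (simp add: projective_change_def)
  show ?thesis
  proof (rule closed_formI[OF D.open_U A])
    fix p X Y assume p: "p \<in> U" and X: "vf_near p X" and Y: "vf_near p Y"
    obtain E where E: "frame_near p E" by (rule ex_frame)
    note v = frame_near_vf[OF E]
    have "ext_deriv M A (E a) (E b) p = 0" for a b
    proof -
      have "ext_deriv M (D'.trace_form E) (E a) (E b) p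
        = ext_deriv M (\<lambda>q v. 1 * D.trace_form E q v + (real CARD('n) + 1) * A q v) (E a) (E b) p"
      proof (rule ext_deriv_cong[OF v v])
        show "\<forall>\<^sub>F q in nhds p. \<forall>v\<in>TT q. D'.trace_form E q v = 1 * D.trace_form E q v + (real CARD('n) + 1) * A q v"
          using eventually_conj[OF D.eventually_U[OF p] frame_near_eventually[OF E]]
          by eventually_elim (simp add: trace_form_projective_change[OF D D' ch])
      qed
      also have "\<dots> = 1 * ext_deriv M (D.trace_form E) (E a) (E b) p + (real CARD('n) + 1) * ext_deriv M A (E a) (E b) p"
        by (rule ext_deriv_lincomb[OF v v D.form_near_trace_form[OF p E] A[OF p]])
      finally show ?thesis
        using sD sD' p E unfolding D.symmetric_schouten_iff D'.symmetric_schouten_iff by simp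
    qed
    then show "ext_deriv M A X Y p = 0" by (rule D.ext_deriv_eq_zeroI[OF p E A[OF p] _ X Y])
  qed
qed

text \<open>The connection is changed by \<open>A = - flat g p (\<mu> p)\<close>: then contracting
  \<open>g\<close> with \<open>A\<close> gives \<open>- \<mu>\<close>, which removes the right-hand
  side of the metrisability equation, and the conformal factor removes the rest. The result is
  parallel, so its inverse is the metric sought. The set \<open>B\<close> is where the closed form
  \<open>A\<close> has a potential.\<close>

lemma projectively_metric_if_metrisable:
  assumes D: "affine_connection M U D" and g: "tensor_field M U g" and \<mu>: "vector_field M U \<mu>"
    and met: "metrisability_eq M U D g \<mu>" and sym: "symmetric_schouten M U D"
    and B: "open B" "B \<subseteq> U" "closed_forms_are_gradients M B"
  shows "projectively_metric M B D"
proof -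
  interpret U: affine_connection M U D by fact
  interpret gU: tensor_field M U g by fact
  have DB: "affine_connection M B D"
    by (rule affine_connectionI[OF B(1) torsionless_connection_subset[OF U.torsionless B(2)]])
  interpret B: affine_connection M B D by fact
  have gB: "tensor_field M B g" by (rule tensor_field_subset[OF g B(2,1)])
  interpret gB: tensor_field M B g by fact
  have ext: "metrisability_eq_ext M U D g \<mu>" using met U.metrisability_eq_iff_ext[OF gU.sym_tensor] by blast
  have "closed_form M B (\<lambda>p. flat g p (\<mu> p))"
    by (rule closed_form_subset[OF U.closed_form_flat[OF g \<mu> ext sym] B(2)])
  then obtain \<phi> where \<phi>: "smooth_fun M B \<phi>" "\<forall>p\<in>B. flat g p (\<mu> p) = differential M \<phi> p"
    using B(3) unfolding closed_forms_are_gradients_def by blast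
  have sm\<phi>: "sm p \<phi>" if "p \<in> B" for p using \<phi>(1) that by (simp add: smooth_fun_iff[OF B(1)])
  \<comment> \<open>\<open>\<phi>\<close> is a potential of the covector dual to
    \<open>\<mu>\<close>; the form of the change is its negative, so the sign moves to the
    potential.\<close>
  define \<psi> where "\<psi> q = - \<phi> q" for q
  have sm\<psi>: "sm p \<psi>" if "p \<in> B" for p unfolding \<psi>_def by (rule sm_uminus[OF sm\<phi>[OF that]])
  \<comment> \<open>This is \<open>- flat g q (\<mu> q)\<close>, in the shape of a linear
    combination expected by \<open>form_near_lincomb\<close> and
    \<open>tensor_linear\<close>.\<close>
  define A where "A q v = (-1) * flat g q (\<mu> q) v + 0 * flat g q (\<mu> q) v" for q v
  have \<mu>p: "vf_near p \<mu>" if "p \<in> B" for p using \<mu> that B(2) by (auto simp: vector_field_iff[OF U.open_U])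
  have A: "form_near p A" if "p \<in> B" for p
    unfolding A_def[abs_def] by (intro form_near_lincomb gB.form_near_flat[OF that \<mu>p[OF that]])
  have Ad: "A p = differential M \<psi> p" if p: "p \<in> B" for p
  proof
    fix v show "A p v = differential M \<psi> p v"
      using \<phi>(2) p tv_uminus[OF _ sm\<phi>[OF p]] by (simp add: A_def differential_def \<psi>_def[abs_def])
  qed
  define D' where "D' = (\<lambda>X Y p f. D X Y p f + A p (X p) * Y p f + A p (Y p) * X p f)"
  have D': "affine_connection M B D'"
    unfolding D'_def by (rule affine_connectionI[OF B(1) B.torsionless_projective_change[OF A]])
  interpret D': affine_connection M B D' by fact
  have ch: "projective_change B D' D A" unfolding projective_change_def by (simp add: A D'_def)
  let ?g = "\<lambda>q \<alpha> \<beta>. exp (- 2 * \<psi> q) * g q \<alpha> \<beta>"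
  have g': "tensor_field M B ?g" by (rule tensor_field_conformal[OF gB sm_cmult[OF sm\<psi>]])
  interpret g': tensor_field M B ?g by fact
  have "metrisability_eq_ext M B D' ?g (\<lambda>p f. 0)"
    unfolding D'.metrisability_eq_ext_iff
  proof (intro ballI allI impI)
    fix p E a b assume p: "p \<in> B" and E: "frame_near p E"
    have pU: "p \<in> U" using p B(2) by blast
    have \<mu>T: "\<mu> p \<in> TT p" by (rule vf_near_TT[OF \<mu>p[OF p]])
    note \<theta> = coframe_CT[OF E]
    have Ap: "A p \<in> CT p" by (rule form_near_CT[OF A[OF p]])
    have gA: "g p (A p) (coframe M E b p) = - coframe M E b p (\<mu> p)" for b
      using tensor_linear[OF gB.bilinear[OF p] gB.flat_CT[OF p \<mu>T] gB.flat_CT[OF p \<mu>T] \<theta>, of "-1" 0 b]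
        gB.flat_apply[OF p \<mu>T \<theta>] by (simp add: A_def[abs_def])
    have "ext_cov_deriv M D' ?g E a b p (E c p) = 0" for c
      unfolding ext_cov_deriv_projective_change[OF DB D' gB sm\<psi>[OF p] ch Ad[OF p] p E frame_near_vf[OF E]]
        tensor_sym[OF gB.bilinear[OF p] \<theta> Ap] gA
      using ext[unfolded U.metrisability_eq_ext_iff, rule_format, OF pU E, of a b] by simp
    then have "ext_cov_deriv M D' ?g E a b p = (\<lambda>v. 0)"
      by (intro CT_eqI[OF E D'.ext_cov_deriv_CT[OF E] CT_zero])
    then show "ext_cov_deriv M D' ?g E a b p = (\<lambda>v. coframe M E a p (\<lambda>f. 0) * coframe M E b p v
      + coframe M E b p (\<lambda>f. 0) * coframe M E a p v)"
      by (simp add: CT_zero_vec[OF \<theta>])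
  qed
  then have "levi_civita M B (flat ?g) D'" by (rule D'.levi_civita_if_parallel[OF g'])
  moreover have "projectively_equivalent M B D D'"
    by (rule projectively_equivalent_sym[OF B(1)]) (use ch in \<open>auto simp: projectively_equivalent_iff[OF B(1)]\<close>)
  ultimately show ?thesis unfolding projectively_metric_def using g'.metric_flat by blast
qed

lemma symmetric_schouten_levi_civita:
  assumes U: "open U" and g: "metric M U g" and lc: "levi_civita M U g D"
  shows "symmetric_schouten M U D"
proof -
  interpret D: affine_connection M U D
    by (rule affine_connectionI[OF U]) (use lc in \<open>simp add: levi_civita_def\<close>)
  interpret g: metric_field M U g by unfold_locales (rule U, rule g)
  show ?thesis
    by (rule D.symmetric_schouten_if_parallel[OF g.tensor_field_inverse_metric
          D.parallel_if_levi_civita[OF g.metric_field_axioms lc]])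
qed

text \<open>\<open>D\<close> and the Levi-Civita connection \<open>D'\<close> are both special, so
  the form between them is closed and has a potential here. The inverse metric is parallel for
  \<open>D'\<close>, and reading the transformation law backwards gives a solution for
  \<open>D\<close>.\<close>

lemma metrisable_if_projectively_metric:
  assumes D: "affine_connection M U D" and sym: "symmetric_schouten M U D"
    and gm: "metric M U gm" and lc: "levi_civita M U gm D'"
    and pe: "projectively_equivalent M U D' D" and grad: "closed_forms_are_gradients M U"
  shows "\<exists>g \<mu>. sym_tensor M U g \<and> nondegenerate_tensor M U g \<and> vector_field M U \<mu> \<and> metrisability_eq M U D g \<mu>"
proof -
  interpret D: affine_connection M U D by fact
  note U = D.open_U
  have D': "affine_connection M U D'"
    by (rule affine_connectionI[OF U]) (use lc in \<open>simp add: levi_civita_def\<close>)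
  interpret D': affine_connection M U D' by fact
  interpret gm: metric_field M U gm by unfold_locales (rule U, rule gm)
  obtain A where ch: "projective_change U D' D A" using pe by (auto simp: projectively_equivalent_iff[OF U])
  have A: "form_near p A" if "p \<in> U" for p using ch that by (simp add: projective_change_def)
  have "closed_form M U A"
    by (rule projective_change_closed[OF D D' ch sym symmetric_schouten_levi_civita[OF U gm lc]])
  then obtain \<phi> where \<phi>: "smooth_fun M U \<phi>" "\<forall>p\<in>U. A p = differential M \<phi> p"
    using grad unfolding closed_forms_are_gradients_def by blast
  have sm\<phi>: "sm p \<phi>" if "p \<in> U" for p using \<phi>(1) that by (simp add: smooth_fun_iff[OF U])
  define g where "g p \<alpha> \<beta> = exp (2 * \<phi> p) * gm.inverse_metric p \<alpha> \<beta>" for p \<alpha> \<beta>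
  have g: "tensor_field M U g"
    unfolding g_def[abs_def] by (rule tensor_field_conformal[OF gm.tensor_field_inverse_metric sm_cmult[OF sm\<phi>]])
  interpret g: tensor_field M U g by fact
  \<comment> \<open>The factor in \<open>g\<close> is the one that the transformation law undoes:
    its rescaled tensor is the parallel inverse metric.\<close>
  have g': "(\<lambda>q \<alpha> \<beta>. exp (- 2 * \<phi> q) * g q \<alpha> \<beta>) = gm.inverse_metric"
    by (intro ext) (simp add: g_def mult.assoc[symmetric] mult_exp_exp)
  \<comment> \<open>Index raising is done with \<open>gm\<close>, so the conformal factor of
    \<open>g\<close> has to be supplied; altogether this is \<open>A\<close> raised with
    \<open>g\<close>, up to sign.\<close>
  define \<mu> where "\<mu> p f = (- exp (2 * \<phi> p)) * sharp gm p (A p) f" for p f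
  have \<mu>: "vector_field M U \<mu>"
    unfolding vector_field_iff[OF U] \<mu>_def[abs_def]
    by (intro ballI vf_near_scale sm_uminus sm_exp sm_cmult sm\<phi> gm.vf_near_sharp A)
  have "metrisability_eq_ext M U D g \<mu>"
    unfolding D.metrisability_eq_ext_iff
  proof (intro ballI allI impI)
    fix p E a b assume p: "p \<in> U" and E: "frame_near p E"
    note \<theta> = coframe_CT[OF E]
    have Ap: "A p \<in> CT p" by (rule form_near_CT[OF A[OF p]])
    have gA: "g p (A p) (coframe M E b p) = - coframe M E b p (\<mu> p)" for b
      unfolding g_def gm.inverse_metric_def \<mu>_def[abs_def] CT_scale[OF \<theta> gm.sharp_TT[OF p Ap]] by simp
    have par: "ext_cov_deriv M D' gm.inverse_metric E a b p (E c p) = 0" for c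
      using D'.parallel_if_levi_civita[OF gm.metric_field_axioms lc, unfolded D'.metrisability_eq_ext_iff, rule_format, OF p E, of a b]
      by (simp add: CT_zero_vec[OF \<theta>])
    show "ext_cov_deriv M D g E a b p = (\<lambda>v. coframe M E a p (\<mu> p) * coframe M E b p v + coframe M E b p (\<mu> p) * coframe M E a p v)"
    proof (rule CT_eqI[OF E D.ext_cov_deriv_CT[OF E] CT_lincomb[OF \<theta> \<theta>]])
      fix c
      have "exp (- 2 * \<phi> p) * (ext_cov_deriv M D g E a b p (E c p)
        + coframe M E a p (E c p) * g p (A p) (coframe M E b p)
        + coframe M E b p (E c p) * g p (coframe M E a p) (A p)) = 0"
        using ext_cov_deriv_projective_change[OF D D' g sm\<phi>[OF p] ch bspec[OF \<phi>(2) p] p E frame_near_vf[OF E, of c], of a b]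
        unfolding g' par by simp
      then have "ext_cov_deriv M D g E a b p (E c p)
        + coframe M E a p (E c p) * g p (A p) (coframe M E b p)
        + coframe M E b p (E c p) * g p (coframe M E a p) (A p) = 0"
        unfolding mult_eq_0_iff by simp
      then show "ext_cov_deriv M D g E a b p (E c p)
          = coframe M E a p (\<mu> p) * coframe M E b p (E c p) + coframe M E b p (\<mu> p) * coframe M E a p (E c p)"
        unfolding tensor_sym[OF g.bilinear[OF p] \<theta> Ap] gA by (simp add: algebra_simps)
    qed
  qed
  then have "metrisability_eq M U D g \<mu>" using D.metrisability_eq_iff_ext[OF g.sym_tensor] by blast
  then show ?thesis using g.sym_tensor g.nondegenerate \<mu> by blast
qed

text \<open>The Levi-Civita connection is itself special, hence the subclass is not empty. Any other
  member is projectively equivalent to it by transitivity, which reduces the claim to a pair of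
  special connections.\<close>

lemma special_subclass_if_projectively_metric:
  assumes U: "open U" and grad: "closed_forms_are_gradients M U" and pm: "projectively_metric M U Dt"
  shows "\<exists>S. special_subclass M U (projective_class M U Dt) S \<and>
            (\<forall>D\<in>S. \<exists>g \<mu>. sym_tensor M U g \<and> nondegenerate_tensor M U g \<and>
               vector_field M U \<mu> \<and> metrisability_eq M U D g \<mu>)"
proof -
  obtain gm D' where gm: "metric M U gm" and lc: "levi_civita M U gm D'" and pe: "projectively_equivalent M U Dt D'"
    using pm unfolding projectively_metric_def by blast
  let ?S = "{D\<in>projective_class M U Dt. symmetric_schouten M U D}"
  have "D' \<in> ?S"
    using lc projectively_equivalent_sym[OF U pe] symmetric_schouten_levi_civita[OF U gm lc]
    by (simp add: projective_class_def levi_civita_def)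
  then have "special_subclass M U (projective_class M U Dt) ?S" unfolding special_subclass_def by blast
  moreover have "\<exists>g \<mu>. sym_tensor M U g \<and> nondegenerate_tensor M U g \<and> vector_field M U \<mu> \<and> metrisability_eq M U D g \<mu>"
    if "D \<in> ?S" for D
  proof -
    have D: "torsionless_connection M U D" "projectively_equivalent M U D Dt" "symmetric_schouten M U D"
      using that by (simp_all add: projective_class_def)
    have "projectively_equivalent M U D' D"
      by (rule projectively_equivalent_sym[OF U projectively_equivalent_trans[OF U D(2) pe]])
    then show ?thesis
      by (rule metrisable_if_projectively_metric[OF affine_connectionI[OF U D(1)] D(3) gm lc _ grad])
  qed
  ultimately show ?thesis by blast
qed

text \<open>A single member with a solution is enough, and nonemptiness of the subclass provides
  one. The metric is found on \<open>B\<close>, where potentials exist, and transitivity carries the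
  result over to \<open>Dt\<close>.\<close>

lemma projectively_metric_if_special_subclass:
  assumes U: "open U" and B: "open B" "B \<subseteq> U" "closed_forms_are_gradients M B"
    and S: "special_subclass M U (projective_class M U Dt) S"
    and met: "\<forall>D\<in>S. \<exists>g \<mu>. sym_tensor M U g \<and> nondegenerate_tensor M U g \<and>
               vector_field M U \<mu> \<and> metrisability_eq M U D g \<mu>"
  shows "projectively_metric M B Dt"
proof -
  obtain D where "D \<in> S" using S unfolding special_subclass_def by blast
  then have D: "torsionless_connection M U D" "projectively_equivalent M U D Dt" "symmetric_schouten M U D"
    using S by (simp_all add: special_subclass_def projective_class_def)
  obtain g \<mu> where g: "sym_tensor M U g" "nondegenerate_tensor M U g" "vector_field M U \<mu>" "metrisability_eq M U D g \<mu>"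
    using met \<open>D \<in> S\<close> by blast
  have "tensor_field M U g" by unfold_locales (rule U, rule g(1), rule g(2))
  from projectively_metric_if_metrisable[OF affine_connectionI[OF U D(1)] this g(3,4) D(3) B]
  obtain gm D' where gm: "metric M B gm" "levi_civita M B gm D'" "projectively_equivalent M B D D'"
    unfolding projectively_metric_def by blast
  have "projectively_equivalent M B Dt D"
    by (rule projectively_equivalent_sym[OF B(1) projectively_equivalent_subset[OF D(2) B(2) U B(1)]])
  then have "projectively_equivalent M B Dt D'"
    by (rule projectively_equivalent_trans[OF B(1) _ gm(3)])
  then show ?thesis using gm unfolding projectively_metric_def by blast
qed

end

text \<open>A special projective subclass is meant to be given modulo gradients. On the whole
  manifold this is secured by \<open>closed_forms_are_gradients\<close>; without it the equivalence
  is asserted around every point. The last clause identifies the two notations for the differential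
  equation.\<close>

theorem theorem2p7:
  fixes M :: "('m::{t2_space, second_countable_topology}, 'n::finite) atlas"
    and Dt :: "'m conn"
  assumes "smooth_manifold M"
    and "CARD('n) \<ge> 2"
    and "torsionless_connection M UNIV Dt"
  shows
    "(closed_forms_are_gradients M UNIV \<longrightarrow>
        (projectively_metric M UNIV Dt \<longleftrightarrow>
          (\<exists>S. special_subclass M UNIV (projective_class M UNIV Dt) S \<and>
            (\<forall>D\<in>S. \<exists>g \<mu>. sym_tensor M UNIV g \<and> nondegenerate_tensor M UNIV g \<and>
               vector_field M UNIV \<mu> \<and> metrisability_eq M UNIV D g \<mu>)))) \<and>
     ((\<forall>p. \<exists>U. open U \<and> p \<in> U \<and> projectively_metric M U Dt) \<longleftrightarrow>
      (\<forall>p. \<exists>U. open U \<and> p \<in> U \<and>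
          (\<exists>S. special_subclass M U (projective_class M U Dt) S \<and>
            (\<forall>D\<in>S. \<exists>g \<mu>. sym_tensor M U g \<and> nondegenerate_tensor M U g \<and>
               vector_field M U \<mu> \<and> metrisability_eq M U D g \<mu>)))) \<and>
     (\<forall>U D g \<mu>. open U \<longrightarrow> torsionless_connection M U D \<longrightarrow> sym_tensor M U g \<longrightarrow>
        vector_field M U \<mu> \<longrightarrow> (metrisability_eq M U D g \<mu> \<longleftrightarrow> metrisability_eq_ext M U D g \<mu>))"
proof -
  interpret manifold M by unfold_locales (rule assms(1))
  let ?metrisable = "\<lambda>U. \<exists>S. special_subclass M U (projective_class M U Dt) S \<and>
            (\<forall>D\<in>S. \<exists>g \<mu>. sym_tensor M U g \<and> nondegenerate_tensor M U g \<and>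
               vector_field M U \<mu> \<and> metrisability_eq M U D g \<mu>)"
  have 1: "projectively_metric M UNIV Dt \<longleftrightarrow> ?metrisable UNIV" if grad: "closed_forms_are_gradients M UNIV"
  proof
    assume "projectively_metric M UNIV Dt"
    then show "?metrisable UNIV" by (rule special_subclass_if_projectively_metric[OF open_UNIV grad])
  next
    assume "?metrisable UNIV"
    then show "projectively_metric M UNIV Dt"
      by (elim exE conjE) (rule projectively_metric_if_special_subclass[OF open_UNIV open_UNIV subset_refl grad])
  qed
  have 2: "(\<forall>p. \<exists>U. open U \<and> p \<in> U \<and> projectively_metric M U Dt) \<longleftrightarrow> (\<forall>p. \<exists>U. open U \<and> p \<in> U \<and> ?metrisable U)"
  proof (intro iffI allI)
    fix p assume "\<forall>p. \<exists>U. open U \<and> p \<in> U \<and> projectively_metric M U Dt"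
    then obtain U where U: "open U" "p \<in> U" "projectively_metric M U Dt" by blast
    \<comment> \<open>\<open>U\<close> is an arbitrary neighbourhood and may carry closed forms that
      are not gradients. Metrisability restricts to a smaller ball where they are.\<close>
    obtain B where B: "open B" "p \<in> B" "B \<subseteq> U" "closed_forms_are_gradients M B"
      by (rule ex_nbhd_closed_forms_are_gradients[OF U(1,2)])
    have "?metrisable B"
      by (rule special_subclass_if_projectively_metric[OF B(1,4) projectively_metric_subset[OF U(3) B(3) U(1) B(1)]])
    then show "\<exists>U. open U \<and> p \<in> U \<and> ?metrisable U" using B(1,2) by (intro exI[of _ B] conjI)
  next
    fix p assume local: "\<forall>p. \<exists>U. open U \<and> p \<in> U \<and> ?metrisable U"
    obtain U where "open U \<and> p \<in> U \<and> ?metrisable U" by (rule exE[OF spec[OF local]])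
    then have U: "open U" "p \<in> U" "?metrisable U" by simp_all
    \<comment> \<open>Here the solution stays on \<open>U\<close>; only the potential, and with it
      the metric, is sought on the smaller set.\<close>
    obtain B where B: "open B" "p \<in> B" "B \<subseteq> U" "closed_forms_are_gradients M B"
      by (rule ex_nbhd_closed_forms_are_gradients[OF U(1,2)])
    have "projectively_metric M B Dt"
      using U(3) by (elim exE conjE) (rule projectively_metric_if_special_subclass[OF U(1) B(1,3,4)])
    then show "\<exists>U. open U \<and> p \<in> U \<and> projectively_metric M U Dt" using B(1,2) by (intro exI[of _ B] conjI)
  qed
  have 3: "metrisability_eq M U D g \<mu> \<longleftrightarrow> metrisability_eq_ext M U D g \<mu>"
    if "open U" "torsionless_connection M U D" "sym_tensor M U g" for U D g \<mu>
  proof -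
    interpret affine_connection M U D by (rule affine_connectionI[OF that(1,2)])
    show ?thesis by (rule metrisability_eq_iff_ext[OF that(3)])
  qed
  show ?thesis
    by (intro conjI allI impI 1 2 3)
qed

end
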